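(* Let $m\ge3$, $\rho=\frac12+\frac1m$, and $0<\delta\le\frac{\pi}{m+2}$. Then $$f(0,a,\lambda)=\bigl[1+O(\lambda^{-\rho})\bigr]\lambda^{-\frac14}\exp[L(a,\lambda)],\qquad f'(0,a,\lambda)=-\bigl[1+O(\lambda^{-\rho})\bigr]\lambda^{\frac14}\exp[L(a,\lambda)]$$ as $\lambda\to\infty$ in the sector $|\arg\lambda|\le\pi-\delta$, uniformly for $a$ in any compact subset of $\mathbb C^m$ (powers of $\lambda$ are principal branches).
   Context: For $a=(a_1,\dots,a_m)\in\mathbb C^m$ let $P(z)=a_1z^{m-1}+\dots+a_m$. Let $b_{j,k}(a)$ ($j\ge1$, $1\le k\le j$) be the coefficient of $z^{mk-j}$ in $\binom{1/2}{k}P(z)^k$, $b_j(a)=\sum_{k=1}^jb_{j,k}(a)$, $\nu(a)=0$ for $m$ odd, $\nu(a)=b_{\frac m2+1}(a)$ for $m$ even, and $\mu(a)=\frac m4-\nu(a)$. Let $F(z,a,\lambda)=\frac{2}{m+2}z^{\frac{m+2}2}+\sum_{1\le j<\frac{m+2}2}\frac{2}{m+2-2j}b_j(a)z^{\frac12(m+2-2j)}$. $f(z,a,\lambda)$ denotes Sibuya's solution of $-y''+(z^m+P(z)+\lambda)y=0$ in the complex $z$-plane: the solution, entire in $(z,a,\lambda)$, with $f(z,a,\lambda)=z^{\mu(a)-\frac m2}(1+O(z^{-1/2}))\exp[-F(z,a,\lambda)]$ and $f'(z,a,\lambda)=-z^{\mu(a)}(1+O(z^{-1/2}))\exp[-F(z,a,\lambda)]$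 as $z\to\infty$ in $|\arg z|\le\frac{3\pi}{m+2}-\varepsilon$ for every $\varepsilon>0$ (principal branches); $f'=\partial f/\partial z$. Further $$L(a,\lambda)=\int_0^{\infty}\Bigl(\sqrt{x^m+P(x)+\lambda}-x^{\frac m2}-\sum_{j=1}^{\lfloor\frac{m+1}2\rfloor}b_j(a)x^{\frac m2-j}-\frac{\nu(a)}{x+1}\Bigr)dx,$$ with principal square root, defined for $|\lambda|$ large in $|\arg\lambda|\le\pi-\delta$. *)

theory Defs
  imports "HOL-Analysis.Analysis" "HOL-Computational_Algebra.Polynomial"
begin

text \<open>Coefficients a = (a_1,...,a_m) are represented as a function nat => complex;
  only the values a 1, ..., a m are used.\<close>

definition Ppoly :: "nat \<Rightarrow> (nat \<Rightarrow> complex) \<Rightarrow> complex poly" where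
  "Ppoly m a = (\<Sum>i=1..m. monom (a i) (m - i))"

definition bjk :: "nat \<Rightarrow> (nat \<Rightarrow> complex) \<Rightarrow> nat \<Rightarrow> nat \<Rightarrow> complex" where
  "bjk m a j k = (if j \<le> m * k
      then ((1/2 :: complex) gchoose k) * coeff (Ppoly m a ^ k) (m * k - j) else 0)"

definition bj :: "nat \<Rightarrow> (nat \<Rightarrow> complex) \<Rightarrow> nat \<Rightarrow> complex" where
  "bj m a j = (\<Sum>k=1..j. bjk m a j k)"

definition nu :: "nat \<Rightarrow> (nat \<Rightarrow> complex) \<Rightarrow> complex" where
  "nu m a = (if odd m then 0 else bj m a (m div 2 + 1))"

definition mu :: "nat \<Rightarrow> (nat \<Rightarrow> complex) \<Rightarrow> complex" where
  "mu m a = of_real (real m / 4) - nu m a"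

definition Fexp :: "nat \<Rightarrow> (nat \<Rightarrow> complex) \<Rightarrow> complex \<Rightarrow> complex" where
  "Fexp m a z = of_real (2 / (real m + 2)) * z powr (of_real ((real m + 2) / 2))
     + (\<Sum>j\<in>{j. 1 \<le> j \<and> 2 * j < m + 2}.
          of_real (2 / (real m + 2 - 2 * real j)) * bj m a j
            * z powr (of_real ((real m + 2 - 2 * real j) / 2)))"

definition sibuya_sol :: "nat \<Rightarrow> (nat \<Rightarrow> complex) \<Rightarrow> complex \<Rightarrow> (complex \<Rightarrow> complex) \<Rightarrow> bool" where
  "sibuya_sol m a lam g \<longleftrightarrow>
     g holomorphic_on UNIV \<and>
     (\<forall>z. (deriv ^^ 2) g z = (z ^ m + poly (Ppoly m a) z + lam) * g z) \<and>
     (\<forall>eps>0. \<exists>C R. \<forall>z. z \<noteq> 0 \<and> norm z \<ge> R \<and> \<bar>Arg z\<bar> \<le> 3 * pi / (real m + 2) - eps \<longrightarrow>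
        norm (g z - z powr (mu m a - of_real (real m / 2)) * exp (- Fexp m a z))
          \<le> C * norm z powr (-1/2) * norm (z powr (mu m a - of_real (real m / 2)) * exp (- Fexp m a z))
      \<and> norm (deriv g z - (- (z powr (mu m a) * exp (- Fexp m a z))))
          \<le> C * norm z powr (-1/2) * norm (z powr (mu m a) * exp (- Fexp m a z)))"

definition sibuya :: "nat \<Rightarrow> (nat \<Rightarrow> complex) \<Rightarrow> complex \<Rightarrow> complex \<Rightarrow> complex" where
  "sibuya m a lam = (THE g. sibuya_sol m a lam g)"

definition Lint :: "nat \<Rightarrow> (nat \<Rightarrow> complex) \<Rightarrow> complex \<Rightarrow> complex" where
  "Lint m a lam = integral {0<..}
     (\<lambda>x::real. csqrt (of_real x ^ m + poly (Ppoly m a) (of_real x) + lam)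
        - of_real (x powr (real m / 2))
        - (\<Sum>j=1..(m + 1) div 2. bj m a j * of_real (x powr (real m / 2 - real j)))
        - nu m a / (of_real x + 1))"

end

theory Submission
  imports Defs
    "HOL-Complex_Analysis.Complex_Analysis"
    "HOL-Computational_Algebra.Fundamental_Theorem_Algebra"
    "HOL-Real_Asymp.Real_Asymp"
begin

text \<open>A solution is written in Liouville-Green form \<open>y = S\<^sup>-\<^sup>1\<^sup>/\<^sup>2 exp (- \<Xi>) U\<close> with \<open>\<Xi>' = S\<close>. Together
  with a multiple \<open>B\<close> of \<open>U'\<close> the factor \<open>U\<close> satisfies a linear system whose only coupling is an integrable
  error \<open>k\<close>, so along every path on which \<open>Re \<Xi>\<close> increases, \<open>U\<close> and \<open>B\<close> stay close to their values at
  the far end.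

  On the half-line \<open>[0, \<infinity>)\<close> take \<open>S\<close> to be the exact square root of the potential: the integral of
  \<open>\<bar>k\<bar>\<close> is then of order \<open>\<lambda>\<^sup>-\<^sup>1\<^sup>/\<^sup>2\<^sup>-\<^sup>1\<^sup>/\<^sup>m\<close>, the normalisation at infinity contributes the factor
  \<open>exp L\<close>, and the value at \<open>0\<close> follows. The same estimate applied to a difference of two solutions gives
  uniqueness of the Sibuya solution.

  For existence take \<open>S\<close> to be the truncated expansion of the square root. In the coordinate
  \<open>z\<^sup>(\<^sup>m\<^sup>+\<^sup>2\<^sup>)\<^sup>/\<^sup>2 = e\<^sup>i\<^sup>\<beta> w\<close> with \<open>\<beta>\<close> close to \<open>\<plusminus> \<pi>/2\<close>, straight segments towards large positive \<open>w\<close>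
  are admissible paths, and they reach a whole half of the sector. Solutions prescribed at far away points
  converge along a subsequence, and the limit inherits the estimates.\<close>

section \<open>Entire solutions of a linear equation with polynomial coefficient\<close>

text \<open>Two choices of \<open>S\<close> occur because their virtues conflict. The exact root
  makes the defect \<open>Q - S^2\<close> vanish and gives bounds uniform in \<open>a\<close>, but
  away from the half-line it may branch at zeros of the potential. The truncated root is analytic in
  the slit plane; its constants depend on \<open>a\<close> and \<open>lam\<close>, which suffices
  for the asymptotics of one fixed solution. The exponent comes from scaling: with \<Lambda> =
  |lam|^(1/m) the potential has size (x + \<Lambda>)^m and \<open>k\<close> has size (x +
  \<Lambda>)^(-m/2-2), whose integral has order \<Lambda>^(-m/2-1) = |lam|^(-1/2-1/m). The sector
  |arg z| < 3 \<pi>/(m+2) becomes |arg| < 3 \<pi>/2 for z^((m+2)/2), whereas segments towards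
  positive \<open>w\<close> start only from |arg w| < \<pi>. One rotation \<beta> therefore reaches
  one half of the sector, and the solutions for the two halves and for different margins must be
  identified afterwards. This is done on the positive axis, where uniqueness follows once the
  integral of |k| from 0 on is small, that is, for large \<open>lam\<close>.\<close>

fun ode_coeff :: "complex poly \<Rightarrow> complex \<Rightarrow> complex \<Rightarrow> nat \<Rightarrow> complex" where
  "ode_coeff q A B n = (if n = 0 then A else if n = 1 then B
     else (\<Sum>i\<le>n - 2. coeff q i * ode_coeff q A B (n - 2 - i)) / of_nat (n * (n - 1)))"

declare ode_coeff.simps [simp del]

text \<open>Comparison of the coefficients of z^n in y'' = q y; \<open>A\<close> and
  \<open>B\<close> are the initial values of y and y'.\<close>

lemma ode_coeff_Suc_Suc:
  "of_nat ((n + 2) * (n + 1)) * ode_coeff q A B (n + 2) = (\<Sum>i\<le>n. coeff q i * ode_coeff q A B (n - i))"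
  by (subst ode_coeff.simps) (auto simp del: of_nat_mult of_nat_Suc of_nat_add)

text \<open>The convolution costs at most the constant factor \<open>G\<close>, and the division by
  \<open>n * (n - 1)\<close> beats it once \<open>n\<close> is large. Every ratio \<open>r\<close>
  is possible, so the power series converges everywhere.\<close>

lemma ode_coeff_bound:
  assumes "r > 0"
  obtains M where "\<And>n. norm (ode_coeff q A B n) \<le> M * r ^ n"
proof -
  \<comment> \<open>The factor multiplied by \<open>coeff q i\<close> in the recursion has index
    smaller by \<open>i + 2\<close>; measured against \<open>r ^ n\<close> this costs
    \<open>1 / r ^ (i + 2)\<close>.\<close>
  define G where "G = (\<Sum>i\<le>degree q. norm (coeff q i) / r ^ (i + 2))"
  have G0: "G \<ge> 0" unfolding G_def using assms by (auto intro!: sum_nonneg)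
  obtain N :: nat where N: "G \<le> real N" using real_arch_simple by blast
  define M where "M = (\<Sum>n\<le>N + 2. norm (ode_coeff q A B n) / r ^ n)"
  have M0: "M \<ge> 0" unfolding M_def using assms by (intro sum_nonneg) auto
  have "norm (ode_coeff q A B n) \<le> M * r ^ n" for n
  proof (induction n rule: less_induct)
    case (less n)
    show ?case
    proof (cases "n \<le> N + 2")
      case True
      have "norm (ode_coeff q A B n) / r ^ n \<le> M"
        unfolding M_def using True assms by (intro member_le_sum) auto
      then show ?thesis using assms by (simp add: field_simps)
    next
      case False
      then obtain k where k: "n = k + 2" "k > N" by (metis add.commute less_diff_conv not_le le_add_diff_inverse2 add_lessD1 linorder_not_less nat_le_linear)
      have "norm (of_nat ((k + 2) * (k + 1)) * ode_coeff q A B n) \<le> (\<Sum>i\<le>k. norm (coeff q i) * norm (ode_coeff q A B (k - i)))"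
        unfolding k(1) ode_coeff_Suc_Suc by (rule sum_norm_le) (simp add: norm_mult)
      also have "\<dots> \<le> (\<Sum>i\<le>k. norm (coeff q i) / r ^ (i + 2) * (M * r ^ n))"
      proof (rule sum_mono)
        fix i assume i: "i \<in> {..k}"
        have "norm (ode_coeff q A B (k - i)) \<le> M * r ^ (k - i)" using i k by (intro less) auto
        moreover have "r ^ (k - i) = r ^ n / r ^ (i + 2)" using i k assms by (auto simp: power_diff field_simps power_add[symmetric])
        ultimately have "norm (ode_coeff q A B (k - i)) \<le> M * r ^ n / r ^ (i + 2)" by (simp only: times_divide_eq_right)
        then have "norm (coeff q i) * norm (ode_coeff q A B (k - i)) \<le> norm (coeff q i) * (M * r ^ n / r ^ (i + 2))"
          by (intro mult_left_mono) auto
        then show "norm (coeff q i) * norm (ode_coeff q A B (k - i)) \<le> norm (coeff q i) / r ^ (i + 2) * (M * r ^ n)"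
          by simp
      qed
      also have "\<dots> = (\<Sum>i\<le>k. norm (coeff q i) / r ^ (i + 2)) * (M * r ^ n)" by (simp add: sum_distrib_right)
      also have "\<dots> \<le> G * (M * r ^ n)"
      proof (rule mult_right_mono)
        have "(\<Sum>i\<le>k. norm (coeff q i) / r ^ (i + 2)) \<le> (\<Sum>i\<in>{..k} \<union> {..degree q}. norm (coeff q i) / r ^ (i + 2))"
          using assms by (intro sum_mono2) auto
        also have "\<dots> = G" unfolding G_def
          by (rule sum.mono_neutral_right) (auto simp: coeff_eq_0)
        finally show "(\<Sum>i\<le>k. norm (coeff q i) / r ^ (i + 2)) \<le> G" .
      qed (use M0 assms in auto)
      also have "\<dots> \<le> real ((k + 2) * (k + 1)) * (M * r ^ n)"
      proof (rule mult_right_mono)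
        have "G \<le> real k" using N k by simp
        also have "\<dots> \<le> real ((k + 2) * (k + 1))" by (simp only: of_nat_le_iff) simp
        finally show "G \<le> real ((k + 2) * (k + 1))" .
      qed (use M0 assms in auto)
      finally have "real ((k + 2) * (k + 1)) * norm (ode_coeff q A B n) \<le> real ((k + 2) * (k + 1)) * (M * r ^ n)"
        by (simp only: norm_mult norm_of_nat)
      then show ?thesis by (rule mult_left_le_imp_le) (simp only: of_nat_0_less_iff, simp)
    qed
  qed
  then show ?thesis by (rule that)
qed

lemma entire_solution:
  fixes q :: "complex poly"
  obtains f f' where "\<And>z. (f has_field_derivative f' z) (at z)"
    "\<And>z. (f' has_field_derivative poly q z * f z) (at z)" "f 0 = A" "f' 0 = B"
proof -
  define F where "F = Abs_fps (ode_coeff q A B)"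
  have rad: "fps_conv_radius F = \<infinity>"
    unfolding fps_conv_radius_def F_def
  proof (rule conv_radius_inftyI'')
    fix z :: complex
    \<comment> \<open>This ratio makes \<open>r * norm z\<close> at most 1/2, so a geometric series
      dominates.\<close>
    define r where "r = 1 / (2 * (norm z + 1))"
    have r: "r > 0" "r * norm z \<le> 1/2" unfolding r_def by (auto simp: field_simps add_pos_nonneg)
    obtain M where M: "\<And>n. norm (ode_coeff q A B n) \<le> M * r ^ n" using ode_coeff_bound[OF r(1)] by metis
    have M0: "M \<ge> 0" using order_trans[OF norm_ge_zero M[of 0]] by simp
    show "summable (\<lambda>n. fps_nth (Abs_fps (ode_coeff q A B)) n * z ^ n)"
    proof (rule summable_comparison_test')
      show "summable (\<lambda>n. M * (1/2) ^ n)" by (intro summable_mult summable_geometric) auto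
      fix n :: nat
      have "norm (ode_coeff q A B n * z ^ n) \<le> M * r ^ n * norm z ^ n"
        using M by (simp add: norm_mult norm_power mult_right_mono)
      also have "\<dots> = M * (r * norm z) ^ n" by (simp add: power_mult_distrib)
      also have "\<dots> \<le> M * (1/2) ^ n" using r M0 by (intro mult_left_mono power_mono) auto
      finally show "norm (fps_nth (Abs_fps (ode_coeff q A B)) n * z ^ n) \<le> M * (1/2) ^ n" by simp
    qed
  qed
  have rad': "fps_conv_radius (fps_deriv F) = \<infinity>" using fps_conv_radius_deriv[of F] rad by simp
  have "fps_deriv (fps_deriv F) = fps_of_poly q * F"
  proof (rule fps_ext)
    fix n
    have "fps_deriv (fps_deriv F) $ n = of_nat ((n + 2) * (n + 1)) * ode_coeff q A B (n + 2)"
      by (simp add: F_def algebra_simps numeral_2_eq_2)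
    also have "\<dots> = (fps_of_poly q * F) $ n"
      unfolding ode_coeff_Suc_Suc by (simp add: fps_mult_nth F_def atLeast0AtMost)
    finally show "fps_deriv (fps_deriv F) $ n = (fps_of_poly q * F) $ n" .
  qed
  then have e: "eval_fps (fps_deriv (fps_deriv F)) z = poly q z * eval_fps F z" for z
    using rad by (simp add: eval_fps_mult)
  show ?thesis
  proof (rule that)
    fix z
    show "(eval_fps F has_field_derivative eval_fps (fps_deriv F) z) (at z)"
      by (rule has_field_derivative_eval_fps) (simp add: rad)
    show "(eval_fps (fps_deriv F) has_field_derivative poly q z * eval_fps F z) (at z)"
      unfolding e[symmetric] by (rule has_field_derivative_eval_fps) (simp add: rad')
    show "eval_fps F 0 = A" by (simp add: eval_fps_at_0 F_def ode_coeff.simps)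
    show "eval_fps (fps_deriv F) 0 = B" by (simp add: eval_fps_at_0 F_def ode_coeff.simps)
  qed
qed

section \<open>A priori estimate for a triangular system\<close>

text \<open>\<open>M x - M b\<close> bounds the integral of |k| over [x, b]. Two combinations remove
  the possibly large factor \<open>s\<close>: multiplying \<open>B\<close> by
  \<open>exp (- 2 * \<Xi>)\<close> removes the term linear in \<open>B\<close>, and in
  \<open>U + B\<close> the terms with \<open>s\<close> cancel. The maximum of |U| is then absorbed
  because \<open>M x0\<close> is at most 1/4.\<close>

lemma system_estimate:
  fixes U B s k \<Xi> :: "real \<Rightarrow> complex" and M D :: "real \<Rightarrow> real" and c :: complex
  assumes "x0 \<le> b"
    and U': "\<And>t. t \<in> {x0..b} \<Longrightarrow> (U has_vector_derivative - 2 * s t * B t) (at t within {x0..b})"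
    and B': "\<And>t. t \<in> {x0..b} \<Longrightarrow> (B has_vector_derivative 2 * s t * B t - k t * U t) (at t within {x0..b})"
    and X': "\<And>t. t \<in> {x0..b} \<Longrightarrow> (\<Xi> has_vector_derivative s t) (at t within {x0..b})"
    and M': "\<And>t. t \<in> {x0..b} \<Longrightarrow> (M has_real_derivative - D t) (at t within {x0..b})"
    and s0: "\<And>t. t \<in> {x0..b} \<Longrightarrow> Re (s t) \<ge> 0"
    and kD: "\<And>t. t \<in> {x0..b} \<Longrightarrow> norm (k t) \<le> D t"
    and Mb: "M b \<ge> 0" and M0: "M x0 \<le> 1/4"
    and Ub: "norm (U b - c) \<le> e" and Bb: "norm (B b) \<le> e"
  shows "norm (U x0 - c) \<le> 4 * (norm c + 3 * e) * M x0 + 3 * e"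
    and "norm (B x0) \<le> 2 * (norm c + 3 * e) * M x0 + e"
proof -
  have int: "at t within {x0..b} = at t" if "x0 < t" "t < b" for t
    using that at_within_Icc_at by blast
  have sub: "(f has_vector_derivative f') (at t)"
    if "x0 < t" "t < b" "(f has_vector_derivative f') (at t within {x0..b})" for f :: "real \<Rightarrow> 'n::real_normed_vector" and f' t
    using that int by simp
  have cU: "continuous_on {x0..b} U" by (rule continuous_on_vector_derivative) (rule U')
  have cB: "continuous_on {x0..b} B" by (rule continuous_on_vector_derivative) (rule B')
  have cX: "continuous_on {x0..b} \<Xi>" by (rule continuous_on_vector_derivative) (rule X')
  have cM: "continuous_on {x0..b} M"
    by (rule DERIV_continuous_on) (rule M')
  obtain xm where xm: "xm \<in> {x0..b}" "\<And>t. t \<in> {x0..b} \<Longrightarrow> norm (U t) \<le> norm (U xm)"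
    using continuous_attains_sup[of "{x0..b}" "\<lambda>t. norm (U t)"] continuous_on_norm[OF cU] \<open>x0 \<le> b\<close>
    by auto
  define N where "N = norm (U xm)"
  have N0: "N \<ge> 0" and UN: "\<And>t. t \<in> {x0..b} \<Longrightarrow> norm (U t) \<le> N" using xm by (auto simp: N_def)
  have mono: "Re (\<Xi> x) \<le> Re (\<Xi> y)" if xy: "x0 \<le> x" "x \<le> y" "y \<le> b" for x y
  proof (rule DERIV_nonneg_imp_increasing_open[OF \<open>x \<le> y\<close>])
    fix t assume t: "x < t" "t < y"
    have "((\<lambda>t. Re (\<Xi> t)) has_vector_derivative Re (s t)) (at t)"
      by (rule bounded_linear.has_vector_derivative[OF bounded_linear_Re], rule sub) (use t xy X' in auto)
    then show "\<exists>d. DERIV (\<lambda>t. Re (\<Xi> t)) t :> d \<and> d \<ge> 0"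
      using s0[of t] t xy by (auto simp: has_real_derivative_iff_has_vector_derivative)
  next
    show "continuous_on {x..y} (\<lambda>t. Re (\<Xi> t))"
      by (intro continuous_intros continuous_on_subset[OF cX]) (use xy in auto)
  qed
  have Mb': "((\<lambda>t. - (a * M t)) has_vector_derivative a * D t) (at t)" if "x0 < t" "t < b" for t a
  proof -
    have "((\<lambda>t. - (a * M t)) has_real_derivative a * D t) (at t within {x0..b})"
      using M'[of t] that by (auto intro!: derivative_eq_intros)
    then show ?thesis using int[OF that] by (simp add: has_real_derivative_iff_has_vector_derivative)
  qed
  have cMa: "continuous_on {x..b} (\<lambda>t. - (a * M t))" if "x0 \<le> x" for x a
    using that by (intro continuous_intros continuous_on_subset[OF cM]) auto
  have D0: "D t \<ge> 0" if "t \<in> {x0..b}" for t using kD[OF that] norm_ge_zero order_trans by blast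
  have kU: "norm (k t * U t) \<le> N * D t" if "t \<in> {x0..b}" for t
    using kD[OF that] UN[OF that] N0 mult_mono[of "norm (k t)" "D t" "norm (U t)" N]
    by (simp add: norm_mult mult.commute D0[OF that])
  have BE: "norm (B x) \<le> e + N * (M x - M b)" if x: "x \<in> {x0..b}" for x
  proof (cases "x = b")
    case True then show ?thesis using Bb by simp
  next
    case False
    then have "x < b" using x by simp
    \<comment> \<open>Integrating factor for \<open>B\<close>. As the real part of \<Xi> increases,
      the size of the factor at \<open>x\<close> bounds it on all of [x, b], so it cancels at the
      end without loss.\<close>
    define E where "E = (\<lambda>t. exp (- 2 * \<Xi> t) * B t)"
    define a where "a = N * exp (- 2 * Re (\<Xi> x))"
    have "norm (E b - E x) \<le> - (a * M b) - (- (a * M x))"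
    proof (rule differentiable_bound_general[OF \<open>x < b\<close> _ cMa])
      show "continuous_on {x..b} E" unfolding E_def
        by (intro continuous_intros continuous_on_subset[OF cX] continuous_on_subset[OF cB]) (use x in auto)
      fix t assume t: "x < t" "t < b"
      have d1: "(\<Xi> has_vector_derivative s t) (at t)" and d2: "(B has_vector_derivative 2 * s t * B t - k t * U t) (at t)"
        by (rule sub; use t x X' B' in auto)+
      have d3: "((\<lambda>t. exp (- 2 * \<Xi> t)) has_vector_derivative (- 2 * s t) * exp (- 2 * \<Xi> t)) (at t)"
        using field_vector_diff_chain_at[of "\<lambda>t. -2 * \<Xi> t" "-2 * s t" t exp "exp (-2 * \<Xi> t)"]
          has_vector_derivative_mult_right[OF d1, of "-2"] DERIV_exp[of "-2 * \<Xi> t"]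
        by (simp add: o_def)
      show "(E has_vector_derivative - exp (- 2 * \<Xi> t) * (k t * U t)) (at t)"
        unfolding E_def
        by (rule has_vector_derivative_eq_rhs[OF has_vector_derivative_mult[OF d3 d2]]) (simp add: algebra_simps)
      show "((\<lambda>t. - (a * M t)) has_vector_derivative a * D t) (at t)" using t x by (intro Mb') auto
      have "norm (exp (- 2 * \<Xi> t)) \<le> exp (- 2 * Re (\<Xi> x))"
        using mono[of x t] t x by (simp add: norm_exp_eq_Re)
      then show "norm (- exp (- 2 * \<Xi> t) * (k t * U t)) \<le> a * D t"
        using kU[of t] t x D0[of t] N0 mult_mono[of "norm (exp (- 2 * \<Xi> t))" "exp (- 2 * Re (\<Xi> x))" "norm (k t * U t)" "N * D t"]
        by (simp add: a_def norm_mult algebra_simps)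
    qed (use x in auto)
    then have 1: "norm (E b - E x) \<le> a * (M x - M b)" by (simp add: algebra_simps)
    have "norm (E x) \<le> norm (E b) + norm (E b - E x)"
      using norm_triangle_ineq4[of "E b" "E b - E x"] by simp
    moreover have "norm (E b) \<le> exp (- 2 * Re (\<Xi> x)) * e"
      using mono[of x b] x Bb by (simp add: E_def norm_mult norm_exp_eq_Re mult_mono)
    moreover have "norm (E x) = exp (- 2 * Re (\<Xi> x)) * norm (B x)" by (simp add: E_def norm_mult norm_exp_eq_Re)
    ultimately have "exp (- 2 * Re (\<Xi> x)) * norm (B x) \<le> exp (- 2 * Re (\<Xi> x)) * (e + N * (M x - M b))"
      using 1 unfolding a_def by (simp add: algebra_simps)
    then show ?thesis by simp
  qed
  have UE: "norm (U x - c) \<le> 2 * N * M x + 3 * e" if x: "x \<in> {x0..b}" for x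
  proof (cases "x = b")
    case True
    have "e \<ge> 0" using Ub norm_ge_zero order_trans by blast
    then show ?thesis using Ub True mult_nonneg_nonneg[OF N0 Mb] by (simp add: algebra_simps)
  next
    case False
    then have "x < b" using x by simp
    have "norm ((U b + B b) - (U x + B x)) \<le> - (N * M b) - (- (N * M x))"
    proof (rule differentiable_bound_general[OF \<open>x < b\<close> _ cMa])
      show "continuous_on {x..b} (\<lambda>t. U t + B t)"
        by (intro continuous_intros continuous_on_subset[OF cU] continuous_on_subset[OF cB]) (use x in auto)
      fix t assume t: "x < t" "t < b"
      have d1: "(U has_vector_derivative - 2 * s t * B t) (at t)" and d2: "(B has_vector_derivative 2 * s t * B t - k t * U t) (at t)"
        by (rule sub; use t x U' B' in auto)+
      show "((\<lambda>t. U t + B t) has_vector_derivative - (k t * U t)) (at t)"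
        by (rule has_vector_derivative_eq_rhs[OF has_vector_derivative_add[OF d1 d2]]) simp
      show "((\<lambda>t. - (N * M t)) has_vector_derivative N * D t) (at t)" using t x by (intro Mb') auto
      show "norm (- (k t * U t)) \<le> N * D t" using kU[of t] t x by simp
    qed (use x in auto)
    then have 1: "norm ((U b + B b) - (U x + B x)) \<le> N * (M x - M b)" by (simp add: algebra_simps)
    have "U x - c = (U b - c) + B b - B x - ((U b + B b) - (U x + B x))" by simp
    then have "norm (U x - c) \<le> norm (U b - c) + norm (B b) + norm (B x) + norm ((U b + B b) - (U x + B x))"
      by (smt (verit) norm_triangle_ineq norm_triangle_ineq4)
    also have "\<dots> \<le> 3 * e + 2 * (N * (M x - M b))" using Ub Bb BE[OF x] 1 by simp
    also have "\<dots> \<le> 2 * N * M x + 3 * e" using mult_nonneg_nonneg[OF N0 Mb] by (simp add: algebra_simps)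
    finally show ?thesis .
  qed
  have Mle: "M x \<le> M x0" if x: "x \<in> {x0..b}" for x
  proof (cases "x = x0")
    case False
    \<comment> \<open>\<open>M\<close> decreases since \<open>D\<close> is nonnegative; the mean
      value bound is applied to the zero function.\<close>
    have "norm ((0::real) - 0) \<le> - (1 * M x) - (- (1 * M x0))"
      using False x D0 by (intro differentiable_bound_general[where f = "\<lambda>_. 0::real" and f' = "\<lambda>_. 0" and \<phi>' = "\<lambda>t. 1 * D t"] Mb' continuous_intros continuous_on_subset[OF cM]) auto
    then show ?thesis by simp
  qed simp
  have Mx0: "M x0 \<ge> 0" using Mle[of b] Mb \<open>x0 \<le> b\<close> by auto
  \<comment> \<open>Bootstrap: \<open>2 * N * M xm\<close> is at most \<open>N / 2\<close> and moves
    to the left-hand side.\<close>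
  have "N \<le> norm c + norm (U xm - c)" unfolding N_def by (metis norm_triangle_sub)
  also have "\<dots> \<le> norm c + 2 * N * M xm + 3 * e" using UE[OF xm(1)] by simp
  also have "2 * N * M xm \<le> 2 * N * (1/4)" using Mle[OF xm(1)] M0 N0 by (intro mult_left_mono) auto
  finally have N: "N \<le> 2 * (norm c + 3 * e)" by simp
  have x0: "x0 \<in> {x0..b}" using \<open>x0 \<le> b\<close> by simp
  have NM: "N * M x0 \<le> 2 * (norm c + 3 * e) * M x0" using N Mx0 by (rule mult_right_mono)
  show "norm (U x0 - c) \<le> 4 * (norm c + 3 * e) * M x0 + 3 * e"
    using UE[OF x0] NM by (simp add: algebra_simps)
  show "norm (B x0) \<le> 2 * (norm c + 3 * e) * M x0 + e"
    using BE[OF x0] NM mult_nonneg_nonneg[OF N0 Mb] by (simp add: algebra_simps)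
qed

text \<open>The right end point runs through the integers and the boundary errors \<open>e n\<close>
  tend to 0. No error term survives, so \<open>c = 0\<close> forces \<open>U x0\<close> and
  \<open>B x0\<close> to vanish; uniqueness rests on this.\<close>

lemma system_estimate_at_top:
  fixes U B s k \<Xi> :: "real \<Rightarrow> complex" and M D :: "real \<Rightarrow> real" and c :: complex
  assumes U': "\<And>b t. t \<in> {x0..b} \<Longrightarrow> (U has_vector_derivative - 2 * s t * B t) (at t within {x0..b})"
    and B': "\<And>b t. t \<in> {x0..b} \<Longrightarrow> (B has_vector_derivative 2 * s t * B t - k t * U t) (at t within {x0..b})"
    and X': "\<And>b t. t \<in> {x0..b} \<Longrightarrow> (\<Xi> has_vector_derivative s t) (at t within {x0..b})"
    and M': "\<And>b t. t \<in> {x0..b} \<Longrightarrow> (M has_real_derivative - D t) (at t within {x0..b})"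
    and s0: "\<And>t. t \<ge> x0 \<Longrightarrow> Re (s t) \<ge> 0"
    and kD: "\<And>t. t \<ge> x0 \<Longrightarrow> norm (k t) \<le> D t"
    and Mb: "\<And>t. t \<ge> x0 \<Longrightarrow> M t \<ge> 0" and M0: "M x0 \<le> 1/4"
    and U: "(\<lambda>n. U (real n)) \<longlonglongrightarrow> c" and B: "(\<lambda>n. B (real n)) \<longlonglongrightarrow> 0"
  shows "norm (U x0 - c) \<le> 4 * norm c * M x0" and "norm (B x0) \<le> 2 * norm c * M x0"
proof -
  define e where "e = (\<lambda>n. norm (U (real n) - c) + norm (B (real n)))"
  have e: "e \<longlonglongrightarrow> 0" unfolding e_def
    using tendsto_norm[OF tendsto_diff[OF U tendsto_const[of c]]] tendsto_norm[OF B] by (auto intro: tendsto_add_zero)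
  have ev: "\<forall>\<^sub>F n in sequentially. x0 \<le> real n"
    using filterlim_real_sequentially unfolding filterlim_at_top by blast
  have *: "norm (U x0 - c) \<le> 4 * (norm c + 3 * e n) * M x0 + 3 * e n" "norm (B x0) \<le> 2 * (norm c + 3 * e n) * M x0 + e n"
    if n: "x0 \<le> real n" for n
  proof -
    have en: "norm (U (real n) - c) \<le> e n" "norm (B (real n)) \<le> e n" by (simp_all add: e_def)
    show "norm (U x0 - c) \<le> 4 * (norm c + 3 * e n) * M x0 + 3 * e n"
      by (rule system_estimate(1)[where U = U and B = B and s = s and k = k and \<Xi> = \<Xi> and D = D, OF n U' B' X' M' _ _ Mb[OF n] M0 en])
        (use s0 kD in auto)
    show "norm (B x0) \<le> 2 * (norm c + 3 * e n) * M x0 + e n"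
      by (rule system_estimate(2)[where U = U and B = B and s = s and k = k and \<Xi> = \<Xi> and D = D, OF n U' B' X' M' _ _ Mb[OF n] M0 en])
        (use s0 kD in auto)
  qed
  have l1: "(\<lambda>n. 4 * (norm c + 3 * e n) * M x0 + 3 * e n) \<longlonglongrightarrow> 4 * (norm c + 3 * 0) * M x0 + 3 * 0"
    and l2: "(\<lambda>n. 2 * (norm c + 3 * e n) * M x0 + e n) \<longlonglongrightarrow> 2 * (norm c + 3 * 0) * M x0 + 0"
    by (intro tendsto_intros e)+
  have "norm (U x0 - c) \<le> 4 * (norm c + 3 * 0) * M x0 + 3 * 0"
    by (rule tendsto_lowerbound[OF l1 eventually_mono[OF ev]]) (use *(1) in auto)
  then show "norm (U x0 - c) \<le> 4 * norm c * M x0" by simp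
  have "norm (B x0) \<le> 2 * (norm c + 3 * 0) * M x0 + 0"
    by (rule tendsto_lowerbound[OF l2 eventually_mono[OF ev]]) (use *(2) in auto)
  then show "norm (B x0) \<le> 2 * norm c * M x0" by simp
qed

section \<open>The Liouville-Green substitution\<close>

text \<open>The derivative of \<open>B\<close>, as an identity of numbers: \<open>i\<close> is 1/S,
  \<open>e\<close> is exp \<Xi> times \<open>R\<close>, \<open>y1\<close> and \<open>y2\<close> are
  the solution and its derivative, \<open>z\<close> is the velocity of the path. A separate variable
  for 1/S makes the identity polynomial.\<close>

lemma liouville_green_identity: fixes s i s1 y1 y2 e z q s2 :: complex
  assumes "s * i = 1"
 shows "(-1/2) * (z * (q * y1 * i + y2 - s1 * i^2 / 2 * y2) * e + ((1 + s1 * (i * i)/2) * (z * (y2 + (s + s1 * i/2) * y1) * e) + z * (s2 * i^2 / 2 - s1^2 * i^3) * (y1 * e)))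
  = 2 * (z * s) * ((-1/2) * (y2 * e * i + (1 + s1 * (i * i)/2) * (y1 * e))) - z / 2 * ((q - s^2) * i + s2 * i^2 / 2 - 3 * s1^2 * i^3 / 4) * (y1 * e)" (is "?L = ?R")
proof -
  \<comment> \<open>The factor 8 clears the numerical denominators; \<open>algebra\<close> then
    works modulo \<open>s * i = 1\<close>.\<close>
  have "8 * ?L = -4 * (z * (q * y1 * i + y2) * e) + 2 * s1 * i^2 * y2 * z * e - (2 + s1 * i^2) * (2 * z * y2 + (2 * s + s1 * i) * z * y1) * e - 2 * z * (s2 * i^2 - 2 * s1^2 * i^3) * (y1 * e)"
    by (simp add: field_simps power2_eq_square power3_eq_cube)
  moreover have "8 * ?R = - 4 * (z * s) * (2 * y2 * e * i + (2 + s1 * i^2) * (y1 * e)) - z * (4 * (q - s^2) * i + 2 * s2 * i^2 - 3 * s1^2 * i^3) * (y1 * e)"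
    by (simp add: field_simps power2_eq_square power3_eq_cube)
  moreover have "-4 * (z * (q * y1 * i + y2) * e) + 2 * s1 * i^2 * y2 * z * e - (2 + s1 * i^2) * (2 * z * y2 + (2 * s + s1 * i) * z * y1) * e - 2 * z * (s2 * i^2 - 2 * s1^2 * i^3) * (y1 * e)
    = - 4 * (z * s) * (2 * y2 * e * i + (2 + s1 * i^2) * (y1 * e)) - z * (4 * (q - s^2) * i + 2 * s2 * i^2 - 3 * s1^2 * i^3) * (y1 * e)"
    using assms by algebra
  ultimately have "8 * ?L = 8 * ?R" by simp
  then show ?thesis by (rule mult_left_cancel[THEN iffD1, rotated]) simp
qed
text \<open>All functions are taken along a path \<open>z(t)\<close> with \<open>zp = z'\<close>; \<open>S1\<close> and \<open>S2\<close> are the first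
  two derivatives of \<open>S\<close> with respect to \<open>z\<close>, and the equation for \<open>R\<close> says that \<open>R\<^sup>2\<close> is a multiple of \<open>S\<close>.\<close>

lemma liouville_green_system:
  fixes y1 y2 \<Xi> S S1 S2 R zp Q :: "real \<Rightarrow> complex"
  assumes y1: "(y1 has_vector_derivative zp t * y2 t) (at t within A)"
    and y2: "(y2 has_vector_derivative zp t * (Q t * y1 t)) (at t within A)"
    and X: "(\<Xi> has_vector_derivative zp t * S t) (at t within A)"
    and S: "(S has_vector_derivative zp t * S1 t) (at t within A)"
    and S1: "(S1 has_vector_derivative zp t * S2 t) (at t within A)"
    and R: "(R has_vector_derivative zp t * (S1 t / (2 * S t) * R t)) (at t within A)"
    and S0: "S t \<noteq> 0"
  defines "U \<equiv> \<lambda>t. y1 t * exp (\<Xi> t) * R t"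
    and "B \<equiv> \<lambda>t. - (y2 t * exp (\<Xi> t) * R t / S t + (1 + S1 t / (2 * S t ^ 2)) * (y1 t * exp (\<Xi> t) * R t)) / 2"
    and "k \<equiv> zp t / 2 * ((Q t - S t ^ 2) / S t + S2 t / (2 * S t ^ 2) - 3 * S1 t ^ 2 / (4 * S t ^ 3))"
  shows "(U has_vector_derivative - 2 * (zp t * S t) * B t) (at t within A)"
    and "(B has_vector_derivative 2 * (zp t * S t) * B t - k * U t) (at t within A)"
proof -
  define i where "i = (\<lambda>t. inverse (S t))"
  have i: "S t * i t = 1" using S0 by (simp add: i_def)
  have E: "((\<lambda>t. exp (\<Xi> t)) has_vector_derivative zp t * S t * exp (\<Xi> t)) (at t within A)"
    using field_vector_diff_chain_within[OF X, of exp "exp (\<Xi> t)"] has_field_derivative_at_within[OF DERIV_exp[of "\<Xi> t"]]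
    by (simp add: o_def)
  have half: "a / (2 * S u) = a * i u / 2" "a / S u = a * i u" "a / (2 * S u ^ 2) = a * (i u * i u) / 2" for a u
    by (simp_all add: i_def inverse_eq_divide power2_eq_square)
  define e where "e = (\<lambda>t. exp (\<Xi> t) * R t)"
  have ER: "(e has_vector_derivative zp t * (S t + S1 t * i t / 2) * e t) (at t within A)"
    unfolding e_def
    by (rule has_vector_derivative_eq_rhs[OF has_vector_derivative_mult[OF E R]]) (simp add: algebra_simps half)
  have I: "(i has_vector_derivative - (zp t * S1 t * (i t * i t))) (at t within A)"
    using field_vector_diff_chain_within[OF S, of inverse "- (inverse (S t) * 1 * inverse (S t))"]
      DERIV_inverse'[OF DERIV_ident, of "S t" "S ` A"] S0
    by (simp add: o_def i_def mult_ac)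
  have U: "U = (\<lambda>t. y1 t * e t)" by (simp add: U_def e_def fun_eq_iff)
  have dU: "(U has_vector_derivative zp t * (y2 t + (S t + S1 t * i t / 2) * y1 t) * e t) (at t within A)"
    unfolding U
    by (rule has_vector_derivative_eq_rhs[OF has_vector_derivative_mult[OF y1 ER]]) (simp add: algebra_simps)
  have B: "B = (\<lambda>t. (- 1/2) * (y2 t * e t * i t + (1 + S1 t * (i t * i t) / 2) * U t))"
    unfolding B_def U half by (rule ext) (simp add: e_def field_simps)
  \<comment> \<open>Times \<open>zp t * e t\<close> the left side is the derivative of
    \<open>U\<close>; times \<open>e t\<close> the bracket on the right is \<open>- 2 * B t\<close>.
    Thus \<open>B\<close> is -U'/(2 z' S).\<close>
  have *: "y2 t + (S t + S1 t * i t / 2) * y1 t = S t * (i t * y2 t + (1 + S1 t * (i t * i t) / 2) * y1 t)"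
  proof -
    have "S t * (i t * y2 t + (1 + S1 t * (i t * i t) / 2) * y1 t)
      = S t * i t * y2 t + (S t + S1 t * (S t * i t) * i t / 2) * y1 t"
      by (simp add: algebra_simps)
    then show ?thesis unfolding i by simp
  qed
  show "(U has_vector_derivative - 2 * (zp t * S t) * B t) (at t within A)"
    by (rule has_vector_derivative_eq_rhs[OF dU], unfold *) (simp add: B U algebra_simps)
  have r: "((\<lambda>t. 1 + S1 t * (i t * i t) / 2) has_vector_derivative
      zp t * (S2 t * (i t)^2 / 2 - (S1 t)^2 * (i t)^3)) (at t within A)"
    by (rule has_vector_derivative_eq_rhs[OF has_vector_derivative_add[OF has_vector_derivative_const
       has_vector_derivative_divide[OF has_vector_derivative_mult[OF S1 has_vector_derivative_mult[OF I I]]]]])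
      (simp add: field_simps power2_eq_square power3_eq_cube)
  have V: "((\<lambda>t. y2 t * e t * i t) has_vector_derivative
     zp t * (Q t * y1 t * i t + y2 t - S1 t * (i t)^2 / 2 * y2 t) * e t) (at t within A)"
  proof (rule has_vector_derivative_eq_rhs[OF has_vector_derivative_mult[OF has_vector_derivative_mult[OF y2 ER] I]])
    have "y2 t * zp t * e t * (S t * i t) = y2 t * zp t * e t" using i by simp
    then show "y2 t * e t * - (zp t * S1 t * (i t * i t)) + (y2 t * (zp t * (S t + S1 t * i t / 2) * e t) + zp t * (Q t * y1 t) * e t) * i t
      = zp t * (Q t * y1 t * i t + y2 t - S1 t * (i t)^2 / 2 * y2 t) * e t"
      by (simp add: algebra_simps power2_eq_square)
  qed
  have k: "k = zp t / 2 * ((Q t - S t ^ 2) * i t + S2 t * (i t)^2 / 2 - 3 * (S1 t)^2 * (i t)^3 / 4)"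
    by (simp add: k_def i_def inverse_eq_divide power_one_over mult.commute)
  note dB = has_vector_derivative_mult_right[OF has_vector_derivative_add[OF V has_vector_derivative_mult[OF r dU]], of "- 1/2"]
  show "(B has_vector_derivative 2 * (zp t * S t) * B t - k * U t) (at t within A)"
    unfolding B k
    by (rule has_vector_derivative_eq_rhs[OF dB])
      (use liouville_green_identity[OF i, of "zp t" "Q t" "y1 t" "y2 t" "S1 t" "e t" "S2 t"] in \<open>simp only: U add.commute[of "_ * (zp t * _ * _)"]\<close>)
qed

section \<open>Estimates on the positive half-line\<close>

text \<open>\<open>lgS\<close> and \<open>lgR\<close> take half and a quarter of one principal
  logarithm, so that the square of \<open>lgR\<close> is \<open>lgS\<close> without any choice of
  branch.\<close>

definition lgS :: "complex poly \<Rightarrow> complex \<Rightarrow> complex" where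
  "lgS q z = exp (Ln (poly q z) / 2)"

definition lgR :: "complex poly \<Rightarrow> complex \<Rightarrow> complex" where
  "lgR q z = exp (Ln (poly q z) / 4)"

definition lgXi :: "complex poly \<Rightarrow> real \<Rightarrow> complex" where
  "lgXi q x = integral {0..x} (\<lambda>t. lgS q (of_real t))"

definition lgU :: "complex poly \<Rightarrow> (complex \<Rightarrow> complex) \<Rightarrow> real \<Rightarrow> complex" where
  "lgU q y x = y (of_real x) * exp (lgXi q x) * lgR q (of_real x)"

text \<open>The \<open>B\<close> of the general substitution: with S1 = q'/(2 S) its term S1/(2 S^2)
  becomes q'/(4 S^3).\<close>

definition lgB :: "complex poly \<Rightarrow> (complex \<Rightarrow> complex) \<Rightarrow> (complex \<Rightarrow> complex) \<Rightarrow> real \<Rightarrow> complex" where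
  "lgB q y y' x = - (y' (of_real x) * exp (lgXi q x) * lgR q (of_real x) / lgS q (of_real x)
     + (1 + poly (pderiv q) (of_real x) / (4 * lgS q (of_real x) ^ 3)) * lgU q y x) / 2"

lemma lgS_nonzero [simp]: "lgS q z \<noteq> 0" by (simp add: lgS_def)

lemma lgS_square: "poly q z \<noteq> 0 \<Longrightarrow> lgS q z ^ 2 = poly q z"
  by (simp add: lgS_def exp_double[symmetric])

lemma lgS_Re_pos:
  assumes "poly q z \<notin> \<real>\<^sub>\<le>\<^sub>0" shows "Re (lgS q z) > 0"
proof -
  have "\<bar>Im (Ln (poly q z))\<bar> < pi"
    using assms by (metis complex_nonpos_Reals_iff abs_less_iff Im_Ln_less_pi mpi_less_Im_Ln minus_less_iff nonpos_Reals_zero_I)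
  then have "cos (Im (Ln (poly q z)) / 2) > 0" by (intro cos_gt_zero_pi) auto
  then show ?thesis by (simp add: lgS_def Re_exp)
qed

lemma norm_lgS: "poly q z \<noteq> 0 \<Longrightarrow> norm (lgS q z) = norm (poly q z) powr (1/2)"
  by (simp add: lgS_def norm_exp_eq_Re powr_def)

text \<open>As S^2 is exactly the potential, \<open>k\<close> reduces to q''/(8 S^3) - 5 q'^2/(32
  S^5). With X = x + \<Lambda> both terms are of order X^(-m/2-2), and integration from 0 produces
  \<Lambda>^(-(m/2+1)).\<close>

lemma half_line_estimate:
  fixes q :: "complex poly" and m :: nat and y y' :: "complex \<Rightarrow> complex" and \<Lambda> c K :: real and cc :: complex
  assumes m: "m \<ge> 2" and L: "\<Lambda> \<ge> 1" and c: "c > 0"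
    and q0: "\<And>x::real. x \<ge> 0 \<Longrightarrow> poly q (of_real x) \<notin> \<real>\<^sub>\<le>\<^sub>0"
    and ql: "\<And>x::real. x \<ge> 0 \<Longrightarrow> norm (poly q (of_real x)) \<ge> c * (x + \<Lambda>) ^ m"
    and q1: "\<And>x::real. x \<ge> 0 \<Longrightarrow> norm (poly (pderiv q) (of_real x)) \<le> K * (x + \<Lambda>) ^ (m - 1)"
    and q2: "\<And>x::real. x \<ge> 0 \<Longrightarrow> norm (poly (pderiv (pderiv q)) (of_real x)) \<le> K * (x + \<Lambda>) ^ (m - 2)"
    and y: "\<And>z. (y has_field_derivative y' z) (at z)"
    and y': "\<And>z. (y' has_field_derivative poly q z * y z) (at z)"
    and U: "(\<lambda>n. lgU q y (real n)) \<longlonglongrightarrow> cc" and B: "(\<lambda>n. lgB q y y' (real n)) \<longlonglongrightarrow> 0"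
  defines "C \<equiv> K / c powr (3/2) + K ^ 2 / c powr (5/2)"
  assumes small: "C * \<Lambda> powr - (real m / 2 + 1) \<le> 1/4"
  shows "norm (lgU q y 0 - cc) \<le> 4 * norm cc * (C * \<Lambda> powr - (real m / 2 + 1))"
    and "norm (lgB q y y' 0) \<le> 2 * norm cc * (C * \<Lambda> powr - (real m / 2 + 1))"
proof -
  define h where "h = real m / 2 + 1"
  have h: "h \<ge> 1" by (simp add: h_def)
  have K: "K \<ge> 0"
  proof -
    have "0 \<le> K * (0 + \<Lambda>) ^ (m - 1)" using order_trans[OF norm_ge_zero q1[of 0]] by simp
    moreover have "\<Lambda> ^ (m - 1) > 0" using L by simp
    ultimately show ?thesis by (simp add: zero_le_mult_iff)
  qed
  have C0: "C \<ge> 0" using K c by (simp add: C_def)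
  \<comment> \<open>The factor \<open>h\<close> makes \<open>- D\<close> the derivative of
    \<open>M\<close>; as \<open>h\<close> is at least 1, it only weakens the bound on
    \<open>k\<close>.\<close>
  define D where "D = (\<lambda>x::real. C * h * (x + \<Lambda>) powr (- h - 1))"
  define M where "M = (\<lambda>x::real. C * (x + \<Lambda>) powr - h)"
  define S where "S = (\<lambda>x::real. lgS q (of_real x))"
  define S1 where "S1 = (\<lambda>x::real. poly (pderiv q) (of_real x) / (2 * S x))"
  define S2 where "S2 = (\<lambda>x::real. poly (pderiv (pderiv q)) (of_real x) / (2 * S x) - poly (pderiv q) (of_real x) ^ 2 / (4 * S x ^ 3))"
  define k where "k = (\<lambda>t::real. 1 / 2 * ((poly q (of_real t) - S t ^ 2) / S t + S2 t / (2 * S t ^ 2) - 3 * S1 t ^ 2 / (4 * S t ^ 3)))"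
  have S0: "S x \<noteq> 0" for x by (simp add: S_def)
  have qn0: "poly q (of_real x) \<noteq> 0" if "x \<ge> 0" for x using q0[OF that] by auto
  have SS: "S x ^ 2 = poly q (of_real x)" if "x \<ge> 0" for x using lgS_square[OF qn0[OF that]] by (simp add: S_def)
  have dS: "(S has_vector_derivative 1 * S1 x) (at x within A)" if "x \<ge> 0" for x A
    unfolding S_def
  proof (rule has_vector_derivative_real_field)
    have "lgS q (of_real x) * (poly (pderiv q) (of_real x) / (2 * poly q (of_real x))) = S1 x"
      unfolding S1_def SS[OF that, symmetric] using S0[of x] by (simp add: S_def power2_eq_square)
    then show "(lgS q has_field_derivative 1 * S1 x) (at (of_real x))"
      unfolding lgS_def[abs_def] using q0[OF that]
      by (auto intro!: derivative_eq_intros simp: field_simps)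
  qed
  have dR: "((\<lambda>x. lgR q (of_real x)) has_vector_derivative 1 * (S1 x / (2 * S x) * lgR q (of_real x))) (at x within A)" if "x \<ge> 0" for x A
  proof (rule has_vector_derivative_real_field)
    have "S1 x / (2 * S x) = poly (pderiv q) (of_real x) / (4 * poly q (of_real x))"
      unfolding S1_def SS[OF that, symmetric] by (simp add: power2_eq_square)
    then show "(lgR q has_field_derivative 1 * (S1 x / (2 * S x) * lgR q (of_real x))) (at (of_real x))"
      unfolding lgR_def[abs_def] using q0[OF that]
      by (auto intro!: derivative_eq_intros simp: field_simps)
  qed
  have dS1: "(S1 has_vector_derivative 1 * S2 x) (at x within A)" if "x \<ge> 0" for x A
  proof -
    have i: "((\<lambda>x. inverse (S x)) has_vector_derivative - (S1 x / S x ^ 2)) (at x within A)"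
      using field_vector_diff_chain_within[OF dS[OF that], of inverse "- (inverse (S x) * 1 * inverse (S x))"]
      DERIV_inverse'[OF DERIV_ident, of "S x" "S ` A"] S0[of x]
      by (simp add: o_def power2_eq_square divide_inverse mult_ac)
    have p: "((\<lambda>x. poly (pderiv q) (of_real x)) has_vector_derivative poly (pderiv (pderiv q)) (of_real x)) (at x within A)"
      by (rule has_vector_derivative_real_field) (rule poly_DERIV)
    have e: "S1 = (\<lambda>x. poly (pderiv q) (of_real x) * inverse (S x) * (1/2))"
      by (simp add: S1_def fun_eq_iff field_simps)
    show ?thesis
      unfolding e
      by (rule has_vector_derivative_eq_rhs[OF has_vector_derivative_mult_left[OF has_vector_derivative_mult[OF p i]]])
        (use S0[of x] in \<open>simp add: S2_def S1_def field_simps power2_eq_square power3_eq_cube\<close>)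
  qed
  have cS: "continuous_on {0..b} S" for b
    by (rule continuous_on_vector_derivative) (rule dS, simp)
  have dX: "(lgXi q has_vector_derivative 1 * S x) (at x within {0..b})" if "x \<in> {0..b}" for x b
    unfolding lgXi_def[abs_def] using integral_has_vector_derivative[OF cS that] by (simp add: S_def)
  have B_eq: "lgB q y y' = (\<lambda>t. - (y' (of_real t) * exp (lgXi q t) * lgR q (of_real t) / S t
      + (1 + S1 t / (2 * S t ^ 2)) * (y (of_real t) * exp (lgXi q t) * lgR q (of_real t))) / 2)"
    by (rule ext) (simp add: lgB_def lgU_def S1_def S_def power2_eq_square power3_eq_cube)
  have U_eq: "lgU q y = (\<lambda>t. y (of_real t) * exp (lgXi q t) * lgR q (of_real t))"
    by (rule ext) (simp add: lgU_def)
  have dy: "((\<lambda>x. y (of_real x)) has_vector_derivative 1 * y' (of_real x)) (at x within A)" for x A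
    using has_vector_derivative_real_field[OF y] by simp
  have dy': "((\<lambda>x. y' (of_real x)) has_vector_derivative 1 * (poly q (of_real x) * y (of_real x))) (at x within A)" for x A
    using has_vector_derivative_real_field[OF y'] by simp
  have sys: "(lgU q y has_vector_derivative - 2 * (1 * S t) * lgB q y y' t) (at t within {0..b})"
       "(lgB q y y' has_vector_derivative 2 * (1 * S t) * lgB q y y' t - k t * lgU q y t) (at t within {0..b})"
      if "t \<in> {0..b}" for t b
  proof -
    have t: "t \<ge> 0" using that by simp
    note lg = liouville_green_system[of "\<lambda>x. y (of_real x)" "\<lambda>_. 1" t "\<lambda>x. y' (of_real x)" "{0..b}"
      "\<lambda>x. poly q (of_real x)" "lgXi q" S S1 S2 "\<lambda>x. lgR q (of_real x)",
      OF dy dy' dX[OF that] dS[OF t] dS1[OF t] dR[OF t] S0]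
    show "(lgU q y has_vector_derivative - 2 * (1 * S t) * lgB q y y' t) (at t within {0..b})"
      unfolding U_eq B_eq using lg(1) .
    show "(lgB q y y' has_vector_derivative 2 * (1 * S t) * lgB q y y' t - k t * lgU q y t) (at t within {0..b})"
      unfolding U_eq B_eq k_def using lg(2) .
  qed
  have dM: "(M has_real_derivative - D t) (at t within {0..b})" if "t \<in> {0..b}" for t b
    unfolding M_def D_def using that L by (auto intro!: derivative_eq_intros simp: algebra_simps powr_diff)
  have kD: "norm (k t) \<le> D t" if t: "t \<ge> 0" for t
  proof -
    define X where "X = t + \<Lambda>"
    have X: "X \<ge> 1" using t L by (simp add: X_def)
    define n where "n = norm (S t)"
    have n: "n > 0" using S0 by (simp add: n_def)
    have nX: "n \<ge> c powr (1/2) * X powr (real m / 2)"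
    proof -
      have "n = norm (poly q (of_real t)) powr (1/2)" using norm_lgS[OF qn0[OF t]] by (simp add: n_def S_def)
      moreover have "(c * X ^ m) powr (1/2) \<le> norm (poly q (of_real t)) powr (1/2)"
        using ql[OF t] c X by (intro powr_mono2) (auto simp: X_def)
      moreover have "(c * X ^ m) powr (1/2) = c powr (1/2) * X powr (real m / 2)"
        using c X by (simp add: powr_mult powr_realpow[symmetric] powr_powr)
      ultimately show ?thesis by simp
    qed
    have pw: "c powr (real j / 2) * X powr (real m * real j / 2) \<le> n ^ j" for j :: nat
    proof -
      have "(c powr (1/2) * X powr (real m / 2)) ^ j \<le> n ^ j" using nX by (intro power_mono) auto
      then show ?thesis using c X by (simp add: power_mult_distrib powr_powr powr_realpow[symmetric] powr_powr_swap mult.commute flip: powr_realpow)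
    qed
    let ?a = "norm (poly (pderiv q) (of_real t))" and ?b = "norm (poly (pderiv (pderiv q)) (of_real t))"
    have "k t = poly (pderiv (pderiv q)) (of_real t) / (8 * S t ^ 3) - 5 * poly (pderiv q) (of_real t) ^ 2 / (32 * S t ^ 5)"
      unfolding k_def S2_def S1_def SS[OF t] using S0[of t]
      by (simp add: SS[OF t, symmetric] field_simps eval_nat_numeral)
    then have "norm (k t) \<le> ?b / (8 * n ^ 3) + 5 * ?a ^ 2 / (32 * n ^ 5)"
      using norm_triangle_ineq4[of "poly (pderiv (pderiv q)) (of_real t) / (8 * S t ^ 3)" "5 * poly (pderiv q) (of_real t) ^ 2 / (32 * S t ^ 5)"]
      by (simp add: norm_divide norm_mult norm_power n_def)
    also have "\<dots> \<le> ?b / n ^ 3 + ?a ^ 2 / n ^ 5"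
      using n by (intro add_mono) (auto simp: field_simps)
    also have "\<dots> \<le> K * X powr (real m - 2) / (c powr (3/2) * X powr (real m * 3 / 2))
       + (K * X powr (real m - 1)) ^ 2 / (c powr (5/2) * X powr (real m * 5 / 2))"
    proof (intro add_mono frac_le power_mono)
      show "?b \<le> K * X powr (real m - 2)" "?a \<le> K * X powr (real m - 1)"
        using q1[OF t] q2[OF t] X m powr_realpow[of X "m - 1"] powr_realpow[of X "m - 2"]
        by (simp_all add: X_def[symmetric] of_nat_diff)
      show "c powr (3/2) * X powr (real m * 3 / 2) \<le> n ^ 3" using pw[of 3] by simp
      show "c powr (5/2) * X powr (real m * 5 / 2) \<le> n ^ 5" using pw[of 5] by simp
    qed (use X c K in auto)
    also have "\<dots> = C * X powr (- h - 1)"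
    proof -
      have "X powr (real m - 2) = X powr (- h - 1) * X powr (real m * 3 / 2)"
        "X powr (real m - 1) * X powr (real m - 1) = X powr (- h - 1) * X powr (real m * 5 / 2)"
        unfolding powr_add[symmetric] by (rule arg_cong[where f = "\<lambda>u. X powr u"], simp add: h_def field_simps)+
      then show ?thesis using X c by (simp add: C_def power_mult_distrib power2_eq_square[of "X powr _"] field_simps)
    qed
    also have "\<dots> \<le> D t"
      using mult_left_mono[OF h C0] by (auto simp: D_def X_def intro!: mult_right_mono)
    finally show ?thesis .
  qed
  have M0: "M 0 \<le> 1/4" "M 0 = C * \<Lambda> powr - (real m / 2 + 1)" using small by (simp_all add: M_def h_def)
  have Mn: "M t \<ge> 0" if "t \<ge> 0" for t using C0 by (simp add: M_def)
  have Re0: "0 \<le> Re (1 * S t)" if "t \<ge> 0" for t using lgS_Re_pos[OF q0[OF that]] by (simp add: S_def)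
  show "norm (lgU q y 0 - cc) \<le> 4 * norm cc * (C * \<Lambda> powr - (real m / 2 + 1))"
    unfolding M0(2)[symmetric]
    by (rule system_estimate_at_top(1)[where s = "\<lambda>t. 1 * S t" and k = k and \<Xi> = "lgXi q" and D = D and B = "lgB q y y'",
      OF sys(1) sys(2) dX dM Re0 kD Mn M0(1) U B])
  show "norm (lgB q y y' 0) \<le> 2 * norm cc * (C * \<Lambda> powr - (real m / 2 + 1))"
    unfolding M0(2)[symmetric]
    by (rule system_estimate_at_top(2)[where s = "\<lambda>t. 1 * S t" and k = k and \<Xi> = "lgXi q" and D = D and U = "lgU q y",
      OF sys(1) sys(2) dX dM Re0 kD Mn M0(1) U B])
qed

section \<open>The truncated square root\<close>

lemma poly_Ppoly: "poly (Ppoly m a) z = (\<Sum>i=1..m. a i * z ^ (m - i))"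
  by (simp add: Ppoly_def poly_sum poly_monom)

text \<open>In s = 1/z the large-z expansion becomes a power series at 0: z^m + P(z) = z^m (1 +
  \<open>Ppoly_rev\<close>(s)).\<close>

definition Ppoly_rev :: "nat \<Rightarrow> (nat \<Rightarrow> complex) \<Rightarrow> complex poly" where
  "Ppoly_rev m a = (\<Sum>i=1..m. monom (a i) i)"

lemma poly_Ppoly_rev:
  assumes "z \<noteq> 0" shows "z ^ m * poly (Ppoly_rev m a) (inverse z) = poly (Ppoly m a) z"
  unfolding poly_Ppoly Ppoly_rev_def poly_sum poly_monom sum_distrib_left
  using assms by (intro sum.cong) (auto simp: power_diff field_simps)

lemma poly_eqI_eval:
  fixes p q :: "complex poly"
  assumes "\<And>z. z \<noteq> 0 \<Longrightarrow> poly p z = poly q z" shows "p = q"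
proof (rule ccontr)
  assume "p \<noteq> q"
  then have "finite {z. poly (p - q) z = 0}" by (intro poly_roots_finite) simp
  moreover have "UNIV - {0} \<subseteq> {z. poly (p - q) z = 0}" using assms by auto
  ultimately have "finite (UNIV - {0::complex})" using finite_subset by blast
  then show False using infinite_UNIV_char_0[where 'a = complex] by simp
qed

lemma degree_Ppoly: "degree (Ppoly m a) \<le> m"
  unfolding Ppoly_def by (intro degree_sum_le) (auto intro!: order.trans[OF degree_monom_le])

lemma degree_power_le_mult: "degree (p ^ k) \<le> m * k" if "degree (p::complex poly) \<le> m"
  using degree_power_le[of p k] that by (meson mult_le_mono1 order_trans)

text \<open>Reversal turns the coefficients of P^k counted from the top, in terms of which b_{j,k}
  is defined, into power series coefficients. The case distinction matches the guard in
  \<open>bjk\<close>.\<close>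

lemma coeff_Ppoly_power:
  "coeff (Ppoly_rev m a ^ k) j = (if j \<le> m * k then coeff (Ppoly m a ^ k) (m * k - j) else 0)"
proof -
  define r where "r = (\<Sum>j\<le>m * k. monom (coeff (Ppoly m a ^ k) (m * k - j)) j)"
  have "Ppoly_rev m a ^ k = r"
  proof (rule poly_eqI_eval)
    fix z :: complex assume z: "z \<noteq> 0"
    have "poly (Ppoly_rev m a) z = z ^ m * poly (Ppoly m a) (inverse z)"
      using poly_Ppoly_rev[of "inverse z" m a] z by (simp add: power_inverse field_simps)
    then have "poly (Ppoly_rev m a ^ k) z = z ^ (m * k) * poly (Ppoly m a ^ k) (inverse z)"
      by (simp add: poly_power power_mult_distrib power_mult)
    also have "poly (Ppoly m a ^ k) (inverse z) = (\<Sum>i\<le>m * k. coeff (Ppoly m a ^ k) i * inverse z ^ i)"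
      unfolding poly_altdef using degree_power_le_mult[OF degree_Ppoly, of m a k]
      by (intro sum.mono_neutral_left) (auto simp: coeff_eq_0)
    also have "\<dots> = (\<Sum>j\<le>m * k. coeff (Ppoly m a ^ k) (m * k - j) * inverse z ^ (m * k - j))"
      by (rule sum.reindex_bij_witness[of _ "\<lambda>j. m * k - j" "\<lambda>j. m * k - j"]) auto
    also have "z ^ (m * k) * \<dots> = poly r z"
      unfolding r_def poly_sum poly_monom sum_distrib_left
      using z by (intro sum.cong) (auto simp: power_diff field_simps)
    finally show "poly (Ppoly_rev m a ^ k) z = poly r z" .
  qed
  then show ?thesis by (simp add: r_def coeff_sum)
qed

text \<open>The coefficients of the power series of sqrt(1 + \<open>Ppoly_rev\<close>), including
  the leading 1 that the b_j leave out.\<close>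

definition bb :: "nat \<Rightarrow> (nat \<Rightarrow> complex) \<Rightarrow> nat \<Rightarrow> complex" where
  "bb m a j = (if j = 0 then 1 else bj m a j)"

text \<open>The b_j are the coefficients of the binomial series (1 + f)^(1/2), and the product law
  of binomial series squares it to 1 + f. The composition makes sense because f has no constant
  term.\<close>

lemma bb_series_square:
  "Abs_fps (bb m a) ^ 2 = 1 + fps_of_poly (Ppoly_rev m a)"
proof -
  define f where "f = fps_of_poly (Ppoly_rev m a)"
  have f0: "f $ 0 = 0" by (simp add: f_def Ppoly_rev_def coeff_sum)
  have "Abs_fps (bb m a) = fps_binomial (1/2) oo f"
  proof (rule fps_ext)
    fix j
    have fk: "f ^ k $ j = coeff (Ppoly_rev m a ^ k) j" for k
      by (simp add: f_def fps_of_poly_power[symmetric])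
    show "Abs_fps (bb m a) $ j = (fps_binomial (1/2) oo f) $ j"
    proof (cases "j = 0")
      case True then show ?thesis by (simp add: bb_def)
    next
      case False
      have "(fps_binomial (1/2) oo f) $ j = (\<Sum>k=0..j. ((1/2) gchoose k) * coeff (Ppoly_rev m a ^ k) j)"
        by (simp add: fps_compose_nth fk)
      \<comment> \<open>The term k = 0 is coefficient j of the constant 1, which vanishes for
        positive j.\<close>
      also have "\<dots> = (\<Sum>k=1..j. ((1/2) gchoose k) * coeff (Ppoly_rev m a ^ k) j)"
        using False by (intro sum.mono_neutral_right) (auto simp: Suc_le_eq)
      also have "\<dots> = bj m a j"
        unfolding bj_def bjk_def by (intro sum.cong) (auto simp: coeff_Ppoly_power)
      finally show ?thesis using False by (simp add: bb_def)
    qed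
  qed
  then have "Abs_fps (bb m a) ^ 2 = (fps_binomial (1/2) * fps_binomial (1/2)) oo f"
    by (simp add: power2_eq_square fps_compose_mult_distrib[OF f0])
  also have "\<dots> = 1 + f"
    using f0 by (simp add: fps_binomial_add_mult[symmetric] fps_binomial_1 fps_compose_add_distrib)
  finally show ?thesis by (simp add: f_def)
qed

text \<open>The cut keeps exactly the terms z^(m/2-j) with exponent at least -1; the next one is
  O(z^(-3/2)) and hence integrable at infinity.\<close>

definition Tpoly :: "nat \<Rightarrow> (nat \<Rightarrow> complex) \<Rightarrow> complex poly" where
  "Tpoly m a = (\<Sum>j\<le>m div 2 + 1. monom (bb m a j) j)"

text \<open>Coefficients of T^2 up to degree \<open>m div 2 + 1\<close> involve only retained b_j
  and agree with those of the full square, so the remainder polynomial starts at degree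
  \<open>m div 2 + 2\<close>.\<close>

lemma truncation_bound:
  obtains C where "C \<ge> 0"
   "\<And>s. norm s \<le> 1 \<Longrightarrow> norm (poly (Tpoly m a) s ^ 2 - 1 - poly (Ppoly_rev m a) s) \<le> C * norm s ^ (m div 2 + 2)"
proof -
  define r where "r = Tpoly m a ^ 2 - 1 - Ppoly_rev m a"
  have cT: "coeff (Tpoly m a) j = bb m a j" if "j \<le> m div 2 + 1" for j
    using that by (simp add: Tpoly_def coeff_sum)
  have r0: "coeff r n = 0" if "n < m div 2 + 2" for n
  proof -
    have "coeff (Tpoly m a ^ 2) n = (Abs_fps (bb m a) ^ 2) $ n"
      unfolding power2_eq_square coeff_mult fps_mult_nth atLeast0AtMost
      using that by (intro sum.cong) (auto simp: cT)
    then show ?thesis by (simp add: r_def bb_series_square)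
  qed
  define C where "C = (\<Sum>n\<le>degree r. norm (coeff r n))"
  have "norm (poly r s) \<le> C * norm s ^ (m div 2 + 2)" if s: "norm s \<le> 1" for s
  proof -
    have "norm (poly r s) \<le> (\<Sum>n\<le>degree r. norm (coeff r n) * norm s ^ (m div 2 + 2))"
      unfolding poly_altdef
    proof (rule sum_norm_le)
      fix n
      show "norm (coeff r n * s ^ n) \<le> norm (coeff r n) * norm s ^ (m div 2 + 2)"
        using r0[of n] power_decreasing[of "m div 2 + 2" n "norm s"] s
        by (cases "n < m div 2 + 2") (auto simp: norm_mult norm_power simp del: power_Suc intro!: mult_left_mono)
    qed
    then show ?thesis by (simp add: C_def sum_distrib_right)
  qed
  moreover have "C \<ge> 0" by (simp add: C_def sum_nonneg)
  ultimately show ?thesis using that[of C] by (simp add: r_def poly_power)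
qed

section \<open>The potential for large parameter\<close>

definition pot :: "nat \<Rightarrow> (nat \<Rightarrow> complex) \<Rightarrow> complex \<Rightarrow> complex poly" where
  "pot m a lam = monom 1 m + Ppoly m a + [:lam:]"

lemma poly_pot: "poly (pot m a lam) z = z ^ m + poly (Ppoly m a) z + lam"
  by (simp add: pot_def poly_monom)

lemma poly_norm_bound:
  fixes p :: "complex poly"
  assumes "degree p \<le> n" "\<And>i. norm (coeff p i) \<le> A" "norm z \<le> X" "X \<ge> 1"
  shows "norm (poly p z) \<le> real (n + 1) * A * X ^ n"
proof -
  have "norm (poly p z) \<le> (\<Sum>i\<le>degree p. A * X ^ n)"
    unfolding poly_altdef
  proof (rule sum_norm_le)
    fix i assume "i \<in> {..degree p}"
    then have "norm z ^ i \<le> X ^ i" "X ^ i \<le> X ^ n" using assms by (auto intro!: power_mono power_increasing)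
    then show "norm (coeff p i * z ^ i) \<le> A * X ^ n"
      using assms(2)[of i] assms(4) order_trans[OF norm_ge_zero assms(2)[of i]]
      by (auto simp: norm_mult norm_power intro!: mult_mono)
  qed
  also have "\<dots> = real (degree p + 1) * (A * X ^ n)" by simp
  also have "\<dots> \<le> real (n + 1) * (A * X ^ n)"
    using assms(1,4) order_trans[OF norm_ge_zero assms(2)] by (intro mult_right_mono) auto
  finally show ?thesis by (simp add: mult.assoc)
qed

lemma coeff_pderiv_bound:
  fixes p :: "complex poly"
  assumes "degree p \<le> n" "\<And>i. norm (coeff p i) \<le> A"
  shows "norm (coeff (pderiv p) i) \<le> real n * A"
proof (cases "Suc i \<le> n")
  case True
  then show ?thesis
    using assms(2)[of "Suc i"] order_trans[OF norm_ge_zero assms(2)[of i]]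
    by (auto simp: coeff_pderiv norm_mult simp del: of_nat_Suc intro!: mult_mono)
next
  case False
  then show ?thesis using assms(1) order_trans[OF norm_ge_zero assms(2)[of i]] by (simp add: coeff_pderiv coeff_eq_0)
qed

lemma coeff_Ppoly: "coeff (Ppoly m a) k = (if k < m then a (m - k) else 0)"
proof -
  have "coeff (Ppoly m a) k = (\<Sum>i=1..m. if i = m - k \<and> k < m then a i else 0)"
    unfolding Ppoly_def coeff_sum by (intro sum.cong) auto
  then show ?thesis by (auto simp: sum.If_cases)
qed

text \<open>Law of cosines. With s = sin(\<delta>/2) the worst case equals s^2 (x + |lam|)^2 + (1 -
  s^2) (x - |lam|)^2, and the second term is dropped.\<close>

lemma sector_lower_bound:
  fixes x :: real and lam :: complex
  assumes "x \<ge> 0" "lam \<noteq> 0" "\<bar>Arg lam\<bar> \<le> pi - \<delta>" "0 < \<delta>" "\<delta> \<le> pi"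
  shows "norm (of_real x + lam) \<ge> sin (\<delta> / 2) * (x + norm lam)"
proof -
  define s where "s = sin (\<delta> / 2)"
  have "cos (Arg lam) \<ge> cos (pi - \<delta>)"
    using cos_monotone_0_pi_le[of "\<bar>Arg lam\<bar>" "pi - \<delta>"] assms by auto
  then have "cos (Arg lam) \<ge> - cos \<delta>" by simp
  moreover have "Re lam = norm lam * cos (Arg lam)" using assms(2) by (simp add: cos_Arg)
  ultimately have re: "Re lam \<ge> - (norm lam * cos \<delta>)"
    using mult_left_mono[of "- cos \<delta>" "cos (Arg lam)" "norm lam"] by simp
  have cd: "cos \<delta> = 1 - 2 * s\<^sup>2" using cos_double_sin[of "\<delta> / 2"] by (simp add: s_def)
  have s1: "s\<^sup>2 \<le> 1" by (simp add: s_def abs_square_le_1)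
  have "(norm (of_real x + lam))\<^sup>2 = x\<^sup>2 + (norm lam)\<^sup>2 + 2 * x * Re lam"
    unfolding cmod_power2 by (simp add: power2_eq_square algebra_simps)
  also have "\<dots> \<ge> x\<^sup>2 + (norm lam)\<^sup>2 - 2 * x * (norm lam * cos \<delta>)"
    using mult_left_mono[OF re, of "2 * x"] assms(1) by simp
  also have "x\<^sup>2 + (norm lam)\<^sup>2 - 2 * x * (norm lam * cos \<delta>) = s\<^sup>2 * (x + norm lam)\<^sup>2 + (1 - s\<^sup>2) * (x - norm lam)\<^sup>2"
    unfolding cd by (simp add: power2_eq_square algebra_simps)
  also have "\<dots> \<ge> s\<^sup>2 * (x + norm lam)\<^sup>2" using s1 by simp
  finally have "(s * (x + norm lam))\<^sup>2 \<le> (norm (of_real x + lam))\<^sup>2" by (simp add: power_mult_distrib)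
  then show ?thesis unfolding s_def[symmetric] by (rule power2_le_imp_le) simp
qed

abbreviation pot_bound :: "nat \<Rightarrow> real \<Rightarrow> real \<Rightarrow> (nat \<Rightarrow> complex) \<Rightarrow> complex \<Rightarrow> real \<Rightarrow> bool" where
  "pot_bound m c K a lam x \<equiv> poly (pot m a lam) (of_real x) \<notin> \<real>\<^sub>\<le>\<^sub>0
      \<and> norm (poly (pot m a lam) (of_real x)) \<ge> c * (x + norm lam powr (1 / real m)) ^ m
      \<and> norm (poly (pderiv (pot m a lam)) (of_real x)) \<le> K * (x + norm lam powr (1 / real m)) ^ (m - 1)
      \<and> norm (poly (pderiv (pderiv (pot m a lam))) (of_real x)) \<le> K * (x + norm lam powr (1 / real m)) ^ (m - 2)"

text \<open>With X = x + |lam|^(1/m), the sector condition makes x^m + lam at least of order X^m,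
  while P is of order X^(m-1) and is absorbed for large \<open>lam\<close>. The constants depend on
  \<open>m\<close>, \<delta> and \<open>A\<close> only, which yields the uniformity on compact
  sets.\<close>

lemma pot_bounds:
  fixes m :: nat and \<delta> A :: real
  assumes m: "m \<ge> 1" and d: "0 < \<delta>" "\<delta> \<le> pi" and A: "A \<ge> 1"
  obtains c K R where "c > 0" "R \<ge> 1" "K \<ge> 0"
   "\<And>a lam x. (\<And>i. i \<in> {1..m} \<Longrightarrow> norm (a i) \<le> A) \<Longrightarrow> norm lam \<ge> R \<Longrightarrow> \<bar>Arg lam\<bar> \<le> pi - \<delta> \<Longrightarrow> (x::real) \<ge> 0 \<Longrightarrow>
      pot_bound m c K a lam x"
proof -
  \<comment> \<open>The factor 2^m is lost in comparing (x + L)^m with x^m + L^m.\<close>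
  define c1 where "c1 = sin (\<delta> / 2) / 2 ^ m"
  have "sin (\<delta> / 2) > 0" using d by (intro sin_gt_zero) auto
  then have c1: "c1 > 0" by (simp add: c1_def)
  \<comment> \<open>After taking m-th roots, |lam|^(1/m) is at least 2 m A / c1, which makes P at
    most half of the lower bound.\<close>
  define R where "R = (max 1 (2 * (real m * A) / c1)) ^ m"
  define K where "K = real m * (real m * A) + real m * (real m * (real m * A))"
  have main: "pot_bound m (c1 / 2) K a lam x"
    if a: "\<And>i. i \<in> {1..m} \<Longrightarrow> norm (a i) \<le> A" and lam: "norm lam \<ge> R" "\<bar>Arg lam\<bar> \<le> pi - \<delta>" and x: "x \<ge> 0"
    for a lam and x :: real
  proof -
    define L where "L = norm lam powr (1 / real m)"
    have "R \<ge> 1" unfolding R_def by (rule one_le_power) simp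
    then have lam0: "lam \<noteq> 0" using lam by auto
    have Lm: "L ^ m = norm lam" using m lam0 by (simp add: L_def powr_realpow[symmetric] powr_powr)
    have "(max 1 (2 * (real m * A) / c1)) ^ m \<le> L ^ m" using lam by (simp add: Lm R_def)
    then have L: "max 1 (2 * (real m * A) / c1) \<le> L"
      using m by (subst (asm) power_mono_iff) (auto simp: L_def)
    define X where "X = x + L"
    have X: "X \<ge> 1" "X \<ge> L" "X \<ge> x" "norm (of_real x :: complex) \<le> X" using L x by (auto simp: X_def)
    have XL: "X ^ m \<le> 2 ^ m * (x ^ m + norm lam)"
    proof -
      have "X ^ m \<le> (2 * max x L) ^ m" using x X by (intro power_mono) (auto simp: X_def)
      also have "\<dots> \<le> 2 ^ m * (x ^ m + L ^ m)" using x zero_le_power[of L m] order_trans[OF zero_le_one order_trans[OF max.cobounded1 L]]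
        by (cases "x \<le> L") (auto simp: power_mult_distrib max_def)
      finally show ?thesis by (simp add: Lm)
    qed
    have Pb: "norm (poly (Ppoly m a) (of_real x)) \<le> c1 / 2 * X ^ m"
    proof -
      have dP: "degree (Ppoly m a) \<le> m - 1" by (rule degree_le) (auto simp: coeff_Ppoly)
      have "norm (poly (Ppoly m a) (of_real x)) \<le> real (m - 1 + 1) * A * X ^ (m - 1)"
        by (rule poly_norm_bound[OF dP _ X(4,1)]) (use a A in \<open>auto simp: coeff_Ppoly\<close>)
      also have "\<dots> = real m * A * X ^ (m - 1)" using m by simp
      also have "\<dots> \<le> c1 / 2 * X * X ^ (m - 1)"
      proof (rule mult_right_mono)
        have "2 * (real m * A) / c1 \<le> X" using L X by simp
        then show "real m * A \<le> c1 / 2 * X" using c1 by (simp add: field_simps)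
      qed (use X in auto)
      also have "\<dots> = c1 / 2 * X ^ m" using m by (cases m) auto
      finally show ?thesis .
    qed
    \<comment> \<open>The extra \<open>t\<close> excludes the negative axis below: if the potential
      were \<open>- t\<close>, then x^m + t + lam would equal -P(x), which is too small. The case
      \<open>t = 0\<close> gives the lower bound itself.\<close>
    have low: "norm (of_real (x ^ m + t) + lam) \<ge> c1 * X ^ m" if "t \<ge> 0" for t :: real
    proof -
      have "c1 * X ^ m \<le> sin (\<delta> / 2) * (x ^ m + norm lam)"
        using mult_left_mono[OF XL, of c1] c1 by (simp add: c1_def)
      also have "\<dots> \<le> sin (\<delta> / 2) * (x ^ m + t + norm lam)" using that \<open>sin (\<delta> / 2) > 0\<close> by simp
      also have "\<dots> \<le> norm (of_real (x ^ m + t) + lam)"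
        by (rule sector_lower_bound) (use x that lam0 lam d in auto)
      finally show ?thesis .
    qed
    have X0: "X ^ m > 0" using X by simp
    have nr: "poly (pot m a lam) (of_real x) \<notin> \<real>\<^sub>\<le>\<^sub>0"
    proof
      assume "poly (pot m a lam) (of_real x) \<in> \<real>\<^sub>\<le>\<^sub>0"
      moreover define t where "t = - Re (poly (pot m a lam) (of_real x))"
      ultimately have t: "t \<ge> 0" "poly (pot m a lam) (of_real x) = - of_real t"
        by (auto simp: complex_nonpos_Reals_iff complex_eq_iff)
      have "of_real (x ^ m + t) + lam = poly (pot m a lam) (of_real x) + of_real t - poly (Ppoly m a) (of_real x)"
        by (simp add: poly_pot)
      then have "norm (of_real (x ^ m + t) + lam) = norm (poly (Ppoly m a) (of_real x))" by (simp add: t(2))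
      then have "c1 * X ^ m \<le> c1 / 2 * X ^ m" using low[OF t(1)] Pb by simp
      then show False using c1 X0 by simp
    qed
    have P0: "norm (poly (pot m a lam) (of_real x)) \<ge> c1 / 2 * X ^ m"
      using low[of 0] Pb norm_diff_ineq[of "of_real (x ^ m + 0) + lam" "poly (Ppoly m a) (of_real x)"]
      by (simp add: poly_pot algebra_simps)
    define q0 where "q0 = monom 1 m + Ppoly m a"
    have pd: "pderiv (pot m a lam) = pderiv q0" by (simp add: pot_def q0_def pderiv_add pderiv_pCons)
    have dq: "degree q0 \<le> m" unfolding q0_def by (intro degree_add_le degree_monom_le degree_Ppoly)
    have cq: "norm (coeff q0 i) \<le> A" for i
      using a[of "m - i"] A by (auto simp: q0_def coeff_Ppoly)
    have dq1: "degree (pderiv q0) \<le> m - 1" using dq by (simp add: degree_pderiv)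
    have cq1: "norm (coeff (pderiv q0) i) \<le> real m * A" for i by (rule coeff_pderiv_bound[OF dq cq])
    have dq2: "degree (pderiv (pderiv q0)) \<le> m - 2" using dq by (simp add: degree_pderiv)
    have cq2: "norm (coeff (pderiv (pderiv q0)) i) \<le> real (m - 1) * (real m * A)" for i by (rule coeff_pderiv_bound[OF dq1 cq1])
    have "norm (poly (pderiv q0) (of_real x)) \<le> real (m - 1 + 1) * (real m * A) * X ^ (m - 1)"
      by (rule poly_norm_bound[OF dq1 cq1 X(4,1)])
    also have "\<dots> \<le> K * X ^ (m - 1)" unfolding K_def using m X A by (intro mult_right_mono) auto
    finally have P1: "norm (poly (pderiv (pot m a lam)) (of_real x)) \<le> K * X ^ (m - 1)" by (simp add: pd)
    have "norm (poly (pderiv (pderiv q0)) (of_real x)) \<le> real (m - 2 + 1) * (real (m - 1) * (real m * A)) * X ^ (m - 2)"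
      by (rule poly_norm_bound[OF dq2 cq2 X(4,1)])
    also have "\<dots> \<le> K * X ^ (m - 2)" 
    proof (rule mult_right_mono)
      have "real (m - 2 + 1) * (real (m - 1) * (real m * A)) \<le> real m * (real m * (real m * A))"
        using m A by (intro mult_mono) auto
      moreover have "0 \<le> real m * (real m * A)" using A by simp
      ultimately show "real (m - 2 + 1) * (real (m - 1) * (real m * A)) \<le> K" unfolding K_def by linarith
    qed (use X in auto)
    finally have P2: "norm (poly (pderiv (pderiv (pot m a lam))) (of_real x)) \<le> K * X ^ (m - 2)" by (simp add: pd)
    show ?thesis using nr P0 P1 P2 unfolding X_def L_def by blast
  qed
  have "R \<ge> 1" unfolding R_def by (rule one_le_power) simp
  moreover have "K \<ge> 0" unfolding K_def using A by simp
  moreover have "c1 / 2 > 0" using c1 by simp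
  ultimately show ?thesis using that[of "c1 / 2" R K, OF _ _ _ main] by blast
qed

section \<open>Expansion of the phase\<close>

lemma poly_Tpoly: "poly (Tpoly m a) s = (\<Sum>j\<le>m div 2 + 1. bb m a j * s ^ j)"
  by (simp add: Tpoly_def poly_sum poly_monom)

lemma exponent_le: "real m - real (m div 2 + 2) \<le> real m / 2 - 3/2"
proof -
  have "real (2 * (m div 2) + 1) \<ge> real m" unfolding of_nat_le_iff by presburger
  then show ?thesis by simp
qed

text \<open>A general polynomial \<open>p\<close> in 1/z is allowed because the derivatives of the
  truncated root are of the same form; the root itself is the case
  \<open>p = Tpoly m a\<close>.\<close>

definition tS :: "nat \<Rightarrow> complex poly \<Rightarrow> complex \<Rightarrow> complex" where
  "tS m p z = exp (of_real (real m / 2) * Ln z) * poly p (inverse z)"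

text \<open>Splits off the 1/z term, whose primitive is a logarithm and does not belong to F. It
  occurs for even m, where z^(m/2) z^(-(m/2+1)) = 1/z and the coefficient is \<nu>.\<close>

lemma tS_Tpoly:
  fixes z :: complex and m :: nat
  assumes "z \<noteq> 0"
  defines "h \<equiv> exp (of_real (real m / 2) * Ln z)"
  shows "tS m (Tpoly m a) z = h + (\<Sum>j=1..(m + 1) div 2. bj m a j * (h * inverse z ^ j)) + nu m a * inverse z"
proof -
  have "{..m div 2 + 1} = insert 0 {1..m div 2 + 1}" by auto
  then have "tS m (Tpoly m a) z = h + (\<Sum>j=1..m div 2 + 1. bj m a j * (h * inverse z ^ j))"
    by (simp add: tS_def poly_Tpoly h_def bb_def algebra_simps sum_distrib_left)
  also have "(\<Sum>j=1..m div 2 + 1. bj m a j * (h * inverse z ^ j)) = (\<Sum>j=1..(m + 1) div 2. bj m a j * (h * inverse z ^ j)) + nu m a * inverse z"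
  proof (cases "odd m")
    case True
    then have "(m + 1) div 2 = m div 2 + 1" by presburger
    then show ?thesis using True by (simp add: nu_def)
  next
    case False
    then obtain l where l: "m = 2 * l" by auto
    have "h = z ^ l" unfolding h_def l using assms(1) by (simp add: exp_of_nat_mult)
    then have "h * inverse z ^ (l + 1) = inverse z" using assms(1) by (simp add: power_inverse)
    then show ?thesis unfolding l by (simp add: nu_def)
  qed
  finally show ?thesis by (simp add: add.assoc)
qed

lemma powr_half_set: "{j. 1 \<le> j \<and> 2 * j < m + 2} = {1..(m + 1) div (2::nat)}" by auto

lemma Fexp_deriv:
  fixes z :: complex and m :: nat
  assumes "z \<notin> \<real>\<^sub>\<le>\<^sub>0"
  defines "h \<equiv> exp (of_real (real m / 2) * Ln z)"
  shows "(Fexp m a has_field_derivative h + (\<Sum>j=1..(m + 1) div 2. bj m a j * (h * inverse z ^ j))) (at z)"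
proof -
  have z: "z \<noteq> 0" using assms by auto
  have d: "((\<lambda>z. of_real (2 / (real m + 2 - 2 * real j)) * z powr of_real ((real m + 2 - 2 * real j) / 2)) has_field_derivative h * inverse z ^ j) (at z)"
    if "2 * j < m + 2" for j
  proof -
    have "real (2 * j) < real (m + 2)" using that by (simp only: of_nat_less_iff)
    then have p: "real m + 2 - 2 * real j \<noteq> 0" by simp
    define e where "e = (real m + 2 - 2 * real j) / 2"
    have e: "e \<noteq> 0" "2 / (real m + 2 - 2 * real j) = 1 / e" "e - 1 = real m / 2 - real j" using p by (auto simp: e_def field_simps)
    have "((\<lambda>z. of_real (1 / e) * z powr of_real e) has_field_derivative of_real (1 / e) * (of_real e * z powr (of_real e - 1))) (at z)"
      by (rule DERIV_cmult) (rule has_field_derivative_powr, use assms in auto)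
    moreover have "of_real (1 / e) * (of_real e * z powr (of_real e - 1)) = z powr of_real (e - 1)" using e(1) by simp
    moreover have "z powr of_real (e - 1) = h * inverse z ^ j"
    proof -
      have "z powr of_real (e - 1) = exp (of_real (real m / 2) * Ln z - of_nat j * Ln z)"
        unfolding e(3) powr_def using z by (simp add: algebra_simps)
      also have "\<dots> = h / z ^ j" unfolding exp_diff exp_of_nat_mult h_def using z by simp
      finally show ?thesis by (simp add: field_simps)
    qed
    ultimately show ?thesis unfolding e_def[symmetric] e(2) by simp
  qed
  \<comment> \<open>The leading term is the case j = 0 of the same computation.\<close>
  have "((\<lambda>z. of_real (2 / (real m + 2)) * z powr of_real ((real m + 2) / 2)) has_field_derivative h) (at z)"
    using d[of 0] by simp
  moreover have "((\<lambda>z. \<Sum>j=1..(m + 1) div 2. bj m a j * (of_real (2 / (real m + 2 - 2 * real j)) * z powr of_real ((real m + 2 - 2 * real j) / 2)))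
     has_field_derivative (\<Sum>j=1..(m + 1) div 2. bj m a j * (h * inverse z ^ j))) (at z)"
    by (rule DERIV_sum, rule DERIV_cmult, rule d) auto
  moreover have "Fexp m a = (\<lambda>z. of_real (2 / (real m + 2)) * z powr of_real ((real m + 2) / 2)
      + (\<Sum>j=1..(m + 1) div 2. bj m a j * (of_real (2 / (real m + 2 - 2 * real j)) * z powr of_real ((real m + 2 - 2 * real j) / 2))))"
    unfolding Fexp_def[abs_def] powr_half_set by (simp only: mult_ac)
  ultimately show ?thesis by (simp only: DERIV_add)
qed

lemma half_power_of_real:
  assumes "x > 0"
  shows "exp (of_real (real m / 2) * Ln (of_real x)) = complex_of_real (x powr (real m / 2))"
    and "exp (of_real (real m / 2) * Ln (of_real x)) * inverse (of_real x) ^ j = complex_of_real (x powr (real m / 2 - real j))"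
proof -
  show 1: "exp (of_real (real m / 2) * Ln (of_real x)) = complex_of_real (x powr (real m / 2))"
    using powr_of_real[of x "real m / 2"] assms by (simp add: powr_def)
  have "x powr (real m / 2 - real j) = x powr (real m / 2) * inverse x ^ j"
    using assms by (simp add: powr_diff powr_realpow power_inverse inverse_eq_divide power_one_over)
  then show "exp (of_real (real m / 2) * Ln (of_real x)) * inverse (of_real x) ^ j = complex_of_real (x powr (real m / 2 - real j))"
    unfolding 1 by simp
qed

lemma Tpoly_near_1:
  obtains C where "C \<ge> 0" "\<And>s. norm s \<le> 1 \<Longrightarrow> norm (poly (Tpoly m a) s - 1) \<le> C * norm s"
proof -
  define C where "C = (\<Sum>j=1..m div 2 + 1. norm (bb m a j))"
  have "norm (poly (Tpoly m a) s - 1) \<le> C * norm s" if s: "norm s \<le> 1" for s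
  proof -
    have "{..m div 2 + 1} = insert 0 {1..m div 2 + 1}" by auto
    then have "poly (Tpoly m a) s - 1 = (\<Sum>j=1..m div 2 + 1. bb m a j * s ^ j)" by (simp add: poly_Tpoly bb_def)
    also have "norm \<dots> \<le> (\<Sum>j=1..m div 2 + 1. norm (bb m a j) * norm s)"
    proof (rule sum_norm_le)
      fix j assume "j \<in> {1..m div 2 + 1}"
      then have "norm s ^ j \<le> norm s" using s power_decreasing[of 1 j "norm s"] by simp
      then show "norm (bb m a j * s ^ j) \<le> norm (bb m a j) * norm s" by (simp add: norm_mult norm_power mult_left_mono)
    qed
    finally show ?thesis unfolding C_def sum_distrib_right .
  qed
  moreover have "C \<ge> 0" unfolding C_def by (rule sum_nonneg) simp
  ultimately show ?thesis using that by blast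
qed

text \<open>\<open>z ^ m * T(1/z)\<^sup>2\<close> is the square of the truncated expansion of \<open>sqrt (z ^ m + P z + lam)\<close>; the constant
  \<open>lam\<close> only enters below the truncation order because \<open>m \<ge> 3\<close>.\<close>

lemma potential_truncation:
  assumes "m \<ge> 3"
  obtains C where "C \<ge> 0"
   "\<And>z. norm z \<ge> 1 \<Longrightarrow> norm (poly (pot m a lam) z - z ^ m * poly (Tpoly m a) (inverse z) ^ 2) \<le> C * norm z powr (real m / 2 - 3/2)"
proof -
  obtain C where C: "C \<ge> 0" "\<And>s. norm s \<le> 1 \<Longrightarrow> norm (poly (Tpoly m a) s ^ 2 - 1 - poly (Ppoly_rev m a) s) \<le> C * norm s ^ (m div 2 + 2)"
    using truncation_bound[of m a] by blast
  have "norm (poly (pot m a lam) z - z ^ m * poly (Tpoly m a) (inverse z) ^ 2) \<le> (C + norm lam) * norm z powr (real m / 2 - 3/2)"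
    if z: "norm z \<ge> 1" for z
  proof -
    have z0: "z \<noteq> 0" using z by auto
    define r where "r = poly (Tpoly m a) (inverse z) ^ 2 - 1 - poly (Ppoly_rev m a) (inverse z)"
    have "norm (z ^ m * r) \<le> norm z ^ m * (C * norm (inverse z) ^ (m div 2 + 2))"
      unfolding norm_mult norm_power r_def
      using z by (intro mult_left_mono C(2)) (auto simp: norm_inverse inverse_le_1_iff)
    also have "\<dots> = C * (norm z ^ m / norm z ^ (m div 2 + 2))"
      by (simp only: norm_inverse power_inverse mult_ac field_class.field_divide_inverse)
    also have "\<dots> = C * norm z powr (real m - real (m div 2 + 2))"
      using powr_realpow[of "norm z" m] powr_realpow[of "norm z" "m div 2 + 2"] z0 unfolding powr_diff by simp
    also have "\<dots> \<le> C * norm z powr (real m / 2 - 3/2)"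
      using z C(1) exponent_le[of m] by (intro mult_left_mono powr_mono) auto
    finally have 1: "norm (z ^ m * r) \<le> C * norm z powr (real m / 2 - 3/2)" .
    have "norm z powr 0 \<le> norm z powr (real m / 2 - 3/2)" using z assms by (intro powr_mono) auto
    then have 2: "norm lam \<le> norm lam * norm z powr (real m / 2 - 3/2)"
      using z0 mult_left_mono[of 1 "norm z powr (real m / 2 - 3/2)" "norm lam"] by simp
    have "poly (pot m a lam) z - z ^ m * poly (Tpoly m a) (inverse z) ^ 2 = lam - z ^ m * r"
      by (simp add: poly_pot r_def algebra_simps poly_Ppoly_rev[OF z0, symmetric])
    then have "norm (poly (pot m a lam) z - z ^ m * poly (Tpoly m a) (inverse z) ^ 2) \<le> norm lam + norm (z ^ m * r)"
      by (simp add: norm_triangle_ineq4)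
    then show ?thesis using 1 2 by (simp add: algebra_simps)
  qed
  then show ?thesis using that[of "C + norm lam"] C(1) by auto
qed

text \<open>Divide the difference of the squares by the sum of the roots. The exact root has
  positive real part and the truncated one has real part at least x^(m/2)/2 once |T(1/x) - 1| is at
  most 1/2, so the sum cannot be small; this also shows that the branches agree.\<close>

lemma sqrt_truncation:
  assumes m: "m \<ge> 3" and nr: "\<And>x::real. x \<ge> 0 \<Longrightarrow> poly (pot m a lam) (of_real x) \<notin> \<real>\<^sub>\<le>\<^sub>0"
  obtains C N where "N \<ge> 1" "\<And>x. x \<ge> real N \<Longrightarrow> norm (lgS (pot m a lam) (of_real x) - tS m (Tpoly m a) (of_real x)) \<le> C * x powr (-3/2)"
proof -
  obtain C where C: "C \<ge> 0"
   "\<And>z. norm z \<ge> 1 \<Longrightarrow> norm (poly (pot m a lam) z - z ^ m * poly (Tpoly m a) (inverse z) ^ 2) \<le> C * norm z powr (real m / 2 - 3/2)"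
    using potential_truncation[OF m, of a lam] by blast
  obtain D where D: "D \<ge> 0" "\<And>s. norm s \<le> 1 \<Longrightarrow> norm (poly (Tpoly m a) s - 1) \<le> D * norm s"
    using Tpoly_near_1[of m a] by blast
  obtain N0 :: nat where N0: "2 * D \<le> real N0" using real_arch_simple by blast
  have "norm (lgS (pot m a lam) (of_real x) - tS m (Tpoly m a) (of_real x)) \<le> 2 * C * x powr (-3/2)" if x: "x \<ge> real (N0 + 1)" for x
  proof -
    define s where "s = lgS (pot m a lam) (of_real x)"
    have x1: "x \<ge> 1" "x > 0" using x by auto
    have Sq: "tS m (Tpoly m a) (of_real x) ^ 2 = of_real x ^ m * poly (Tpoly m a) (inverse (of_real x)) ^ 2"
      using x1 half_power_of_real(1)[of x m] by (simp add: tS_def power_mult_distrib powr_powr powr_realpow flip: of_real_power powr_realpow)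
    have "norm (s ^ 2 - tS m (Tpoly m a) (of_real x) ^ 2) \<le> C * x powr (real m / 2 - 3/2)"
    proof -
      have "poly (pot m a lam) (of_real x) \<noteq> 0" using nr[of x] x1 by auto
      then show ?thesis using C(2)[of "of_real x"] x1 unfolding Sq s_def by (simp add: lgS_square)
    qed
    then have 1: "norm (s - tS m (Tpoly m a) (of_real x)) * norm (s + tS m (Tpoly m a) (of_real x)) \<le> C * x powr (real m / 2 - 3/2)"
      unfolding norm_mult[symmetric] by (simp add: power2_eq_square algebra_simps)
    have "norm (poly (Tpoly m a) (inverse (of_real x)) - 1) \<le> D * norm (inverse (of_real x) :: complex)"
      using x1 by (intro D(2)) (auto simp: norm_inverse inverse_le_1_iff)
    also have "\<dots> \<le> 1/2" using x x1 N0 by (simp add: norm_inverse norm_divide divide_simps mult.commute)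
    finally have "Re (poly (Tpoly m a) (inverse (of_real x))) \<ge> 1/2"
      using abs_Re_le_cmod[of "poly (Tpoly m a) (inverse (of_real x)) - 1"] by simp
    then have "Re (tS m (Tpoly m a) (of_real x)) \<ge> x powr (real m / 2) / 2"
      unfolding tS_def half_power_of_real(1)[OF x1(2)] using mult_left_mono[of "1/2" _ "x powr (real m / 2)"] by simp
    moreover have "Re s > 0" unfolding s_def using nr[of x] x1 by (intro lgS_Re_pos) auto
    ultimately have "norm (s + tS m (Tpoly m a) (of_real x)) \<ge> x powr (real m / 2) / 2"
      using complex_Re_le_cmod[of "s + tS m (Tpoly m a) (of_real x)"] by simp
    then have "norm (s - tS m (Tpoly m a) (of_real x)) * (x powr (real m / 2) / 2) \<le> C * x powr (real m / 2 - 3/2)"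
      using 1 mult_left_mono[of _ _ "norm (s - tS m (Tpoly m a) (of_real x))"] by (meson norm_ge_zero order_trans)
    also have "x powr (real m / 2 - 3/2) = x powr (real m / 2) / 2 * (2 * x powr (-3/2))"
      by (simp add: powr_add[symmetric])
    finally have "norm (s - tS m (Tpoly m a) (of_real x)) * (x powr (real m / 2) / 2) \<le> 2 * C * x powr (-3/2) * (x powr (real m / 2) / 2)"
      by (simp add: mult_ac)
    then show ?thesis using x1 unfolding s_def by simp
  qed
  then show ?thesis using that[of "N0 + 1"] by auto
qed

lemma Fexp_of_real:
  assumes "x \<ge> 0"
  shows "Fexp m a (of_real x) = of_real (2 / (real m + 2) * x powr ((real m + 2) / 2))
    + (\<Sum>j=1..(m + 1) div 2. bj m a j * of_real (2 / (real m + 2 - 2 * real j) * x powr ((real m + 2 - 2 * real j) / 2)))"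
  unfolding Fexp_def powr_half_set powr_of_real[OF assms] by (simp add: mult_ac)

lemma Fexp_deriv_real:
  assumes "x > 0"
  shows "((\<lambda>x. Fexp m a (of_real x)) has_vector_derivative of_real (x powr (real m / 2))
    + (\<Sum>j=1..(m + 1) div 2. bj m a j * of_real (x powr (real m / 2 - real j)))) (at x)"
  unfolding half_power_of_real[OF assms, symmetric]
  by (rule has_vector_derivative_real_field, rule Fexp_deriv) (use assms in auto)

lemma continuous_on_Fexp_real: "continuous_on {0..b} (\<lambda>x. Fexp m a (of_real x))"
proof -
  have p: "continuous_on {0..b} (\<lambda>x. of_real (2 / (real m + 2 - 2 * real j) * x powr ((real m + 2 - 2 * real j) / 2)) :: complex)" if "2 * j < m + 2" for j
  proof -
    have "real (2 * j) < real (m + 2)" using that by (simp only: of_nat_less_iff)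
    then have "(real m + 2 - 2 * real j) / 2 > 0" by simp
    then have "continuous_on {0..b} (\<lambda>x. x powr ((real m + 2 - 2 * real j) / 2))"
      by (intro continuous_on_powr' continuous_on_id continuous_on_const) auto
    then show ?thesis by (intro continuous_on_of_real continuous_on_mult continuous_on_const)
  qed
  have "continuous_on {0..b} (\<lambda>x. of_real (2 / (real m + 2) * x powr ((real m + 2) / 2))
    + (\<Sum>j=1..(m + 1) div 2. bj m a j * of_real (2 / (real m + 2 - 2 * real j) * x powr ((real m + 2 - 2 * real j) / 2))))"
  proof (rule continuous_on_add)
    show "continuous_on {0..b} (\<lambda>x. of_real (2 / (real m + 2) * x powr ((real m + 2) / 2)) :: complex)"
      using p[of 0] by (simp only: mult_zero_right of_nat_0 diff_zero)
    show "continuous_on {0..b} (\<lambda>x. \<Sum>j=1..(m + 1) div 2. bj m a j * of_real (2 / (real m + 2 - 2 * real j) * x powr ((real m + 2 - 2 * real j) / 2)))"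
      by (rule continuous_on_sum, rule continuous_on_mult[OF continuous_on_const], rule p) auto
  qed
  also have "?this \<longleftrightarrow> ?thesis"
    by (rule continuous_on_cong) (auto simp: Fexp_of_real)
  finally show ?thesis .
qed

lemma Fexp_0: "Fexp m a 0 = 0"
  by (simp add: Fexp_def)

section \<open>The phase integral\<close>

definition Lfun :: "nat \<Rightarrow> (nat \<Rightarrow> complex) \<Rightarrow> complex \<Rightarrow> real \<Rightarrow> complex" where
  "Lfun m a lam x = csqrt (of_real x ^ m + poly (Ppoly m a) (of_real x) + lam)
        - of_real (x powr (real m / 2))
        - (\<Sum>j=1..(m + 1) div 2. bj m a j * of_real (x powr (real m / 2 - real j)))
        - nu m a / (of_real x + 1)"

text \<open>A primitive of the integrand of L that vanishes at 0; the logarithm of x + 1 matches the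
  regularised term \<nu>/(x + 1).\<close>

definition Hfun :: "nat \<Rightarrow> (nat \<Rightarrow> complex) \<Rightarrow> complex \<Rightarrow> real \<Rightarrow> complex" where
  "Hfun m a lam x = lgXi (pot m a lam) x - Fexp m a (of_real x) - nu m a * of_real (ln (x + 1))"

lemma continuous_on_lgS:
  assumes nr: "\<And>x::real. x \<ge> 0 \<Longrightarrow> poly q (of_real x) \<notin> \<real>\<^sub>\<le>\<^sub>0"
  shows "continuous_on {0..b} (\<lambda>x. lgS q (of_real x))"
  unfolding lgS_def using nr by (intro continuous_intros) (auto simp: complex_nonpos_Reals_iff)

text \<open>For odd m the integrand may contain x^(-1/2), so differentiability at 0 can fail. The
  primitive is continuous there, since all exponents in F are positive, and derivatives in the
  interior suffice.\<close>

lemma Lfun_has_integral: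
  assumes nr: "\<And>x::real. x \<ge> 0 \<Longrightarrow> poly (pot m a lam) (of_real x) \<notin> \<real>\<^sub>\<le>\<^sub>0" and ab: "0 \<le> a0" "a0 \<le> b"
  shows "(Lfun m a lam has_integral (Hfun m a lam b - Hfun m a lam a0)) {a0..b}"
proof (rule fundamental_theorem_of_calculus_interior[OF \<open>a0 \<le> b\<close>])
  let ?q = "pot m a lam"
  have dX: "(lgXi ?q has_vector_derivative lgS ?q (of_real x)) (at x within {0..b})" if "x \<in> {0..b}" for x
    unfolding lgXi_def[abs_def] using integral_has_vector_derivative[OF continuous_on_lgS[OF nr] that] by simp
  have cX: "continuous_on {0..b} (lgXi ?q)" by (rule continuous_on_vector_derivative) (rule dX)
  show "continuous_on {a0..b} (Hfun m a lam)"
    unfolding Hfun_def[abs_def] using ab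
    by (intro continuous_intros continuous_on_subset[OF cX] continuous_on_subset[OF continuous_on_Fexp_real]) auto
  fix x assume x: "x \<in> {a0<..<b}"
  then have x0: "x > 0" "x < b" using ab by auto
  have "(lgXi ?q has_vector_derivative lgS ?q (of_real x)) (at x)"
    using dX[of x] x0 by (simp add: at_within_Icc_at)
  moreover have "((\<lambda>x. of_real (ln (x + 1)) :: complex) has_vector_derivative of_real (1 / (x + 1))) (at x)"
    using x0 by (intro has_vector_derivative_of_real) (auto intro!: derivative_eq_intros)
  ultimately have "(Hfun m a lam has_vector_derivative lgS ?q (of_real x) - (of_real (x powr (real m / 2))
    + (\<Sum>j=1..(m + 1) div 2. bj m a j * of_real (x powr (real m / 2 - real j)))) - nu m a * of_real (1 / (x + 1))) (at x)"
    unfolding Hfun_def[abs_def]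
    by (intro has_vector_derivative_diff has_vector_derivative_mult_right Fexp_deriv_real x0)
  moreover have "lgS ?q (of_real x) = csqrt (poly ?q (of_real x))"
    using nr[of x] x0 by (subst csqrt_exp_Ln) (auto simp: lgS_def)
  ultimately show "(Hfun m a lam has_vector_derivative Lfun m a lam x) (at x)"
    by (elim has_vector_derivative_eq_rhs) (simp add: Lfun_def poly_pot)
qed

lemma Hfun_0: "Hfun m a lam 0 = 0"
  by (simp add: Hfun_def lgXi_def Fexp_0)

text \<open>This is the origin of L: it is the limit of the exact phase minus F and the logarithmic
  term. The integrand is O(x^(-3/2)), which makes the improper integral converge absolutely at
  infinity.\<close>

lemma Lint_limit:
  assumes m: "m \<ge> 3" and nr: "\<And>x::real. x \<ge> 0 \<Longrightarrow> poly (pot m a lam) (of_real x) \<notin> \<real>\<^sub>\<le>\<^sub>0"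
  shows "(\<lambda>n. Hfun m a lam (real n)) \<longlonglongrightarrow> Lint m a lam"
proof -
  let ?q = "pot m a lam" and ?f = "Lfun m a lam" and ?H = "Hfun m a lam"
  obtain C N where N: "N \<ge> 1" and C: "\<And>x. x \<ge> real N \<Longrightarrow> norm (lgS ?q (of_real x) - tS m (Tpoly m a) (of_real x)) \<le> C * x powr (-3/2)"
    using sqrt_truncation[OF m nr] by blast
  define D where "D = (\<lambda>x::real. (C + norm (nu m a)) * x powr (-3/2))"
  have fD: "norm (?f x) \<le> D x" if x: "x \<ge> real N" for x
  proof -
    have x1: "x \<ge> 1" using x N by linarith
    have "lgS ?q (of_real x) = csqrt (poly ?q (of_real x))"
      using nr[of x] x1 by (subst csqrt_exp_Ln) (auto simp: lgS_def)
    \<comment> \<open>The truncated root contains \<nu>/x where the integrand has \<nu>/(x + 1); the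
      difference is of order x^(-2).\<close>
    then have e: "?f x = (lgS ?q (of_real x) - tS m (Tpoly m a) (of_real x)) + nu m a * of_real (inverse x - 1 / (x + 1))"
      using x1 tS_Tpoly[of "of_real x" m a] half_power_of_real[of x m] by (simp add: Lfun_def poly_pot algebra_simps)
    have "\<bar>inverse x - 1 / (x + 1)\<bar> = 1 / (x * (x + 1))" using x1 by (simp add: field_simps)
    also have "\<dots> \<le> x powr (-2)" 
    proof -
      have "1 / (x * (x + 1)) \<le> 1 / (x * x)" using x1 by (intro frac_le mult_left_mono) auto
      then show ?thesis using x1 by (simp add: powr_minus_divide power2_eq_square)
    qed
    also have "\<dots> \<le> x powr (-3/2)" using x1 by (intro powr_mono) auto
    finally have "norm (nu m a * of_real (inverse x - 1 / (x + 1))) \<le> norm (nu m a) * x powr (-3/2)"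
      unfolding norm_mult norm_of_real by (intro mult_left_mono) auto
    then show ?thesis unfolding e D_def using C[OF x] norm_triangle_ineq[of "lgS ?q (of_real x) - tS m (Tpoly m a) (of_real x)" "nu m a * of_real (inverse x - 1 / (x + 1))"]
      by (simp add: algebra_simps)
  qed
  have Dint: "D integrable_on {real N..}"
    unfolding D_def using has_integral_powr_to_inf[of "-3/2" "real N"] N by (intro integrable_on_mult_right) (auto simp: integrable_on_def)
  \<comment> \<open>Cut-off integrands: dominated convergence yields both integrability up to
    infinity and the limit of the primitives.\<close>
  define g where "g = (\<lambda>k x. if x \<in> {real N..real (N + k)} then ?f x else 0)"
  have g: "(g k has_integral (?H (real (N + k)) - ?H (real N))) {real N..}" for k
  proof -
    have "(?f has_integral (?H (real (N + k)) - ?H (real N))) {real N..real (N + k)}"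
      by (rule Lfun_has_integral[OF nr]) auto
    then show ?thesis unfolding g_def by (subst has_integral_restrict) auto
  qed
  have dc: "?f integrable_on {real N..}" "(\<lambda>k. integral {real N..} (g k)) \<longlonglongrightarrow> integral {real N..} ?f"
  proof -
    have 1: "g k integrable_on {real N..}" for k using g by blast
    have 2: "norm (g k x) \<le> D x" if "x \<in> {real N..}" for k x
      using fD[of x] order_trans[OF norm_ge_zero fD[of x]] that by (auto simp: g_def)
    have 3: "(\<lambda>k. g k x) \<longlonglongrightarrow> ?f x" if "x \<in> {real N..}" for x
    proof (rule tendsto_eventually)
      obtain k0 :: nat where "x \<le> real k0" using real_arch_simple by blast
      then have "g k x = ?f x" if "k \<ge> k0" for k using that \<open>x \<in> _\<close> by (auto simp: g_def)
      then show "\<forall>\<^sub>F k in sequentially. g k x = ?f x" by (auto simp: eventually_sequentially)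
    qed
    show "?f integrable_on {real N..}" "(\<lambda>k. integral {real N..} (g k)) \<longlonglongrightarrow> integral {real N..} ?f"
      by (rule dominated_convergence[OF 1 Dint 2 3]; simp)+
  qed
  have "(\<lambda>k. ?H (real (N + k)) - ?H (real N)) \<longlonglongrightarrow> integral {real N..} ?f"
    using dc(2) by (simp only: integral_unique[OF g])
  then have "(\<lambda>k. ?H (real (N + k)) - ?H (real N) + ?H (real N)) \<longlonglongrightarrow> integral {real N..} ?f + ?H (real N)"
    by (intro tendsto_intros)
  then have lim: "(\<lambda>k. ?H (real (k + N))) \<longlonglongrightarrow> integral {real N..} ?f + ?H (real N)" by (simp add: add.commute)
  have "(?f has_integral (?H (real N) - ?H 0)) {0..real N}" by (rule Lfun_has_integral[OF nr]) auto
  then have "(?f has_integral (?H (real N) + integral {real N..} ?f)) ({0..real N} \<union> {real N..})"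
    by (intro has_integral_Un integrable_integral dc(1)) (auto simp: Hfun_0 intro: negligible_subset[of "{real N}"])
  moreover have "{0..real N} \<union> {real N..} = {0..}" by auto
  ultimately have "(?f has_integral (?H (real N) + integral {real N..} ?f)) {0..}" by simp
  then have "(?f has_integral (?H (real N) + integral {real N..} ?f)) {0<..}"
    by (subst has_integral_spike_set_eq[of "{0<..}" "{0..}"]) (auto intro: negligible_subset[of "{0}"])
  then have "integral {0<..} ?f = ?H (real N) + integral {real N..} ?f" by (rule integral_unique)
  then have "Lint m a lam = ?H (real N) + integral {real N..} ?f"
    by (simp add: Lint_def Lfun_def[abs_def])
  then show ?thesis using LIMSEQ_offset[OF lim] by (simp add: add.commute)
qed

section \<open>Normalisation at infinity along the integers\<close>

lemma pot_ratio_limit: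
  "(\<lambda>n. poly (pot m a lam) (of_nat n) / of_nat n ^ m) \<longlonglongrightarrow> 1" if "m \<ge> 1"
proof -
  have n: "(\<lambda>n. inverse (of_nat n :: complex)) \<longlonglongrightarrow> 0"
    by (rule lim_inverse_n)
  have "(\<lambda>n. 1 + poly (Ppoly_rev m a) (inverse (of_nat n)) + lam * inverse (of_nat n) ^ m) \<longlonglongrightarrow> 1 + poly (Ppoly_rev m a) 0 + lam * 0 ^ m"
    by (intro tendsto_intros n tendsto_poly)
  moreover have "poly (Ppoly_rev m a) 0 = 0" by (auto simp: Ppoly_rev_def poly_sum poly_monom)
  ultimately have "(\<lambda>n. 1 + poly (Ppoly_rev m a) (inverse (of_nat n)) + lam * inverse (of_nat n) ^ m) \<longlonglongrightarrow> 1"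
    using that by (simp add: zero_power)
  then show ?thesis
  proof (rule Lim_transform_eventually)
    show "\<forall>\<^sub>F n in sequentially. 1 + poly (Ppoly_rev m a) (inverse (of_nat n)) + lam * inverse (of_nat n) ^ m = poly (pot m a lam) (of_nat n) / of_nat n ^ m"
      using eventually_gt_at_top[of 0]
    proof eventually_elim
      case (elim n)
      then have n0: "(of_nat n :: complex) \<noteq> 0" by simp
      show ?case unfolding poly_pot poly_Ppoly_rev[OF n0, symmetric] using n0 by (simp add: field_simps power_inverse)
    qed
  qed
qed

text \<open>Division by the positive number n^m leaves the argument unchanged, so the principal
  logarithm splits exactly and continuity of \<open>Ln\<close> at 1 is enough.\<close>

lemma Ln_pot_limit:
  assumes "m \<ge> 1"
  shows "(\<lambda>n. Ln (poly (pot m a lam) (of_nat n)) - of_real (real m * ln (real n))) \<longlonglongrightarrow> 0"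
proof -
  have "(\<lambda>n. Ln (poly (pot m a lam) (of_nat n) / of_nat n ^ m)) \<longlonglongrightarrow> Ln 1"
    by (intro tendsto_Ln pot_ratio_limit assms) simp
  moreover have "\<forall>\<^sub>F n in sequentially. Ln (poly (pot m a lam) (of_nat n) / of_nat n ^ m) = Ln (poly (pot m a lam) (of_nat n)) - of_real (real m * ln (real n))"
    using eventually_gt_at_top[of 0] tendsto_imp_eventually_ne[OF pot_ratio_limit[OF assms, of a lam], of 0, OF one_neq_zero]
  proof eventually_elim
    case (elim n)
    then have "poly (pot m a lam) (of_nat n) \<noteq> 0" by auto
    then have "Ln (poly (pot m a lam) (of_nat n) / of_real (real n ^ m)) = Ln (poly (pot m a lam) (of_nat n)) - ln (real n ^ m)"
      using elim by (intro Ln_divide_of_real) auto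
    then show ?case using elim by (simp add: ln_realpow)
  qed
  ultimately show ?thesis by (simp add: Lim_transform_eventually)
qed

definition asym0 :: "nat \<Rightarrow> (nat \<Rightarrow> complex) \<Rightarrow> complex \<Rightarrow> complex" where
  "asym0 m a z = z powr (mu m a - of_real (real m / 2)) * exp (- Fexp m a z)"

text \<open>The leading form of -f', whence the plus sign in \<open>asym_bound\<close>.\<close>

definition asym1 :: "nat \<Rightarrow> (nat \<Rightarrow> complex) \<Rightarrow> complex \<Rightarrow> complex" where
  "asym1 m a z = z powr (mu m a) * exp (- Fexp m a z)"

abbreviation asym_bound :: "nat \<Rightarrow> (nat \<Rightarrow> complex) \<Rightarrow> real \<Rightarrow> (complex \<Rightarrow> complex) \<Rightarrow> (complex \<Rightarrow> complex) \<Rightarrow> complex \<Rightarrow> bool" where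
  "asym_bound m a C y y' z \<equiv> norm (y z - asym0 m a z) \<le> C * norm z powr (- 1 / 2) * norm (asym0 m a z)
     \<and> norm (y' z + asym1 m a z) \<le> C * norm z powr (- 1 / 2) * norm (asym1 m a z)"

text \<open>Translates the normalisation at infinity into limits of \<open>U\<close> and
  \<open>B\<close>. A general \<gamma> covers both the normalised solution, \<gamma> = 1, and the
  difference of two of them, \<gamma> = 0. In \<open>B\<close> the contributions of y' and y tend to
  opposite values and cancel.\<close>

lemma lgU_lgB_limit:
  assumes m: "m \<ge> 3" and nr: "\<And>x::real. x \<ge> 0 \<Longrightarrow> poly (pot m a lam) (of_real x) \<notin> \<real>\<^sub>\<le>\<^sub>0"
    and y: "(\<lambda>n. y (of_nat n) / asym0 m a (of_nat n)) \<longlonglongrightarrow> \<gamma>"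
    and y': "(\<lambda>n. y' (of_nat n) / asym1 m a (of_nat n)) \<longlonglongrightarrow> - \<gamma>"
  shows "(\<lambda>n. lgU (pot m a lam) y (real n)) \<longlonglongrightarrow> \<gamma> * exp (Lint m a lam)"
    and "(\<lambda>n. lgB (pot m a lam) y y' (real n)) \<longlonglongrightarrow> 0"
proof -
  let ?q = "pot m a lam"
  \<comment> \<open>\<open>d\<close> is the error in Ln q(n) = m ln n + o(1), and \<open>l\<close>
    replaces ln (n + 1) by ln n; both tend to 0.\<close>
  define d where "d = (\<lambda>n. Ln (poly ?q (of_nat n)) - of_real (real m * ln (real n)))"
  define l where "l = (\<lambda>n. complex_of_real (ln (real n + 1) - ln (real n)))"
  have d: "d \<longlonglongrightarrow> 0" unfolding d_def using m by (intro Ln_pot_limit) auto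
  have "(\<lambda>n. ln (real n + 1) - ln (real n)) \<longlonglongrightarrow> 0" by real_asymp
  then have l: "l \<longlonglongrightarrow> 0" unfolding l_def using tendsto_of_real by fastforce
  note H = Lint_limit[OF m nr]
  have Xi: "lgXi ?q x = Hfun m a lam x + Fexp m a (of_real x) + nu m a * of_real (ln (x + 1))" for x
    by (simp add: Hfun_def)
  have U: "\<forall>\<^sub>F n in sequentially. y (of_nat n) / asym0 m a (of_nat n) * exp (Hfun m a lam (real n) + nu m a * l n + d n / 4) = lgU ?q y (real n)"
    using eventually_gt_at_top[of 0]
  proof eventually_elim
    case (elim n)
    then have L: "Ln (of_nat n) = of_real (ln (real n))" using Ln_of_nat by simp
    have *: "asym0 m a (of_nat n) = exp ((mu m a - of_real (real m / 2)) * of_real (ln (real n)) - Fexp m a (of_nat n))"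
      using elim by (simp add: asym0_def powr_def L exp_diff exp_minus inverse_eq_divide)
    have "exp (lgXi ?q (real n)) * lgR ?q (of_nat n) * asym0 m a (of_nat n) = exp (Hfun m a lam (real n) + nu m a * l n + d n / 4)"
    proof -
      define k where "k = complex_of_real (ln (real n))"
      \<comment> \<open>All multiples of ln n cancel: R contributes m/4, the power in
        \<open>asym0\<close> contributes \<mu> - m/2 = -m/4 - \<nu>, and the phase contributes
        \<nu>.\<close>
      have e: "lgXi ?q (real n) + Ln (poly ?q (of_nat n)) / 4 + ((mu m a - of_real (real m / 2)) * k - Fexp m a (of_nat n))
        = Hfun m a lam (real n) + nu m a * l n + d n / 4"
        by (simp add: Xi mu_def l_def d_def k_def[symmetric] field_simps)
      show ?thesis
        unfolding * lgR_def k_def[symmetric] exp_add[symmetric] e ..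
    qed
    then show ?case using elim by (simp add: lgU_def asym0_def field_simps)
  qed
  have "(\<lambda>n. y (of_nat n) / asym0 m a (of_nat n) * exp (Hfun m a lam (real n) + nu m a * l n + d n / 4)) \<longlonglongrightarrow> \<gamma> * exp (Lint m a lam + nu m a * 0 + 0 / 4)"
    by (intro tendsto_intros y H l d) simp_all
  then show Ulim: "(\<lambda>n. lgU ?q y (real n)) \<longlonglongrightarrow> \<gamma> * exp (Lint m a lam)"
    using Lim_transform_eventually[OF _ U] by simp
  have V: "\<forall>\<^sub>F n in sequentially. y' (of_nat n) / asym1 m a (of_nat n) * exp (Hfun m a lam (real n) + nu m a * l n - d n / 4)
     = y' (of_nat n) * exp (lgXi ?q (real n)) * lgR ?q (of_nat n) / lgS ?q (of_nat n)"
    using eventually_gt_at_top[of 0]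
  proof eventually_elim
    case (elim n)
    then have L: "Ln (of_nat n) = of_real (ln (real n))" using Ln_of_nat by simp
    have *: "asym1 m a (of_nat n) = exp (mu m a * of_real (ln (real n)) - Fexp m a (of_nat n))"
      using elim by (simp add: asym1_def powr_def L exp_diff exp_minus inverse_eq_divide)
    have "exp (lgXi ?q (real n)) * lgR ?q (of_nat n) / lgS ?q (of_nat n) * asym1 m a (of_nat n) = exp (Hfun m a lam (real n) + nu m a * l n - d n / 4)"
    proof -
      define k where "k = complex_of_real (ln (real n))"
      have e: "lgXi ?q (real n) + Ln (poly ?q (of_nat n)) / 4 - Ln (poly ?q (of_nat n)) / 2 + (mu m a * k - Fexp m a (of_nat n))
        = Hfun m a lam (real n) + nu m a * l n - d n / 4"
        by (simp add: Xi mu_def l_def d_def k_def[symmetric] field_simps)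
      show ?thesis
        unfolding * lgR_def lgS_def k_def[symmetric] exp_add[symmetric] exp_diff[symmetric] e ..
    qed
    then show ?case using elim by (simp add: asym1_def field_simps)
  qed
  have "(\<lambda>n. y' (of_nat n) / asym1 m a (of_nat n) * exp (Hfun m a lam (real n) + nu m a * l n - d n / 4)) \<longlonglongrightarrow> - \<gamma> * exp (Lint m a lam + nu m a * 0 - 0 / 4)"
    by (intro tendsto_intros y' H l d) simp_all
  then have Vlim: "(\<lambda>n. y' (of_nat n) * exp (lgXi ?q (real n)) * lgR ?q (of_nat n) / lgS ?q (of_nat n)) \<longlonglongrightarrow> - \<gamma> * exp (Lint m a lam)"
    using Lim_transform_eventually[OF _ V] by simp
  have inf: "filterlim (of_nat :: nat \<Rightarrow> complex) at_infinity sequentially"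
    by (rule tendsto_of_nat)
  have dq: "degree ?q = m"
  proof -
    have "degree (Ppoly m a + [:lam:]) < m"
      using m by (intro degree_add_less) (auto simp: coeff_Ppoly intro!: le_less_trans[OF degree_le[of "m - 1"]])
    then show ?thesis unfolding pot_def add.assoc by (subst degree_add_eq_left) (auto simp: degree_monom_eq)
  qed
  have r1: "(\<lambda>n. poly (pderiv ?q) (of_nat n) / poly ?q (of_nat n)) \<longlonglongrightarrow> 0"
    by (rule filterlim_compose[OF poly_divide_tendsto_0_at_infinity inf]) (use m dq in \<open>auto simp: degree_pderiv\<close>)
  have s: "(\<lambda>n. inverse (lgS ?q (of_nat n))) \<longlonglongrightarrow> 0"
  proof -
    have "(\<lambda>n. of_real (real n powr (- real m / 2)) * exp (- d n / 2)) \<longlonglongrightarrow> of_real 0 * exp (- 0 / 2)"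
      using m by (intro tendsto_intros d) (auto, real_asymp)
    moreover have "\<forall>\<^sub>F n in sequentially. of_real (real n powr (- real m / 2)) * exp (- d n / 2) = inverse (lgS ?q (of_nat n))"
      using eventually_gt_at_top[of 0]
      by eventually_elim (simp add: lgS_def d_def powr_def exp_minus[symmetric] exp_of_real[symmetric] exp_add[symmetric] diff_divide_distrib)
    ultimately show ?thesis by (simp add: Lim_transform_eventually)
  qed
  have "(\<lambda>n. (poly (pderiv ?q) (of_nat n) / poly ?q (of_nat n)) * inverse (lgS ?q (of_nat n)) / 4) \<longlonglongrightarrow> 0 * 0 / 4"
    by (intro tendsto_intros r1 s) simp_all
  moreover have "(poly (pderiv ?q) (of_nat n) / poly ?q (of_nat n)) * inverse (lgS ?q (of_nat n)) / 4 = poly (pderiv ?q) (of_nat n) / (4 * lgS ?q (of_nat n) ^ 3)" for n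
  proof -
    have "poly ?q (of_nat n) \<noteq> 0" using nr[of "real n"] by auto
    then show ?thesis by (simp add: lgS_square[symmetric] field_simps power2_eq_square power3_eq_cube)
  qed
  ultimately have r: "(\<lambda>n. poly (pderiv ?q) (of_nat n) / (4 * lgS ?q (of_nat n) ^ 3)) \<longlonglongrightarrow> 0" by simp
  have "(\<lambda>n. - (y' (of_nat n) * exp (lgXi ?q (real n)) * lgR ?q (of_nat n) / lgS ?q (of_nat n)
     + (1 + poly (pderiv ?q) (of_nat n) / (4 * lgS ?q (of_nat n) ^ 3)) * lgU ?q y (real n)) / 2)
    \<longlonglongrightarrow> - (- \<gamma> * exp (Lint m a lam) + (1 + 0) * (\<gamma> * exp (Lint m a lam))) / 2"
    by (intro tendsto_intros Vlim r Ulim) simp_all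
  then show "(\<lambda>n. lgB ?q y y' (real n)) \<longlonglongrightarrow> 0" by (simp add: lgB_def)
qed

section \<open>The Liouville-Green data in the slit plane\<close>

definition solves :: "complex poly \<Rightarrow> (complex \<Rightarrow> complex) \<Rightarrow> (complex \<Rightarrow> complex) \<Rightarrow> bool" where
  "solves q y y' \<longleftrightarrow> (\<forall>z. (y has_field_derivative y' z) (at z)) \<and> (\<forall>z. (y' has_field_derivative poly q z * y z) (at z))"

lemma solvesD:
  assumes "solves q y y'"
  shows "(y has_field_derivative y' z) (at z)" "(y' has_field_derivative poly q z * y z) (at z)"
  using assms by (auto simp: solves_def)

lemma solves_combination:
  assumes "solves q y y'" "solves q w w'"
  shows "solves q (\<lambda>z. b * y z + c * w z) (\<lambda>z. b * y' z + c * w' z)"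
  using assms unfolding solves_def by (auto intro!: derivative_eq_intros simp: algebra_simps)

lemma wronskian_constant:
  assumes y: "solves q y y'" and w: "solves q w w'"
  shows "y z * w' z - y' z * w z = y 0 * w' 0 - y' 0 * w 0"
proof -
  have "((\<lambda>z. y z * w' z - y' z * w z) has_field_derivative 0) (at z)" for z
    by (rule derivative_eq_intros solvesD[OF y] solvesD[OF w] refl)+ simp
  then obtain c where "\<forall>z\<in>UNIV. y z * w' z - y' z * w z = c"
    using has_field_derivative_zero_constant[of UNIV "\<lambda>z. y z * w' z - y' z * w z"] by auto
  then show ?thesis by auto
qed

text \<open>The basis with initial data (1, 0) and (0, 1) has Wronskian 1, so Cramer's rule converts
  values of y and y' at any point into the data at 0.\<close>

lemma solution_basis:
  obtains e1 e1' e2 e2' where "solves q e1 e1'" "solves q e2 e2'"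
   "\<And>z. e1 z * e2' z - e1' z * e2 z = 1"
   "\<And>y y' z. solves q y y' \<Longrightarrow> y z * e2' z - y' z * e2 z = y 0"
   "\<And>y y' z. solves q y y' \<Longrightarrow> e1 z * y' z - e1' z * y z = y' 0"
   "\<And>y y' z. solves q y y' \<Longrightarrow> y z = y 0 * e1 z + y' 0 * e2 z"
   "\<And>y y' z. solves q y y' \<Longrightarrow> y' z = y 0 * e1' z + y' 0 * e2' z"
proof -
  obtain e1 e1' where 1: "\<And>z. (e1 has_field_derivative e1' z) (at z)"
    "\<And>z. (e1' has_field_derivative poly q z * e1 z) (at z)" "e1 0 = 1" "e1' 0 = 0"
    using entire_solution[of q 1 0] by metis
  obtain e2 e2' where 2: "\<And>z. (e2 has_field_derivative e2' z) (at z)"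
    "\<And>z. (e2' has_field_derivative poly q z * e2 z) (at z)" "e2 0 = 0" "e2' 0 = 1"
    using entire_solution[of q 0 1] by metis
  have s: "solves q e1 e1'" "solves q e2 e2'" using 1 2 by (auto simp: solves_def)
  have W: "e1 z * e2' z - e1' z * e2 z = 1" for z
    using wronskian_constant[OF s, of z] 1 2 by simp
  have a: "y z * e2' z - y' z * e2 z = y 0" if "solves q y y'" for y y' z
    using wronskian_constant[OF that s(2), of z] 2 by simp
  have b: "e1 z * y' z - e1' z * y z = y' 0" if "solves q y y'" for y y' z
    using wronskian_constant[OF s(1) that, of z] 1 by simp
  have c: "y z = y 0 * e1 z + y' 0 * e2 z" if y: "solves q y y'" for y y' z
  proof -
    have "y z = y z * (e1 z * e2' z - e1' z * e2 z)" by (simp add: W)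
    also have "\<dots> = (y z * e2' z - y' z * e2 z) * e1 z + (e1 z * y' z - e1' z * y z) * e2 z" by (simp add: algebra_simps)
    finally show ?thesis unfolding a[OF y] b[OF y] .
  qed
  have d: "y' z = y 0 * e1' z + y' 0 * e2' z" if y: "solves q y y'" for y y' z
  proof -
    have "y' z = y' z * (e1 z * e2' z - e1' z * e2 z)" by (simp add: W)
    also have "\<dots> = (y z * e2' z - y' z * e2 z) * e1' z + (e1 z * y' z - e1' z * y z) * e2' z" by (simp add: algebra_simps)
    finally show ?thesis unfolding a[OF y] b[OF y] .
  qed
  show ?thesis by (rule that[of e1 e1' e2 e2']) (fact s W a b c d)+
qed

lemma solves_unique:
  assumes "solves q y y'" "solves q w w'" "y 0 = w 0" "y' 0 = w' 0"
  shows "y = w" "y' = w'"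
proof -
  have "y z = w z \<and> y' z = w' z" for z
  proof (rule solution_basis[of q])
    fix e1 e1' e2 e2'
    assume e: "\<And>y y' z. solves q y y' \<Longrightarrow> y z = y 0 * e1 z + y' 0 * e2 z"
      "\<And>y y' z. solves q y y' \<Longrightarrow> y' z = y 0 * e1' z + y' 0 * e2' z"
    show ?thesis
      using e(1)[OF assms(1), of z] e(1)[OF assms(2), of z] e(2)[OF assms(1), of z] e(2)[OF assms(2), of z] assms(3,4) by simp
  qed
  then show "y = w" "y' = w'" by auto
qed

text \<open>The action of z d/dz on z^(m/2) p(1/z), transferred to the polynomial p.\<close>

definition euler_op :: "nat \<Rightarrow> complex poly \<Rightarrow> complex poly" where
  "euler_op m p = smult (of_real (real m / 2)) p - pCons 0 (pderiv p)"

lemma tS_deriv: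
  assumes "z \<notin> \<real>\<^sub>\<le>\<^sub>0"
  shows "(tS m p has_field_derivative tS m (euler_op m p) z / z) (at z)"
proof -
  have z: "z \<noteq> 0" using assms by auto
  have "((\<lambda>z. exp (of_real (real m / 2) * Ln z)) has_field_derivative exp (of_real (real m / 2) * Ln z) * (of_real (real m / 2) / z)) (at z)"
    using assms by (auto intro!: derivative_eq_intros simp: inverse_eq_divide)
  moreover have "((\<lambda>z. poly p (inverse z)) has_field_derivative poly (pderiv p) (inverse z) * - (inverse z * inverse z)) (at z)"
    using z by (intro DERIV_chain2[OF poly_DERIV]) (auto intro!: derivative_eq_intros simp: power2_eq_square)
  ultimately have "((\<lambda>z. exp (of_real (real m / 2) * Ln z) * poly p (inverse z)) has_field_derivative
    exp (of_real (real m / 2) * Ln z) * (of_real (real m / 2) / z) * poly p (inverse z)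
     + poly (pderiv p) (inverse z) * - (inverse z * inverse z) * exp (of_real (real m / 2) * Ln z)) (at z)"
    by (rule DERIV_mult)
  then show ?thesis unfolding tS_def[abs_def] euler_op_def
    by (rule back_subst[where P = "\<lambda>d. (_ has_field_derivative d) _"]) (use z in \<open>simp add: field_simps\<close>)
qed

text \<open>A square root of \<open>tS\<close> with separate logarithms for z^(m/2) and for p(1/z):
  the principal logarithm of the product may jump inside the sectors.\<close>

definition tR :: "nat \<Rightarrow> complex poly \<Rightarrow> complex \<Rightarrow> complex" where
  "tR m p z = exp (of_real (real m / 4) * Ln z + Ln (poly p (inverse z)) / 2)"

lemma tR_deriv:
  assumes "z \<notin> \<real>\<^sub>\<le>\<^sub>0" "poly p (inverse z) \<notin> \<real>\<^sub>\<le>\<^sub>0"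
  shows "(tR m p has_field_derivative tS m (euler_op m p) z / z / (2 * tS m p z) * tR m p z) (at z)"
proof -
  have z: "z \<noteq> 0" "poly p (inverse z) \<noteq> 0" using assms by auto
  have "((\<lambda>z. poly p (inverse z)) has_field_derivative poly (pderiv p) (inverse z) * - (inverse z * inverse z)) (at z)"
    using z by (intro DERIV_chain2[OF poly_DERIV]) (auto intro!: derivative_eq_intros simp: power2_eq_square)
  then have "((\<lambda>z. Ln (poly p (inverse z))) has_field_derivative inverse (poly p (inverse z)) * (poly (pderiv p) (inverse z) * - (inverse z * inverse z))) (at z)"
    by (intro DERIV_chain2[OF has_field_derivative_Ln]) (use assms in auto)
  then have "(tR m p has_field_derivative tR m p z * (of_real (real m / 4) / z + inverse (poly p (inverse z)) * (poly (pderiv p) (inverse z) * - (inverse z * inverse z)) / 2)) (at z)"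
    unfolding tR_def[abs_def] using assms(1) assms(2)[unfolded inverse_eq_divide] by (auto intro!: derivative_eq_intros simp: field_simps)
  then show ?thesis
    by (rule back_subst[where P = "\<lambda>d. (_ has_field_derivative d) _"]) (use z in \<open>simp add: tS_def euler_op_def field_simps\<close>)
qed

text \<open>Primitive of the truncated root. The logarithm belongs to the 1/z term and accounts for
  the shift by -\<nu> in the exponent \<mu>.\<close>

definition tXi :: "nat \<Rightarrow> (nat \<Rightarrow> complex) \<Rightarrow> complex \<Rightarrow> complex" where
  "tXi m a z = Fexp m a z + nu m a * Ln z"

lemma tXi_deriv:
  assumes "z \<notin> \<real>\<^sub>\<le>\<^sub>0"
  shows "(tXi m a has_field_derivative tS m (Tpoly m a) z) (at z)"
proof -
  have "((\<lambda>z. nu m a * Ln z) has_field_derivative nu m a * inverse z) (at z)"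
    using assms by (auto intro!: derivative_eq_intros simp: inverse_eq_divide)
  moreover have "z \<noteq> 0" using assms by auto
  ultimately show ?thesis
    unfolding tXi_def[abs_def] tS_Tpoly[OF \<open>z \<noteq> 0\<close>] by (intro DERIV_add Fexp_deriv assms)
qed

definition tS1 :: "nat \<Rightarrow> (nat \<Rightarrow> complex) \<Rightarrow> complex \<Rightarrow> complex" where
  "tS1 m a z = tS m (euler_op m (Tpoly m a)) z / z"

text \<open>Second derivative of the truncated root, from z^2 (d/dz)^2 = (z d/dz)^2 - z
  d/dz.\<close>

definition tS2 :: "nat \<Rightarrow> (nat \<Rightarrow> complex) \<Rightarrow> complex \<Rightarrow> complex" where
  "tS2 m a z = tS m (euler_op m (euler_op m (Tpoly m a)) - euler_op m (Tpoly m a)) z / z ^ 2"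

abbreviation tS0 :: "nat \<Rightarrow> (nat \<Rightarrow> complex) \<Rightarrow> complex \<Rightarrow> complex" where
  "tS0 m a \<equiv> tS m (Tpoly m a)"

abbreviation tR0 :: "nat \<Rightarrow> (nat \<Rightarrow> complex) \<Rightarrow> complex \<Rightarrow> complex" where
  "tR0 m a \<equiv> tR m (Tpoly m a)"

text \<open>The error coefficient \<open>k\<close> per unit of dz; along a path it is multiplied by
  the velocity.\<close>

definition tK :: "nat \<Rightarrow> (nat \<Rightarrow> complex) \<Rightarrow> complex \<Rightarrow> complex \<Rightarrow> complex" where
  "tK m a lam z = 1 / 2 * ((poly (pot m a lam) z - tS0 m a z ^ 2) / tS0 m a z
     + tS2 m a z / (2 * tS0 m a z ^ 2) - 3 * tS1 m a z ^ 2 / (4 * tS0 m a z ^ 3))"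

lemma tS1_deriv:
  assumes "z \<notin> \<real>\<^sub>\<le>\<^sub>0"
  shows "(tS1 m a has_field_derivative tS2 m a z) (at z)"
proof -
  have z: "z \<noteq> 0" using assms by auto
  show ?thesis
    unfolding tS1_def[abs_def]
    by (rule DERIV_cong[OF DERIV_divide[OF tS_deriv[OF assms] DERIV_ident z]])
      (use z in \<open>simp add: tS2_def tS_def field_simps power2_eq_square\<close>)
qed

lemma norm_exp_Ln: "z \<noteq> 0 \<Longrightarrow> norm (exp (of_real s * Ln z)) = norm z powr s"
  by (simp add: norm_exp_eq_Re powr_def)

lemma norm_tS: "z \<noteq> 0 \<Longrightarrow> norm (tS m p z) = norm z powr (real m / 2) * norm (poly p (inverse z))"
  unfolding tS_def norm_mult by (subst norm_exp_Ln) auto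

lemma tS_square: "z \<noteq> 0 \<Longrightarrow> tS m p z ^ 2 = z ^ m * poly p (inverse z) ^ 2"
proof -
  assume z: "z \<noteq> 0"
  have "exp (of_real (real m / 2) * Ln z) ^ 2 = exp (of_nat m * Ln z)" by (simp add: exp_double[symmetric])
  also have "\<dots> = z ^ m" using z by (simp add: exp_of_nat_mult)
  finally show ?thesis by (simp add: tS_def power_mult_distrib)
qed

text \<open>The truncation defect has order m/2 - 3/2, and division by S of order m/2 leaves
  z^(-3/2), integrable at infinity. The terms with derivatives of S are of order z^(-m/2-2), hence
  smaller.\<close>

lemma tail_bounds:
  assumes m: "m \<ge> 3"
  obtains C R where "C \<ge> 0" "R \<ge> 1"
    "\<And>z. norm z \<ge> R \<Longrightarrow> norm (poly (Tpoly m a) (inverse z) - 1) \<le> C / norm z"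
    "\<And>z. norm z \<ge> R \<Longrightarrow> norm (poly (Tpoly m a) (inverse z) - 1) \<le> 1 / 2"
    "\<And>z. norm z \<ge> R \<Longrightarrow> norm (tK m a lam z) \<le> C * norm z powr (- 3 / 2)"
    "\<And>z. norm z \<ge> R \<Longrightarrow> norm (tS1 m a z / (2 * tS0 m a z ^ 2)) \<le> C * norm z powr (- 1 / 2)"
proof -
  obtain C1 where C1: "C1 \<ge> 0"
   "\<And>z. norm z \<ge> 1 \<Longrightarrow> norm (poly (pot m a lam) z - z ^ m * poly (Tpoly m a) (inverse z) ^ 2) \<le> C1 * norm z powr (real m / 2 - 3/2)"
    using potential_truncation[OF m, of a lam] by blast
  obtain C2 where C2: "C2 \<ge> 0" "\<And>s. norm s \<le> 1 \<Longrightarrow> norm (poly (Tpoly m a) s - 1) \<le> C2 * norm s"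
    using Tpoly_near_1[of m a] by blast
  obtain B1 where B1: "B1 > 0" "\<And>s. norm s \<le> 1 \<Longrightarrow> norm (poly (euler_op m (Tpoly m a)) s) \<le> B1"
    using poly_bound_exists[of 1 "euler_op m (Tpoly m a)"] by blast
  obtain B2 where B2: "B2 > 0" "\<And>s. norm s \<le> 1 \<Longrightarrow> norm (poly (euler_op m (euler_op m (Tpoly m a)) - euler_op m (Tpoly m a)) s) \<le> B2"
    using poly_bound_exists[of 1 "euler_op m (euler_op m (Tpoly m a)) - euler_op m (Tpoly m a)"] by blast
  \<comment> \<open>From 2 C2 on, |T - 1| is at most 1/2 and |S| is at least half of
    |z|^(m/2).\<close>
  define R where "R = max 1 (2 * C2)"
  \<comment> \<open>The summands are the bounds of the separate terms; the factors 2 and 6 stem from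
    replacing |S| by \<open>h / 2\<close> in denominators.\<close>
  define C where "C = C2 + 2 * C1 + 2 * B2 + 6 * B1\<^sup>2 + 2 * B1"
  have CC: "C2 \<le> C" "2 * B1 \<le> C" "2 * C1 + 2 * B2 + 6 * B1\<^sup>2 \<le> C" "C \<ge> 0"
    unfolding C_def using C1(1) C2(1) B1(1) B2(1) by auto
  have main: "norm (poly (Tpoly m a) (inverse z) - 1) \<le> C / norm z
    \<and> norm (poly (Tpoly m a) (inverse z) - 1) \<le> 1 / 2
    \<and> norm (tK m a lam z) \<le> C * norm z powr (- 3 / 2)
    \<and> norm (tS1 m a z / (2 * tS0 m a z ^ 2)) \<le> C * norm z powr (- 1 / 2)" if z: "norm z \<ge> R" for z
  proof -
    define x where "x = norm z"
    have x: "x \<ge> 1" "x \<ge> 2 * C2" using z by (auto simp: R_def x_def)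
    have z0: "z \<noteq> 0" using x by (auto simp: x_def)
    have i1: "norm (inverse z) \<le> 1" using x by (simp add: norm_inverse x_def[symmetric] inverse_le_1_iff)
    have T1: "norm (poly (Tpoly m a) (inverse z) - 1) \<le> C2 / x"
      using C2(2)[OF i1] unfolding norm_inverse x_def[symmetric] by (simp only: divide_inverse)
    have T3: "C2 / x \<le> C / x" using CC(1) x by (simp add: divide_right_mono)
    have T2: "C2 / x \<le> 1 / 2" using x by (simp add: field_simps)
    define h where "h = x powr (real m / 2)"
    have h: "h > 0" using x by (simp add: h_def)
    define S where "S = tS0 m a z"
    have "1 - norm (poly (Tpoly m a) (inverse z) - 1) \<le> norm (poly (Tpoly m a) (inverse z))"
      using norm_triangle_ineq2[of 1 "1 - poly (Tpoly m a) (inverse z)"] by (simp add: norm_minus_commute)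
    then have "norm (poly (Tpoly m a) (inverse z)) \<ge> 1 / 2" using T1 T2 by linarith
    then have S: "norm S \<ge> h / 2" unfolding S_def norm_tS[OF z0] h_def x_def[symmetric]
      using mult_left_mono[of "1/2" _ "x powr (real m / 2)"] by simp
    have S1: "norm (tS1 m a z) \<le> h * B1 / x"
      unfolding tS1_def norm_divide norm_tS[OF z0] h_def x_def[symmetric] using B1(2)[OF i1] x
      by (intro divide_right_mono mult_left_mono) auto
    have S2: "norm (tS2 m a z) \<le> h * B2 / x ^ 2"
      unfolding tS2_def norm_divide norm_tS[OF z0] norm_power h_def x_def[symmetric] using B2(2)[OF i1] x
      by (intro divide_right_mono mult_left_mono) auto
    have hx: "inverse h * inverse x ^ 2 \<le> x powr (- 3 / 2)" "inverse h * inverse x \<le> x powr (- 1 / 2)"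
    proof -
      have "inverse h * inverse x ^ 2 = x powr (- (real m / 2) - 2)"
        using x by (simp add: h_def powr_diff powr_minus powr_realpow[of x 2, simplified] power_inverse inverse_eq_divide power_one_over)
      also have "\<dots> \<le> x powr (- 3 / 2)" using x by (intro powr_mono) auto
      finally show "inverse h * inverse x ^ 2 \<le> x powr (- 3 / 2)" .
      have "inverse h * inverse x = x powr (- (real m / 2) - 1)"
        using x by (simp add: h_def powr_diff powr_minus inverse_eq_divide)
      also have "\<dots> \<le> x powr (- 1 / 2)" using x by (intro powr_mono) auto
      finally show "inverse h * inverse x \<le> x powr (- 1 / 2)" .
    qed
    have "norm (poly (pot m a lam) z - S ^ 2) \<le> C1 * x powr (real m / 2 - 3/2)"
      unfolding S_def tS_square[OF z0] using C1(2)[of z] x by (simp add: x_def)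
    also have "\<dots> = C1 * (h * x powr (- 3 / 2))" unfolding h_def powr_add[symmetric] by simp
    finally have "norm ((poly (pot m a lam) z - S ^ 2) / S) \<le> C1 * (h * x powr (- 3 / 2)) / (h / 2)"
      unfolding norm_divide using S h C1(1) by (intro frac_le) auto
    then have k1: "norm ((poly (pot m a lam) z - S ^ 2) / S) \<le> 2 * C1 * x powr (- 3 / 2)" using h by simp
    have "norm (tS2 m a z / (2 * S ^ 2)) \<le> (h * B2 / x ^ 2) / (2 * (h / 2) ^ 2)"
      unfolding norm_divide norm_mult norm_power using S2 S h B2(1) x
      by (intro frac_le mult_mono power_mono) auto
    also have "\<dots> = 2 * B2 * (inverse h * inverse x ^ 2)" using h x by (simp add: field_simps power2_eq_square)
    also have "\<dots> \<le> 2 * B2 * x powr (- 3 / 2)" using hx(1) B2(1) by (intro mult_left_mono) auto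
    finally have k2: "norm (tS2 m a z / (2 * S ^ 2)) \<le> 2 * B2 * x powr (- 3 / 2)" .
    have "norm (3 * tS1 m a z ^ 2 / (4 * S ^ 3)) \<le> 3 * (h * B1 / x) ^ 2 / (4 * (h / 2) ^ 3)"
      unfolding norm_divide norm_mult norm_power norm_numeral using S1 S h B1(1) x
      by (intro frac_le mult_mono power_mono) auto
    also have "\<dots> = 6 * B1\<^sup>2 * (inverse h * inverse x ^ 2)" using h x by (simp add: field_simps power2_eq_square power3_eq_cube)
    also have "\<dots> \<le> 6 * B1\<^sup>2 * x powr (- 3 / 2)" using hx(1) by (intro mult_left_mono) auto
    finally have k3: "norm (3 * tS1 m a z ^ 2 / (4 * S ^ 3)) \<le> 6 * B1\<^sup>2 * x powr (- 3 / 2)" .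
    define A1 A2 A3 where A: "A1 = (poly (pot m a lam) z - S ^ 2) / S" "A2 = tS2 m a z / (2 * S ^ 2)" "A3 = 3 * tS1 m a z ^ 2 / (4 * S ^ 3)"
    have "norm (tK m a lam z) = norm (A1 + A2 - A3) / 2"
      unfolding tK_def S_def[symmetric] A[symmetric] by (simp add: norm_mult)
    also have "\<dots> \<le> norm (A1 + A2 - A3)" by simp
    also have "\<dots> \<le> norm A1 + norm A2 + norm A3" by (smt (verit) norm_triangle_ineq norm_triangle_ineq4)
    also have "\<dots> \<le> (2 * C1 + 2 * B2 + 6 * B1\<^sup>2) * x powr (- 3 / 2)"
      using k1 k2 k3 unfolding A[symmetric] by (simp add: algebra_simps)
    also have "\<dots> \<le> C * x powr (- 3 / 2)" using CC(3) by (intro mult_right_mono) auto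
    finally have T4: "norm (tK m a lam z) \<le> C * x powr (- 3 / 2)" .
    have "norm (tS1 m a z / (2 * S ^ 2)) \<le> (h * B1 / x) / (2 * (h / 2) ^ 2)"
      unfolding norm_divide norm_mult norm_power using S1 S h B1(1) x
      by (intro frac_le mult_mono power_mono) auto
    then have "norm (tS1 m a z / (2 * S ^ 2)) \<le> 2 * B1 * (inverse h * inverse x)"
      using h x by (simp add: field_simps power2_eq_square)
    then have T5: "norm (tS1 m a z / (2 * S ^ 2)) \<le> C * x powr (- 1 / 2)"
      using mult_mono[OF CC(2) hx(2)] CC(4) h x by (auto intro: order_trans)
    show ?thesis using T1 T2 T3 T4 T5 unfolding S_def x_def by linarith
  qed
  have "R \<ge> 1" by (simp add: R_def)
  then show ?thesis using that[of C R] CC(4) main by blast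
qed

text \<open>The inverse of the coordinate \<open>w\<close>. The angle \<beta> + Im (Ln v) may leave
  (-\<pi>, \<pi>], where a principal power of \<open>cis \<beta> * v\<close> would take the wrong
  branch.\<close>

definition zf :: "nat \<Rightarrow> real \<Rightarrow> complex \<Rightarrow> complex" where
  "zf m \<beta> v = exp (of_real (2 / (real m + 2)) * (\<i> * of_real \<beta> + Ln v))"

text \<open>The angle of the rotated \<open>v\<close> is at most 3 \<pi>/2, and the exponent
  2/(m+2), at most 2/5, brings it below \<pi>. Hence z stays in the slit plane and the principal
  logarithm undoes the exponential.\<close>

lemma zf_facts:
  assumes m: "m \<ge> 3" and b: "\<bar>\<beta>\<bar> < pi / 2" and v: "v \<notin> \<real>\<^sub>\<le>\<^sub>0"
  shows "Ln (zf m \<beta> v) = of_real (2 / (real m + 2)) * (\<i> * of_real \<beta> + Ln v)"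
    and "zf m \<beta> v \<notin> \<real>\<^sub>\<le>\<^sub>0"
    and "norm (zf m \<beta> v) = norm v powr (2 / (real m + 2))"
    and "(zf m \<beta> has_field_derivative of_real (2 / (real m + 2)) * zf m \<beta> v / v) (at v)"
proof -
  define \<kappa> where "\<kappa> = 2 / (real m + 2)"
  have k: "0 < \<kappa>" "\<kappa> \<le> 2 / 5" using m by (auto simp: \<kappa>_def field_simps)
  have v0: "v \<noteq> 0" using v by auto
  have "\<bar>Im (Ln v)\<bar> \<le> pi" using v0 mpi_less_Im_Ln[of v] Im_Ln_le_pi[of v] by auto
  then have "\<bar>\<beta> + Im (Ln v)\<bar> \<le> 3 * pi / 2" using b by linarith
  then have "\<kappa> * \<bar>\<beta> + Im (Ln v)\<bar> \<le> 2 / 5 * (3 * pi / 2)" using k by (intro mult_mono) auto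
  also have "\<dots> < pi" by simp
  finally have "\<bar>\<kappa> * (\<beta> + Im (Ln v))\<bar> < pi" using k by (simp add: abs_mult)
  then have im: "\<bar>Im (of_real \<kappa> * (\<i> * of_real \<beta> + Ln v))\<bar> < pi" by simp
  show L: "Ln (zf m \<beta> v) = of_real (2 / (real m + 2)) * (\<i> * of_real \<beta> + Ln v)"
    unfolding zf_def \<kappa>_def[symmetric] using im by (intro Ln_exp) auto
  show "zf m \<beta> v \<notin> \<real>\<^sub>\<le>\<^sub>0"
  proof
    assume "zf m \<beta> v \<in> \<real>\<^sub>\<le>\<^sub>0"
    moreover have "zf m \<beta> v \<noteq> 0" by (simp add: zf_def)
    ultimately have "Im (Ln (zf m \<beta> v)) = pi" by (auto simp: Im_Ln_eq_pi complex_nonpos_Reals_iff complex_eq_iff)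
    then show False using im unfolding L \<kappa>_def by simp
  qed
  show "norm (zf m \<beta> v) = norm v powr (2 / (real m + 2))"
    using v0 by (simp add: zf_def norm_exp_eq_Re powr_def)
  show "(zf m \<beta> has_field_derivative of_real (2 / (real m + 2)) * zf m \<beta> v / v) (at v)"
    unfolding zf_def[abs_def] \<kappa>_def[symmetric] using v by (auto intro!: derivative_eq_intros simp: inverse_eq_divide)
qed

section \<open>Integration along segments of the phase plane\<close>

definition tU :: "nat \<Rightarrow> (nat \<Rightarrow> complex) \<Rightarrow> (complex \<Rightarrow> complex) \<Rightarrow> complex \<Rightarrow> complex" where
  "tU m a y z = y z * exp (tXi m a z) * tR0 m a z"

definition tB :: "nat \<Rightarrow> (nat \<Rightarrow> complex) \<Rightarrow> (complex \<Rightarrow> complex) \<Rightarrow> (complex \<Rightarrow> complex) \<Rightarrow> complex \<Rightarrow> complex" where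
  "tB m a y y' z = - (y' z * exp (tXi m a z) * tR0 m a z / tS0 m a z
     + (1 + tS1 m a z / (2 * tS0 m a z ^ 2)) * tU m a y z) / 2"

abbreviation lg_bound :: "nat \<Rightarrow> (nat \<Rightarrow> complex) \<Rightarrow> real \<Rightarrow> real \<Rightarrow> (complex \<Rightarrow> complex) \<Rightarrow> (complex \<Rightarrow> complex) \<Rightarrow> complex \<Rightarrow> bool" where
  "lg_bound m a \<beta> C y y' w \<equiv> norm (tU m a y (zf m \<beta> w) - 1) \<le> C * norm w powr (- (1 / (real m + 2)))
     \<and> norm (tB m a y y' (zf m \<beta> w)) \<le> C * norm w powr (- (1 / (real m + 2)))"

text \<open>In the coordinate \<open>w\<close> the derivative of the phase is close to the constant \<open>2/(m+2) * cis \<beta>\<close>, so its real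
  part increases from \<open>w\<close> to \<open>X\<close> as soon as the direction \<open>d\<close> is close to \<open>1\<close>. The condition on
  \<open>w * cnj d\<close> keeps the segment away from the origin.\<close>

lemma path_estimate:
  assumes m: "m \<ge> 3" and b: "\<bar>\<beta>\<bar> < pi / 2" and q: "0 < q" "q < 1"
  obtains C R where "C \<ge> 0" "R \<ge> 1"
   "\<And>w X d y y'. norm w \<ge> R \<Longrightarrow> w \<notin> \<real>\<^sub>\<le>\<^sub>0 \<Longrightarrow> X > 0 \<Longrightarrow> d = (of_real X - w) / of_real (norm (of_real X - w)) \<Longrightarrow>
     d \<noteq> 0 \<Longrightarrow> Re (w * cnj d) \<ge> - q * norm w \<Longrightarrow> Re (cis \<beta> * d) \<ge> cos \<beta> / 2 \<Longrightarrow> solves (pot m a lam) y y' \<Longrightarrow>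
     tU m a y (zf m \<beta> (of_real X)) = 1 \<Longrightarrow> tB m a y y' (zf m \<beta> (of_real X)) = 0 \<Longrightarrow>
     lg_bound m a \<beta> C y y' w"
proof (rule tail_bounds[OF m, of a lam])
  fix C0 R0
  assume C0: "C0 \<ge> 0" "R0 \<ge> 1"
    and T1: "\<And>z. norm z \<ge> R0 \<Longrightarrow> norm (poly (Tpoly m a) (inverse z) - 1) \<le> C0 / norm z"
    and T2: "\<And>z. norm z \<ge> R0 \<Longrightarrow> norm (poly (Tpoly m a) (inverse z) - 1) \<le> 1 / 2"
    and T3: "\<And>z. norm z \<ge> R0 \<Longrightarrow> norm (tK m a lam z) \<le> C0 * norm z powr (- 3 / 2)"
  define \<kappa> where "\<kappa> = 2 / (real m + 2)"
  have k: "\<kappa> > 0" by (simp add: \<kappa>_def)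
  have cb: "cos \<beta> > 0" using b by (intro cos_gt_zero_pi) auto
  \<comment> \<open>From here on |T - 1| is at most cos \<beta> / 2, which uses up exactly the
    margin in the condition on \<open>cis \<beta> * d\<close>.\<close>
  define R1 where "R1 = max R0 (2 * C0 / cos \<beta>)"
  \<comment> \<open>From |v|^2 \<ge> (1 - q) (|w|^2 + t^2) and |w|^2 + t^2 \<ge> (|w| + t)^2 /
    2.\<close>
  define c2 where "c2 = sqrt ((1 - q) / 2)"
  have c2: "c2 > 0" using q by (simp add: c2_def)
  define D0 where "D0 = \<kappa> * C0 * c2 powr (- \<kappa> / 2 - 1)"
  define M0 where "M0 = 2 * D0 / \<kappa>"
  have D0: "D0 \<ge> 0" "M0 \<ge> 0" using k C0 by (auto simp: D0_def M0_def)
  \<comment> \<open>The second bound gives \<open>M 0 \<le> 1 / 4\<close>; the third keeps |z| above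
    \<open>R1\<close> along the whole segment.\<close>
  define R where "R = max 1 (max ((4 * M0) powr (2 / \<kappa>)) (R1 powr (1 / \<kappa>) / c2))"
  have R1: "R1 \<ge> 1" "R1 \<ge> R0" "R1 \<ge> 2 * C0 / cos \<beta>" using C0 by (auto simp: R1_def)
  have "lg_bound m a \<beta> (4 * M0) y y' w"
    if w: "norm w \<ge> R" "w \<notin> \<real>\<^sub>\<le>\<^sub>0" and X: "X > 0" and dX: "d = (of_real X - w) / of_real (norm (of_real X - w))"
     and d0: "d \<noteq> 0" and dw: "Re (w * cnj d) \<ge> - q * norm w" and db: "Re (cis \<beta> * d) \<ge> cos \<beta> / 2"
     and y: "solves (pot m a lam) y y'"
     and U: "tU m a y (zf m \<beta> (of_real X)) = 1" and B: "tB m a y y' (zf m \<beta> (of_real X)) = 0"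
    for w d :: complex and X :: real and y y'
  proof -
    have wR: "norm w \<ge> 1" "norm w \<ge> (4 * M0) powr (2 / \<kappa>)" "norm w \<ge> R1 powr (1 / \<kappa>) / c2" using w(1) by (auto simp: R_def)
    define bb where "bb = norm (of_real X - w)"
    have bb: "bb > 0" using d0 dX by (auto simp: bb_def)
    have nd: "norm d = 1" using bb by (simp add: dX bb_def norm_divide)
    define v where "v = (\<lambda>t::real. w + of_real t * d)"
    have v0: "v 0 = w" by (simp add: v_def)
    have vb: "v bb = of_real X" using bb by (simp add: v_def dX bb_def)
    have vlow: "norm (v t) \<ge> c2 * (norm w + t)" if "t \<ge> 0" for t
    proof (rule power2_le_imp_le)
      have "(norm (v t))\<^sup>2 = (norm w)\<^sup>2 + t\<^sup>2 * (norm d)\<^sup>2 + 2 * t * Re (w * cnj d)"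
        unfolding v_def cmod_power2 by (simp add: power2_eq_square algebra_simps)
      also have "\<dots> \<ge> (norm w)\<^sup>2 + t\<^sup>2 - 2 * t * (q * norm w)"
        using mult_left_mono[OF dw, of "2 * t"] that by (simp add: nd)
      also have "(norm w)\<^sup>2 + t\<^sup>2 - 2 * t * (q * norm w) = (1 - q) * ((norm w)\<^sup>2 + t\<^sup>2) + q * (norm w - t)\<^sup>2"
        by (simp add: power2_eq_square algebra_simps)
      also have "\<dots> \<ge> (1 - q) * ((norm w)\<^sup>2 + t\<^sup>2)" using q by simp
      also have "(norm w)\<^sup>2 + t\<^sup>2 = ((norm w + t)\<^sup>2 + (norm w - t)\<^sup>2) / 2" by (simp add: power2_eq_square algebra_simps)
      also have "(1 - q) * (((norm w + t)\<^sup>2 + (norm w - t)\<^sup>2) / 2) \<ge> (1 - q) * ((norm w + t)\<^sup>2 / 2)"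
        using q by (intro mult_left_mono) auto
      also have "(1 - q) * ((norm w + t)\<^sup>2 / 2) = (c2 * (norm w + t))\<^sup>2"
        using q by (simp add: c2_def power_mult_distrib)
      finally show "(c2 * (norm w + t))\<^sup>2 \<le> (norm (v t))\<^sup>2" .
    qed simp
    have vnr: "v t \<notin> \<real>\<^sub>\<le>\<^sub>0" if t: "t \<in> {0..bb}" for t
    proof
      assume "v t \<in> \<real>\<^sub>\<le>\<^sub>0"
      then have r: "Re (v t) \<le> 0" "Im (v t) = 0" by (auto simp: complex_nonpos_Reals_iff)
      define s where "s = t / bb"
      have s: "s \<ge> 0" "s \<le> 1" using t bb by (auto simp: s_def)
      have vt: "v t = of_real (1 - s) * w + of_real (s * X)"
        using bb by (simp add: v_def dX bb_def[symmetric] s_def field_simps)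
      show False
      proof (cases "s = 1")
        case True then show False using r X vt by simp
      next
        case False
        then have "Im w = 0" using r(2) vt by simp
        then have "Re w > 0" using w(2) by (simp add: complex_nonpos_Reals_iff)
        then have "(1 - s) * Re w > 0" using False s by simp
        then show False using r(1) vt mult_nonneg_nonneg[OF s(1) less_imp_le[OF X]] by simp
      qed
    qed
    define Z where "Z = (\<lambda>t. zf m \<beta> (v t))"
    define zp where "zp = (\<lambda>t. d * (of_real \<kappa> * Z t / v t))"
    have dv: "(v has_vector_derivative d) (at t within A)" for t A
      unfolding v_def by (auto intro!: derivative_eq_intros)
    have dZ: "(Z has_vector_derivative zp t) (at t within A)" if t: "t \<in> {0..bb}" for t A
      using field_vector_diff_chain_within[OF dv has_field_derivative_at_within[OF zf_facts(4)[OF m b vnr[OF t]]]]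
      by (simp add: Z_def zp_def \<kappa>_def o_def mult_ac)
    have Zn: "norm (Z t) = norm (v t) powr \<kappa>" "Z t \<notin> \<real>\<^sub>\<le>\<^sub>0" "Ln (Z t) = of_real \<kappa> * (\<i> * of_real \<beta> + Ln (v t))"
      if "t \<in> {0..bb}" for t
      using zf_facts[OF m b vnr[OF that]] by (auto simp: Z_def \<kappa>_def)
    have ZR: "norm (Z t) \<ge> R1" if t: "t \<in> {0..bb}" for t
    proof -
      have "R1 powr (1 / \<kappa>) \<le> c2 * norm w" using wR(3) c2 by (simp add: field_simps)
      also have "\<dots> \<le> c2 * (norm w + t)" using c2 t by simp
      also have "\<dots> \<le> norm (v t)" using vlow t by simp
      finally have "(R1 powr (1 / \<kappa>)) powr \<kappa> \<le> norm (v t) powr \<kappa>" using k by (intro powr_mono2) auto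
      then show ?thesis using Zn(1)[OF t] k R1 by (simp add: powr_powr)
    qed
    have chain: "((\<lambda>t. f (Z t)) has_vector_derivative zp t * f' (Z t)) (at t within A)"
      if "t \<in> {0..bb}" "\<And>z. z \<notin> \<real>\<^sub>\<le>\<^sub>0 \<Longrightarrow> norm z \<ge> R1 \<Longrightarrow> (f has_field_derivative f' z) (at z)" for f f' t A
      using field_vector_diff_chain_within[OF dZ[OF that(1)] has_field_derivative_at_within[OF that(2)[OF Zn(2)[OF that(1)] ZR[OF that(1)]]]]
      by (simp add: o_def)
    have Tnr: "poly (Tpoly m a) (inverse z) \<notin> \<real>\<^sub>\<le>\<^sub>0" if "norm z \<ge> R1" for z
    proof -
      have "norm (poly (Tpoly m a) (inverse z) - 1) \<le> 1 / 2" using T2 that R1 by simp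
      then have "Re (poly (Tpoly m a) (inverse z)) > 0"
        using abs_Re_le_cmod[of "poly (Tpoly m a) (inverse z) - 1"] by simp
      then show ?thesis by (simp add: complex_nonpos_Reals_iff)
    qed
    have S0: "tS0 m a z \<noteq> 0" if "norm z \<ge> R1" for z
      using Tnr[OF that] by (auto simp: tS_def)
    define kk where "kk = (\<lambda>t. zp t / 2 * ((poly (pot m a lam) (Z t) - tS0 m a (Z t) ^ 2) / tS0 m a (Z t)
     + tS2 m a (Z t) / (2 * tS0 m a (Z t) ^ 2) - 3 * tS1 m a (Z t) ^ 2 / (4 * tS0 m a (Z t) ^ 3)))"
    have sys: "((\<lambda>t. tU m a y (Z t)) has_vector_derivative - 2 * (zp t * tS0 m a (Z t)) * tB m a y y' (Z t)) (at t within {0..bb})"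
       "((\<lambda>t. tB m a y y' (Z t)) has_vector_derivative 2 * (zp t * tS0 m a (Z t)) * tB m a y y' (Z t) - kk t * tU m a y (Z t)) (at t within {0..bb})"
       if t: "t \<in> {0..bb}" for t
    proof -
      have d1: "((\<lambda>t. y (Z t)) has_vector_derivative zp t * y' (Z t)) (at t within {0..bb})"
        by (rule chain[OF t]) (rule solvesD(1)[OF y])
      have d2: "((\<lambda>t. y' (Z t)) has_vector_derivative zp t * (poly (pot m a lam) (Z t) * y (Z t))) (at t within {0..bb})"
        by (rule chain[OF t, where f' = "\<lambda>z. poly (pot m a lam) z * y z"]) (rule solvesD(2)[OF y])
      have d3: "((\<lambda>t. tXi m a (Z t)) has_vector_derivative zp t * tS0 m a (Z t)) (at t within {0..bb})"
        by (rule chain[OF t]) (rule tXi_deriv)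
      have d4: "((\<lambda>t. tS0 m a (Z t)) has_vector_derivative zp t * tS1 m a (Z t)) (at t within {0..bb})"
        by (rule chain[OF t], unfold tS1_def) (rule tS_deriv)
      have d5: "((\<lambda>t. tS1 m a (Z t)) has_vector_derivative zp t * tS2 m a (Z t)) (at t within {0..bb})"
        by (rule chain[OF t]) (rule tS1_deriv)
      have d6: "((\<lambda>t. tR0 m a (Z t)) has_vector_derivative zp t * (tS1 m a (Z t) / (2 * tS0 m a (Z t)) * tR0 m a (Z t))) (at t within {0..bb})"
        by (rule chain[OF t, where f' = "\<lambda>z. tS1 m a z / (2 * tS0 m a z) * tR0 m a z"], unfold tS1_def) (rule tR_deriv, assumption, rule Tnr, assumption)
      note lg = liouville_green_system[where ?y1.0 = "\<lambda>t. y (Z t)" and ?y2.0 = "\<lambda>t. y' (Z t)" and Q = "\<lambda>t. poly (pot m a lam) (Z t)" and zp = zp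
         and \<Xi> = "\<lambda>t. tXi m a (Z t)" and S = "\<lambda>t. tS0 m a (Z t)" and ?S1.0 = "\<lambda>t. tS1 m a (Z t)" and ?S2.0 = "\<lambda>t. tS2 m a (Z t)" and R = "\<lambda>t. tR0 m a (Z t)",
         OF d1 d2 d3 d4 d5 d6 S0[OF ZR[OF t]]]
      show "((\<lambda>t. tU m a y (Z t)) has_vector_derivative - 2 * (zp t * tS0 m a (Z t)) * tB m a y y' (Z t)) (at t within {0..bb})"
        unfolding tB_def tU_def by (rule lg(1))
      show "((\<lambda>t. tB m a y y' (Z t)) has_vector_derivative 2 * (zp t * tS0 m a (Z t)) * tB m a y y' (Z t) - kk t * tU m a y (Z t)) (at t within {0..bb})"
        unfolding tB_def tU_def kk_def by (rule lg(2))
    qed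
    have dXi: "((\<lambda>t. tXi m a (Z t)) has_vector_derivative zp t * tS0 m a (Z t)) (at t within {0..bb})" if t: "t \<in> {0..bb}" for t
      by (rule chain[OF t]) (rule tXi_deriv)
    define D where "D = (\<lambda>t. D0 * (norm w + t) powr (- \<kappa> / 2 - 1))"
    define M where "M = (\<lambda>t. M0 * (norm w + t) powr (- \<kappa> / 2))"
    have dM: "(M has_real_derivative - D t) (at t within {0..bb})" if "t \<in> {0..bb}" for t
    proof -
      have p: "norm w + t > 0" using that wR(1) by auto
      have "(M has_real_derivative M0 * (- \<kappa> / 2 * (norm w + t) powr (- \<kappa> / 2 - 1))) (at t within {0..bb})"
        unfolding M_def using p by (auto intro!: derivative_eq_intros)
      moreover have "M0 * (- \<kappa> / 2) = - D0" using k by (simp add: M0_def)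
      then have "M0 * (- \<kappa> / 2 * (norm w + t) powr (- \<kappa> / 2 - 1)) = - D t"
        unfolding D_def mult.assoc[symmetric] by (simp only: mult_minus_left)
      ultimately show ?thesis by simp
    qed
    have Re0: "0 \<le> Re (zp t * tS0 m a (Z t))" if t: "t \<in> {0..bb}" for t
    proof -
      have vt: "v t \<noteq> 0" and Zt: "Z t \<noteq> 0" using vnr[OF t] Zn(2)[OF t] by auto
      \<comment> \<open>The reason for the coordinate: z z^(m/2) = cis \<beta> * w, so in
        \<open>w\<close> the derivative of the phase is \<kappa> cis \<beta> times the factor T,
        which is near 1.\<close>
      have k1: "(real m / 2 + 1) * \<kappa> = 1" by (simp add: \<kappa>_def field_simps)
      have "Z t * exp (of_real (real m / 2) * Ln (Z t)) = exp (of_real (real m / 2 + 1) * Ln (Z t))"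
        using Zt by (simp add: distrib_right exp_add)
      also have "of_real (real m / 2 + 1) * Ln (Z t) = of_real ((real m / 2 + 1) * \<kappa>) * (\<i> * of_real \<beta> + Ln (v t))"
        unfolding Zn(3)[OF t] by simp
      also have "exp \<dots> = cis \<beta> * v t" unfolding k1 using vt by (simp add: exp_add cis_conv_exp)
      finally have e: "Z t * exp (of_real (real m / 2) * Ln (Z t)) = cis \<beta> * v t" .
      define \<tau> where "\<tau> = poly (Tpoly m a) (inverse (Z t))"
      have "zp t * tS0 m a (Z t) = of_real \<kappa> * d * (Z t * exp (of_real (real m / 2) * Ln (Z t))) / v t * \<tau>"
        by (simp add: zp_def tS_def \<tau>_def)
      also have "\<dots> = of_real \<kappa> * (cis \<beta> * d * \<tau>)" unfolding e using vt by simp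
      finally have f: "Re (zp t * tS0 m a (Z t)) = \<kappa> * Re (cis \<beta> * d * \<tau>)" by simp
      have "norm (\<tau> - 1) \<le> C0 / norm (Z t)" unfolding \<tau>_def using T1 ZR[OF t] R1 by simp
      also have "\<dots> \<le> cos \<beta> / 2"
      proof -
        have "2 * C0 / cos \<beta> \<le> norm (Z t)" "norm (Z t) > 0" using ZR[OF t] R1 by linarith+
        then show ?thesis using cb by (simp add: pos_divide_le_eq mult.commute)
      qed
      finally have "norm (cis \<beta> * d * (\<tau> - 1)) \<le> cos \<beta> / 2" by (simp add: norm_mult nd)
      then have "Re (cis \<beta> * d * (\<tau> - 1)) \<ge> - (cos \<beta> / 2)"
        using abs_Re_le_cmod[of "cis \<beta> * d * (\<tau> - 1)"] by linarith
      moreover have "cis \<beta> * d * \<tau> = cis \<beta> * d + cis \<beta> * d * (\<tau> - 1)" by (simp add: algebra_simps)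
      ultimately have "Re (cis \<beta> * d * \<tau>) \<ge> 0" using db by (metis add_mono_thms_linordered_semiring(1) add.right_inverse plus_complex.simps(1))
      then show ?thesis unfolding f using k by simp
    qed
    \<comment> \<open>In \<open>w\<close> the bound |z|^(-3/2) |dz| becomes |w|^(-\<kappa>/2-1)
      |dw|, integrable along the segment with a bound independent of \<open>X\<close>.\<close>
    have kD: "norm (kk t) \<le> D t" if t: "t \<in> {0..bb}" for t
    proof -
      have vt: "norm (v t) > 0" using vnr[OF t] by auto
      have wt: "norm w + t > 0" using t wR(1) by auto
      have "kk t = zp t * tK m a lam (Z t)" by (simp add: kk_def tK_def)
      then have "norm (kk t) = \<kappa> * norm (Z t) / norm (v t) * norm (tK m a lam (Z t))"
        using k by (simp add: zp_def norm_mult norm_divide nd)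
      also have "\<dots> \<le> \<kappa> * norm (Z t) / norm (v t) * (C0 * norm (Z t) powr (- 3 / 2))"
        using k T3[of "Z t"] ZR[OF t] R1 by (intro mult_left_mono) auto
      also have "\<dots> = \<kappa> * C0 * (norm (Z t) powr (- 1 / 2) / norm (v t))"
      proof -
        have "norm (Z t) * norm (Z t) powr (- 3 / 2) = norm (Z t) powr (1 + - 3 / 2)"
          using ZR[OF t] R1 by (subst powr_add) auto
        then show ?thesis by simp
      qed
      also have "norm (Z t) powr (- 1 / 2) / norm (v t) = norm (v t) powr (- \<kappa> / 2 - 1)"
        using vt by (simp add: Zn(1)[OF t] powr_powr powr_diff)
      also have "\<kappa> * C0 * norm (v t) powr (- \<kappa> / 2 - 1) \<le> \<kappa> * C0 * (c2 * (norm w + t)) powr (- \<kappa> / 2 - 1)"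
        using k C0 vlow[of t] t c2 wt by (intro mult_left_mono powr_mono2') auto
      also have "\<dots> = D t" using c2 wt by (simp add: D_def D0_def powr_mult)
      finally show ?thesis .
    qed
    have Mb: "M bb \<ge> 0" using D0 by (simp add: M_def)
    have Mw: "M 0 = M0 * norm w powr (- (1 / (real m + 2)))" 
    proof -
      have "- \<kappa> / 2 = - (1 / (real m + 2))" by (simp add: \<kappa>_def divide_simps)
      then show ?thesis by (simp only: M_def add_0_right)
    qed
    have M00: "M 0 \<le> 1 / 4"
    proof (cases "M0 = 0")
      case False
      then have M0: "M0 > 0" using D0 by simp
      have "((4 * M0) powr (2 / \<kappa>)) powr (\<kappa> / 2) \<le> norm w powr (\<kappa> / 2)" using wR(2) k by (intro powr_mono2) auto
      then have "4 * M0 \<le> norm w powr (\<kappa> / 2)" using k M0 by (simp add: powr_powr)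
      moreover have "norm w powr (\<kappa> / 2) > 0" using wR(1) by auto
      moreover have "M 0 = M0 / norm w powr (\<kappa> / 2)" by (simp add: M_def powr_minus_divide)
      ultimately show ?thesis by (simp add: pos_divide_le_eq)
    qed (simp add: M_def)
    have Ub: "norm (tU m a y (Z bb) - 1) \<le> 0" "norm (tB m a y y' (Z bb)) \<le> 0"
      using U B by (simp_all add: Z_def vb)
    have bb0: "0 \<le> bb" using bb by simp
    have "norm (tU m a y (Z 0) - 1) \<le> 4 * (norm (1::complex) + 3 * 0) * M 0 + 3 * 0"
      by (rule system_estimate(1)[where U = "\<lambda>t. tU m a y (Z t)" and B = "\<lambda>t. tB m a y y' (Z t)" and s = "\<lambda>t. zp t * tS0 m a (Z t)"
          and k = kk and \<Xi> = "\<lambda>t. tXi m a (Z t)" and D = D and M = M and ?x0.0 = 0 and b = bb, OF bb0 sys dXi dM Re0 kD Mb M00 Ub])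
    moreover have "norm (tB m a y y' (Z 0)) \<le> 2 * (norm (1::complex) + 3 * 0) * M 0 + 0"
      by (rule system_estimate(2)[where U = "\<lambda>t. tU m a y (Z t)" and B = "\<lambda>t. tB m a y y' (Z t)" and s = "\<lambda>t. zp t * tS0 m a (Z t)"
          and k = kk and \<Xi> = "\<lambda>t. tXi m a (Z t)" and D = D and M = M and ?x0.0 = 0 and b = bb, OF bb0 sys dXi dM Re0 kD Mb M00 Ub])
    moreover have "M 0 \<ge> 0" using D0 by (simp add: M_def)
    ultimately show ?thesis unfolding Z_def v0 Mw by auto
  qed
  note main = this
  have R: "R \<ge> 1" by (simp add: R_def)
  have M: "4 * M0 \<ge> 0" using D0 by simp
  show ?thesis by (rule that[of "4 * M0" R]) (fact M, fact R, rule main, assumption+)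
qed

lemma tR_nonzero [simp]: "tR m p z \<noteq> 0" by (simp add: tR_def)

lemma not_nonpos_Reals_sector:
  assumes "w \<noteq> 0" "Re w > - q * norm w" "q < 1"
  shows "w \<notin> \<real>\<^sub>\<le>\<^sub>0"
proof
  assume "w \<in> \<real>\<^sub>\<le>\<^sub>0"
  then have "Re w = - norm w" by (simp add: complex_nonpos_Reals_iff cmod_eq_Re)
  then have "(1 - q) * norm w < 0" using assms(2) by (simp add: algebra_simps)
  then show False using assms(1,3) by (simp add: mult_less_0_iff)
qed

text \<open>The solution is a limit of solutions with \<open>U = 1\<close> and \<open>B = 0\<close> at the points \<open>zf m \<beta> (X n)\<close>, \<open>X n \<rightarrow> \<infinity>\<close>;
  the estimate at one fixed point bounds their Cauchy data, which gives a convergent subsequence.\<close>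

lemma sector_solution:
  assumes m: "m \<ge> 3" and b: "\<bar>\<beta>\<bar> < pi / 2" and q: "0 < q" "q < 1"
  obtains y y' C R where "C \<ge> 0" "R \<ge> 1" "solves (pot m a lam) y y'"
   "\<And>w. norm w \<ge> R \<Longrightarrow> Re w > - q * norm w \<Longrightarrow>
     lg_bound m a \<beta> C y y' w"
proof (rule path_estimate[OF m b q, of a lam]; rule tail_bounds[OF m, of a lam]; rule solution_basis[of "pot m a lam"])
  fix C R C0 R0 :: real and e1 e1' e2 e2' :: "complex \<Rightarrow> complex"
  assume C: "C \<ge> 0" "R \<ge> 1"
   and est: "\<And>w X d y y'. norm w \<ge> R \<Longrightarrow> w \<notin> \<real>\<^sub>\<le>\<^sub>0 \<Longrightarrow> X > 0 \<Longrightarrow> d = (of_real X - w) / of_real (norm (of_real X - w)) \<Longrightarrow>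
     d \<noteq> 0 \<Longrightarrow> Re (w * cnj d) \<ge> - q * norm w \<Longrightarrow> Re (cis \<beta> * d) \<ge> cos \<beta> / 2 \<Longrightarrow> solves (pot m a lam) y y' \<Longrightarrow>
     tU m a y (zf m \<beta> (of_real X)) = 1 \<Longrightarrow> tB m a y y' (zf m \<beta> (of_real X)) = 0 \<Longrightarrow>
     lg_bound m a \<beta> C y y' w"
   and R0: "R0 \<ge> 1" and T2: "\<And>z. norm z \<ge> R0 \<Longrightarrow> norm (poly (Tpoly m a) (inverse z) - 1) \<le> 1 / 2"
   and e: "solves (pot m a lam) e1 e1'" "solves (pot m a lam) e2 e2'" "\<And>z. e1 z * e2' z - e1' z * e2 z = 1"
  define \<kappa> where "\<kappa> = 2 / (real m + 2)"
  have k: "\<kappa> > 0" by (simp add: \<kappa>_def)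
  have cb: "cos \<beta> > 0" using b by (intro cos_gt_zero_pi) auto
  define R1 where "R1 = max R (R0 powr (1 / \<kappa>))"
  have R1: "R1 \<ge> R" "R1 \<ge> 1" using C by (auto simp: R1_def)
  have S0: "tS0 m a (zf m \<beta> (of_real x)) \<noteq> 0" if x: "x \<ge> R1" for x
  proof -
    have nr: "complex_of_real x \<notin> \<real>\<^sub>\<le>\<^sub>0" using x R1 by (auto simp: complex_nonpos_Reals_iff)
    have "(R0 powr (1 / \<kappa>)) powr \<kappa> \<le> x powr \<kappa>" using x k by (intro powr_mono2) (auto simp: R1_def)
    then have "norm (zf m \<beta> (of_real x)) \<ge> R0" using k R0 x R1 by (simp add: zf_facts(3)[OF m b nr] \<kappa>_def[symmetric] powr_powr)
    then have "norm (poly (Tpoly m a) (inverse (zf m \<beta> (of_real x))) - 1) \<le> 1 / 2" by (rule T2)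
    then have "poly (Tpoly m a) (inverse (zf m \<beta> (of_real x))) \<noteq> 0" by auto
    then show ?thesis by (simp add: tS_def)
  qed
  define X where "X = (\<lambda>n::nat. R1 + 1 + real n)"
  define Zn where "Zn = (\<lambda>n. zf m \<beta> (of_real (X n)))"
  have ZnE: "zf m \<beta> (of_real (X n)) = Zn n" for n by (simp add: Zn_def)
  have X: "X n > R1" "X n > 0" for n using R1 by (auto simp: X_def)
  \<comment> \<open>\<open>u\<close> and \<open>p\<close> are the values of y and y' that give
    \<open>U = 1\<close> and \<open>B = 0\<close> at \<open>Zn\<close>; \<open>c1\<close> and
    \<open>c2\<close> are their coordinates in the basis, by Cramer's rule.\<close>
  define u where "u = (\<lambda>n. exp (- tXi m a (Zn n)) / tR0 m a (Zn n))"
  define p where "p = (\<lambda>n. - (1 + tS1 m a (Zn n) / (2 * tS0 m a (Zn n) ^ 2)) * tS0 m a (Zn n) * u n)"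
  define c1 where "c1 = (\<lambda>n. u n * e2' (Zn n) - p n * e2 (Zn n))"
  define c2 where "c2 = (\<lambda>n. e1 (Zn n) * p n - e1' (Zn n) * u n)"
  define yn where "yn = (\<lambda>n z. c1 n * e1 z + c2 n * e2 z)"
  define yn' where "yn' = (\<lambda>n z. c1 n * e1' z + c2 n * e2' z)"
  have sol: "solves (pot m a lam) (yn n) (yn' n)" for n
    unfolding yn_def yn'_def by (rule solves_combination[OF e(1,2)])
  have "yn n (Zn n) = u n * (e1 (Zn n) * e2' (Zn n) - e1' (Zn n) * e2 (Zn n))"
    "yn' n (Zn n) = p n * (e1 (Zn n) * e2' (Zn n) - e1' (Zn n) * e2 (Zn n))" for n
    by (simp_all add: yn_def yn'_def c1_def c2_def algebra_simps)
  then have ynZ: "yn n (Zn n) = u n" "yn' n (Zn n) = p n" for n by (simp_all add: e(3))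
  have U1: "tU m a (yn n) (zf m \<beta> (of_real (X n))) = 1" for n
    unfolding ZnE tU_def ynZ by (simp add: u_def exp_minus)
  have B0: "tB m a (yn n) (yn' n) (zf m \<beta> (of_real (X n))) = 0" for n
  proof -
    have S: "tS0 m a (Zn n) \<noteq> 0" using S0 X(1)[of n] by (simp add: Zn_def)
    have u1: "u n * exp (tXi m a (Zn n)) * tR0 m a (Zn n) = 1" by (simp add: u_def exp_minus)
    define g where "g = 1 + tS1 m a (Zn n) / (2 * tS0 m a (Zn n) ^ 2)"
    have "p n * exp (tXi m a (Zn n)) * tR0 m a (Zn n) = - g * tS0 m a (Zn n) * (u n * exp (tXi m a (Zn n)) * tR0 m a (Zn n))"
      by (simp add: p_def g_def)
    then have "p n * exp (tXi m a (Zn n)) * tR0 m a (Zn n) / tS0 m a (Zn n) = - g" using S by (simp add: u1)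
    then show ?thesis unfolding tB_def U1 unfolding ZnE ynZ g_def[symmetric] by simp
  qed
  \<comment> \<open>A base point with real \<open>w\<close>: the segment to \<open>X n\<close> has
    direction exactly 1, so the estimate applies for every n.\<close>
  define z1 where "z1 = zf m \<beta> (of_real R1)"
  have b1: "norm (tU m a (yn n) z1 - 1) \<le> C * norm (complex_of_real R1) powr (- (1 / (real m + 2)))
     \<and> norm (tB m a (yn n) (yn' n) z1) \<le> C * norm (complex_of_real R1) powr (- (1 / (real m + 2)))" for n
    unfolding z1_def
  proof (rule est[OF _ _ X(2)[of n] _ _ _ _ sol U1 B0])
    have "norm (complex_of_real (X n) - of_real R1) = X n - R1"
      unfolding of_real_diff[symmetric] norm_of_real using X(1)[of n] by simp
    then show "1 = (of_real (X n) - complex_of_real R1) / of_real (norm (of_real (X n) - complex_of_real R1))"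
      using X(1)[of n] by (simp flip: of_real_diff)
    show "complex_of_real R1 \<notin> \<real>\<^sub>\<le>\<^sub>0" using R1 by (auto simp: complex_nonpos_Reals_iff)
    have f: "- (q * R1) \<le> 0" using R1 q by simp
    show "- q * norm (complex_of_real R1) \<le> Re (of_real R1 * cnj 1)" using order_trans[OF f, of R1] R1 by simp
  qed (use R1 cb in auto)
  have pw1: "C * norm (complex_of_real R1) powr (- (1 / (real m + 2))) \<le> C"
    using R1 C powr_mono[of "- (1 / (real m + 2))" 0 R1] by (simp add: mult_left_le)
  have bU: "norm (tU m a (yn n) z1) \<le> C + 1" and bB: "norm (tB m a (yn n) (yn' n) z1) \<le> C" for n
    using b1[of n] pw1 norm_triangle_ineq2[of "tU m a (yn n) z1" 1] by auto
  \<comment> \<open>\<open>Y\<close> and \<open>r1\<close> convert the bounds on \<open>U\<close>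
    and \<open>B\<close> at \<open>z1\<close> into bounds on y and y' there that are independent of
    n.\<close>
  define Y where "Y = norm (exp (- tXi m a z1) / tR0 m a z1)"
  define r1 where "r1 = norm (1 + tS1 m a z1 / (2 * tS0 m a z1 ^ 2))"
  have by1: "norm (yn n z1) \<le> (C + 1) * Y" for n
  proof -
    have "yn n z1 = tU m a (yn n) z1 * (exp (- tXi m a z1) / tR0 m a z1)" by (simp add: tU_def exp_minus)
    then have "norm (yn n z1) = norm (tU m a (yn n) z1) * Y" by (simp add: norm_mult norm_divide Y_def)
    then show ?thesis using bU[of n] by (simp add: mult_right_mono Y_def)
  qed
  have by2: "norm (yn' n z1) \<le> (2 * C + r1 * (C + 1)) * norm (tS0 m a z1) * Y" for n
  proof -
    have S1: "tS0 m a z1 \<noteq> 0" unfolding z1_def by (rule S0) simp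
    define V where "V = yn' n z1 * exp (tXi m a z1) * tR0 m a z1 / tS0 m a z1"
    have V: "V = - (2 * tB m a (yn n) (yn' n) z1 + (1 + tS1 m a z1 / (2 * tS0 m a z1 ^ 2)) * tU m a (yn n) z1)"
    proof -
      have "2 * tB m a (yn n) (yn' n) z1 = - (V + (1 + tS1 m a z1 / (2 * tS0 m a z1 ^ 2)) * tU m a (yn n) z1)"
        unfolding tB_def V_def by simp
      then show ?thesis by simp
    qed
    have "norm V \<le> 2 * norm (tB m a (yn n) (yn' n) z1) + r1 * norm (tU m a (yn n) z1)"
      unfolding V norm_minus_cancel r1_def
      by (rule order_trans[OF norm_triangle_ineq]) (simp add: norm_mult)
    also have "\<dots> \<le> 2 * C + r1 * (C + 1)" using bU[of n] bB[of n] by (intro add_mono mult_left_mono) (auto simp: r1_def)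
    finally have nV: "norm V \<le> 2 * C + r1 * (C + 1)" .
    have "yn' n z1 = V * tS0 m a z1 * (exp (- tXi m a z1) / tR0 m a z1)" using S1 by (simp add: V_def exp_minus)
    then have "norm (yn' n z1) = norm V * norm (tS0 m a z1) * Y" by (simp add: norm_mult norm_divide Y_def)
    then show ?thesis using nV by (simp add: mult_right_mono Y_def)
  qed
  define A where "A = (C + 1) * Y + (2 * C + r1 * (C + 1)) * norm (tS0 m a z1) * Y"
  have bA: "norm (yn n z1) \<le> A" "norm (yn' n z1) \<le> A" for n
    using by1[of n] by2[of n] order_trans[OF norm_ge_zero by1[of n]] order_trans[OF norm_ge_zero by2[of n]] by (auto simp: A_def)
  have c1_eq: "c1 n = yn n z1 * e2' z1 - yn' n z1 * e2 z1" and c2_eq: "c2 n = e1 z1 * yn' n z1 - e1' z1 * yn n z1" for n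
  proof -
    have "yn n z1 * e2' z1 - yn' n z1 * e2 z1 = c1 n * (e1 z1 * e2' z1 - e1' z1 * e2 z1)"
      "e1 z1 * yn' n z1 - e1' z1 * yn n z1 = c2 n * (e1 z1 * e2' z1 - e1' z1 * e2 z1)"
      by (simp_all add: yn_def yn'_def algebra_simps)
    then show "c1 n = yn n z1 * e2' z1 - yn' n z1 * e2 z1" "c2 n = e1 z1 * yn' n z1 - e1' z1 * yn n z1" by (simp_all add: e(3))
  qed
  have bc: "norm (c1 n) \<le> A * norm (e2' z1) + A * norm (e2 z1)" "norm (c2 n) \<le> A * norm (e1 z1) + A * norm (e1' z1)" for n
  proof -
    have "norm (c1 n) \<le> norm (yn n z1) * norm (e2' z1) + norm (yn' n z1) * norm (e2 z1)"
      unfolding c1_eq by (rule order_trans[OF norm_triangle_ineq4]) (simp add: norm_mult)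
    also have "\<dots> \<le> A * norm (e2' z1) + A * norm (e2 z1)" by (intro add_mono mult_right_mono bA) auto
    finally show "norm (c1 n) \<le> A * norm (e2' z1) + A * norm (e2 z1)" .
    have "norm (c2 n) \<le> norm (yn' n z1) * norm (e1 z1) + norm (yn n z1) * norm (e1' z1)"
      unfolding c2_eq by (rule order_trans[OF norm_triangle_ineq4]) (simp add: norm_mult)
    also have "\<dots> \<le> A * norm (e1 z1) + A * norm (e1' z1)" by (intro add_mono mult_right_mono bA) auto
    finally show "norm (c2 n) \<le> A * norm (e1 z1) + A * norm (e1' z1)" .
  qed
  have "bounded (range (\<lambda>n. (c1 n, c2 n)))"
  proof (rule bounded_subset)
    show "bounded (range c1 \<times> range c2)"
      by (intro bounded_Times) (use bc in \<open>auto simp: bounded_iff\<close>)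
  qed auto
  then obtain l r where r: "strict_mono (r :: nat \<Rightarrow> nat)" and l: "((\<lambda>n. (c1 n, c2 n)) \<circ> r) \<longlonglongrightarrow> l"
    using bounded_imp_convergent_subsequence by blast
  have l1: "(\<lambda>n. c1 (r n)) \<longlonglongrightarrow> fst l" and l2: "(\<lambda>n. c2 (r n)) \<longlonglongrightarrow> snd l"
    using tendsto_fst[OF l] tendsto_snd[OF l] by (simp_all add: o_def)
  define y where "y = (\<lambda>z. fst l * e1 z + snd l * e2 z)"
  define y' where "y' = (\<lambda>z. fst l * e1' z + snd l * e2' z)"
  have ysol: "solves (pot m a lam) y y'" unfolding y_def y'_def by (rule solves_combination[OF e(1,2)])
  have limU: "(\<lambda>n. tU m a (yn (r n)) z) \<longlonglongrightarrow> tU m a y z" for z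
    unfolding tU_def yn_def y_def by (intro tendsto_intros l1 l2)
  have limB: "(\<lambda>n. tB m a (yn (r n)) (yn' (r n)) z) \<longlonglongrightarrow> tB m a y y' z" for z
    unfolding tB_def divide_inverse by (intro tendsto_intros limU) (auto simp: yn'_def y'_def intro!: tendsto_intros l1 l2)
  have "lg_bound m a \<beta> C y y' w"
    if w: "norm w \<ge> R" "Re w > - q * norm w" for w
  proof -
    have w0: "w \<noteq> 0" using w C by auto
    have wnr: "w \<notin> \<real>\<^sub>\<le>\<^sub>0" by (rule not_nonpos_Reals_sector[OF w0 w(2) q(2)])
    define d where "d = (\<lambda>n. (of_real (X n) - w) / of_real (norm (of_real (X n) - w)))"
    \<comment> \<open>\<open>d n\<close> is \<open>s n\<close> divided by its modulus, and
      \<open>s n\<close> tends to 1. The conditions on the direction hold strictly for direction 1,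
      so they hold for all large n.\<close>
    define s where "s = (\<lambda>n. 1 - w * of_real (inverse (X n)))"
    have "filterlim X at_top sequentially" unfolding X_def
      by (intro filterlim_tendsto_add_at_top[OF tendsto_const] filterlim_real_sequentially)
    then have "(\<lambda>n. inverse (X n)) \<longlonglongrightarrow> 0" by (rule tendsto_inverse_0_at_top)
    then have "s \<longlonglongrightarrow> 1 - w * of_real 0" unfolding s_def by (intro tendsto_intros)
    then have s: "s \<longlonglongrightarrow> 1" by simp
    have "(\<lambda>n. s n / of_real (norm (s n))) \<longlonglongrightarrow> 1 / of_real (norm (1::complex))" by (intro tendsto_intros s) simp
    moreover have "s n / of_real (norm (s n)) = d n" for n
    proof -
      have "of_real (X n) - w = of_real (X n) * s n" using X(2)[of n] by (simp add: s_def algebra_simps)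
      then show ?thesis using X(2)[of n] by (simp add: d_def norm_mult)
    qed
    ultimately have d: "d \<longlonglongrightarrow> 1" by simp
    have d1: "(\<lambda>n. Re (w * cnj (d n))) \<longlonglongrightarrow> Re (w * cnj 1)" and d2: "(\<lambda>n. Re (cis \<beta> * d n)) \<longlonglongrightarrow> Re (cis \<beta> * 1)"
      by (intro tendsto_intros d)+
    have "\<forall>\<^sub>F n in sequentially. - q * norm w < Re (w * cnj (d n))" "\<forall>\<^sub>F n in sequentially. cos \<beta> / 2 < Re (cis \<beta> * d n)"
      by (rule order_tendstoD(1)[OF d1] order_tendstoD(1)[OF d2]; use w(2) cb in simp)+
    moreover have "\<forall>\<^sub>F n in sequentially. d n \<noteq> 0" using tendsto_imp_eventually_ne[OF d] by simp
    ultimately have "\<forall>\<^sub>F n in sequentially. lg_bound m a \<beta> C (yn n) (yn' n) w"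
    proof eventually_elim
      case (elim n)
      show ?case
        by (rule est[OF w(1) wnr X(2)[of n] d_def[THEN fun_cong] elim(3) less_imp_le[OF elim(1)] less_imp_le[OF elim(2)] sol U1 B0])
    qed
    then have ev: "\<forall>\<^sub>F n in sequentially. lg_bound m a \<beta> C (yn (r n)) (yn' (r n)) w"
      using eventually_compose_filterlim[OF _ filterlim_subseq[OF r]] by blast
    show ?thesis
    proof
      show "norm (tU m a y (zf m \<beta> w) - 1) \<le> C * norm w powr (- (1 / (real m + 2)))"
        by (rule tendsto_upperbound[OF tendsto_norm[OF tendsto_diff[OF limU tendsto_const]]]) (use ev in \<open>auto elim: eventually_mono\<close>)
      show "norm (tB m a y y' (zf m \<beta> w)) \<le> C * norm w powr (- (1 / (real m + 2)))"
        by (rule tendsto_upperbound[OF tendsto_norm[OF limB]]) (use ev in \<open>auto elim: eventually_mono\<close>)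
    qed
  qed
  note main = this
  show thesis by (rule that[of C R y y']) (fact C(1), fact C(2), fact ysol, rule main, assumption+)
qed

section \<open>Asymptotics in sectors\<close>

text \<open>The principal root \<sigma> has nonnegative real part, so |\<sigma> + 1| \<ge> 1 and
  |\<sigma> - 1| \<le> |\<sigma>^2 - 1| = |T - 1|.\<close>

lemma sqrt_exp_near_1:
  assumes "norm (T - 1) \<le> 1 / 2"
  defines "\<sigma> \<equiv> exp (Ln T / 2)"
  shows "norm (\<sigma> - 1) \<le> norm (T - 1)" "norm (1 / \<sigma> - 1) \<le> 2 * norm (T - 1)" "norm \<sigma> \<le> 2" "norm (1 / \<sigma>) \<le> 2"
proof -
  have T0: "T \<noteq> 0" using assms(1) by auto
  have sq: "\<sigma>\<^sup>2 = T" using T0 by (simp add: \<sigma>_def exp_double[symmetric])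
  have re: "Re \<sigma> \<ge> 0" unfolding \<sigma>_def csqrt_exp_Ln[OF T0, symmetric] by (rule Re_csqrt)
  have "1 \<le> Re (\<sigma> + 1)" using re by simp
  also have "\<dots> \<le> norm (\<sigma> + 1)" by (rule complex_Re_le_cmod)
  finally have "norm (\<sigma> - 1) * 1 \<le> norm (\<sigma> - 1) * norm (\<sigma> + 1)" by (intro mult_left_mono) auto
  also have "\<dots> = norm (T - 1)" unfolding norm_mult[symmetric] sq[symmetric] by (simp add: power2_eq_square algebra_simps)
  finally show 1: "norm (\<sigma> - 1) \<le> norm (T - 1)" by simp
  have s2: "norm \<sigma> \<ge> 1 / 2" using 1 assms(1) norm_triangle_ineq2[of 1 "1 - \<sigma>"] by (simp add: norm_minus_commute)
  have s0: "\<sigma> \<noteq> 0" by (simp add: \<sigma>_def)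
  show i: "norm (1 / \<sigma>) \<le> 2" using s2 s0 by (simp add: norm_divide field_simps)
  have "1 / \<sigma> - 1 = - ((\<sigma> - 1) * (1 / \<sigma>))" using s0 by (simp add: field_simps)
  then have "norm (1 / \<sigma> - 1) = norm (\<sigma> - 1) * norm (1 / \<sigma>)" by (simp only: norm_minus_cancel norm_mult)
  also have "\<dots> \<le> norm (T - 1) * 2" using 1 i by (intro mult_mono) auto
  finally show "norm (1 / \<sigma> - 1) \<le> 2 * norm (T - 1)" by simp
  show "norm \<sigma> \<le> 2" using 1 assms(1) norm_triangle_ineq2[of \<sigma> 1] by simp
qed

text \<open>Undoes the substitution: y is \<open>U\<close> times exp(-\<Xi>)/R, which differs from
  \<open>asym0\<close> by the factor 1/\<sigma> with \<sigma> the root of T(1/z); for y' the factor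
  is \<sigma>. Both factors are 1 + O(1/z).\<close>

lemma sector_asymptotics:
  assumes m: "m \<ge> 3" and b: "\<bar>\<beta>\<bar> < pi / 2" and q: "0 < q" "q < 1"
  obtains y y' C R where "C \<ge> 0" "R \<ge> 1" "solves (pot m a lam) y y'"
   "\<And>w z. norm w \<ge> R \<Longrightarrow> Re w > - q * norm w \<Longrightarrow> z = zf m \<beta> w \<Longrightarrow>
     asym_bound m a C y y' z"
proof (rule sector_solution[OF m b q, of a lam]; rule tail_bounds[OF m, of a lam])
  fix y y' C R C0 R0
  assume C: "C \<ge> 0" "R \<ge> 1" and sol: "solves (pot m a lam) y y'"
    and est: "\<And>w. norm w \<ge> R \<Longrightarrow> Re w > - q * norm w \<Longrightarrow>
     lg_bound m a \<beta> C y y' w"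
    and C0: "C0 \<ge> 0" "R0 \<ge> 1"
    and T1: "\<And>z. norm z \<ge> R0 \<Longrightarrow> norm (poly (Tpoly m a) (inverse z) - 1) \<le> C0 / norm z"
    and T2: "\<And>z. norm z \<ge> R0 \<Longrightarrow> norm (poly (Tpoly m a) (inverse z) - 1) \<le> 1 / 2"
    and T4: "\<And>z. norm z \<ge> R0 \<Longrightarrow> norm (tS1 m a z / (2 * tS0 m a z ^ 2)) \<le> C0 * norm z powr (- 1 / 2)"
  define \<kappa> where "\<kappa> = 2 / (real m + 2)"
  have k: "\<kappa> > 0" by (simp add: \<kappa>_def)
  define R1 where "R1 = max R (R0 powr (1 / \<kappa>))"
  define C1 where "C1 = 2 * (3 * C + C0 * (1 + C)) + 2 * C0"
  have C1: "C1 \<ge> 0" "2 * C + 2 * C0 \<le> C1" using C C0 by (auto simp: C1_def algebra_simps)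
  have main: "asym_bound m a C1 y y' z"
    if w: "norm w \<ge> R1" "Re w > - q * norm w" and zw: "z = zf m \<beta> w" for w z
  proof -
    have w0: "w \<noteq> 0" "norm w \<ge> R" using w C by (auto simp: R1_def)
    have wnr: "w \<notin> \<real>\<^sub>\<le>\<^sub>0" by (rule not_nonpos_Reals_sector[OF w0(1) w(2) q(2)])
    have nz: "norm z = norm w powr \<kappa>" unfolding zw \<kappa>_def by (rule zf_facts(3)[OF m b wnr])
    have "(R0 powr (1 / \<kappa>)) powr \<kappa> \<le> norm w powr \<kappa>" using w k by (intro powr_mono2) (auto simp: R1_def)
    then have zR: "norm z \<ge> R0" using nz k C0 by (simp add: powr_powr)
    have z0: "z \<noteq> 0" using zR C0 by auto
    define x where "x = norm z powr (- 1 / 2)"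
    have wx: "norm w powr (- (1 / (real m + 2))) = x"
    proof -
      \<comment> \<open>As |z| = |w|^\<kappa> with \<kappa> = 2/(m+2), the error in \<open>w\<close>
        is exactly |z|^(-1/2).\<close>
      have "- (1 / (real m + 2)) = \<kappa> * (- 1 / 2)" by (simp add: \<kappa>_def divide_simps)
      then show ?thesis unfolding x_def nz powr_powr by (simp only:)
    qed
    have x1: "x \<le> 1" "x \<ge> 0" using powr_mono[of "- 1 / 2" 0 "norm z"] zR C0 z0 by (auto simp: x_def)
    have xz: "1 / norm z \<le> x"
      using powr_mono[of "- 1" "- 1 / 2" "norm z"] zR C0 z0 by (simp add: x_def powr_minus_divide)
    define U where "U = tU m a y z"
    define B where "B = tB m a y y' z"
    define r where "r = tS1 m a z / (2 * tS0 m a z ^ 2)"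
    define T where "T = poly (Tpoly m a) (inverse z)"
    define \<sigma> where "\<sigma> = exp (Ln T / 2)"
    have U: "norm (U - 1) \<le> C * x" and B: "norm B \<le> C * x"
      using est[OF w0(2) w(2)] unfolding wx zw[symmetric] U_def B_def by auto
    have r: "norm r \<le> C0 * x" using T4[OF zR] by (simp add: r_def x_def)
    have Th: "norm (T - 1) \<le> 1 / 2" using T2[OF zR] by (simp add: T_def)
    have "norm (T - 1) \<le> C0 / norm z" using T1[OF zR] by (simp add: T_def)
    also have "\<dots> \<le> C0 * x" using mult_left_mono[OF xz C0(1)] by simp
    finally have T: "norm (T - 1) \<le> C0 * x" .
    note s = sqrt_exp_near_1[OF Th, folded \<sigma>_def]
    have s0: "\<sigma> \<noteq> 0" by (simp add: \<sigma>_def)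
    have T0: "T \<noteq> 0" using Th by auto
    have a0: "exp (- tXi m a z) / tR0 m a z = asym0 m a z * (1 / \<sigma>)"
    proof -
      \<comment> \<open>The powers of z agree because \<mu> - m/2 = -\<nu> - m/4.\<close>
      have e: "(mu m a - of_real (real m / 2)) * Ln z + - Fexp m a z - Ln T / 2 = - tXi m a z - (of_real (real m / 4) * Ln z + Ln T / 2)"
        by (simp add: mu_def tXi_def field_simps)
      have "asym0 m a z * (1 / \<sigma>) = exp ((mu m a - of_real (real m / 2)) * Ln z + - Fexp m a z - Ln T / 2)"
        unfolding asym0_def \<sigma>_def powr_def using z0 by (simp only: if_False exp_add exp_diff) simp
      also have "\<dots> = exp (- tXi m a z - (of_real (real m / 4) * Ln z + Ln T / 2))" by (simp only: e)
      also have "\<dots> = exp (- tXi m a z) / tR0 m a z" by (simp only: exp_diff tR_def T_def)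
      finally show ?thesis ..
    qed
    have a1: "tS0 m a z * (exp (- tXi m a z) / tR0 m a z) = asym1 m a z * \<sigma>"
    proof -
      have "asym1 m a z = asym0 m a z * exp (of_real (real m / 2) * Ln z)"
        unfolding asym0_def asym1_def powr_def using z0 by (simp add: exp_add[symmetric] algebra_simps)
      moreover have "tS0 m a z = exp (of_real (real m / 2) * Ln z) * \<sigma>\<^sup>2"
        unfolding tS_def T_def[symmetric] \<sigma>_def using T0 by (simp add: exp_double[symmetric])
      ultimately show ?thesis unfolding a0 using s0 by (simp add: power2_eq_square)
    qed
    have "y z = U * (exp (- tXi m a z) / tR0 m a z)" by (simp add: U_def tU_def exp_minus)
    then have "y z - asym0 m a z = asym0 m a z * ((U - 1) * (1 / \<sigma>) + (1 / \<sigma> - 1))" unfolding a0 using s0 by (simp add: field_simps)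
    then have "norm (y z - asym0 m a z) = norm (asym0 m a z) * norm ((U - 1) * (1 / \<sigma>) + (1 / \<sigma> - 1))" by (simp only: norm_mult)
    also have "\<dots> \<le> norm (asym0 m a z) * (C1 * x)"
    proof (rule mult_left_mono)
      have "norm ((U - 1) * (1 / \<sigma>) + (1 / \<sigma> - 1)) \<le> norm (U - 1) * norm (1 / \<sigma>) + norm (1 / \<sigma> - 1)"
        by (rule order_trans[OF norm_triangle_ineq]) (simp only: norm_mult order_refl)
      also have "\<dots> \<le> (C * x) * 2 + 2 * (C0 * x)" using U s T x1 C by (intro add_mono mult_mono) auto
      also have "\<dots> = (2 * C + 2 * C0) * x" by (simp add: algebra_simps)
      also have "\<dots> \<le> C1 * x" using C1 x1 by (intro mult_right_mono) auto
      finally show "norm ((U - 1) * (1 / \<sigma>) + (1 / \<sigma> - 1)) \<le> C1 * x" .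
    qed simp
    finally have f1: "norm (y z - asym0 m a z) \<le> C1 * x * norm (asym0 m a z)" by (simp add: mult_ac)
    have S0: "tS0 m a z \<noteq> 0" using T0 by (simp add: tS_def T_def)
    define V where "V = y' z * exp (tXi m a z) * tR0 m a z / tS0 m a z"
    \<comment> \<open>Since \<open>B\<close> and \<open>r\<close> are small and \<open>U\<close> is
      near 1, the normalised derivative \<open>V\<close> is near -1.\<close>
    have "2 * B = - (V + (1 + r) * U)" unfolding B_def tB_def V_def r_def U_def by simp
    then have V: "V + 1 = - (2 * B + (U - 1) + r * U)" by (simp add: algebra_simps)
    have "norm U \<le> 1 + C"
    proof -
      have "norm U \<le> 1 + norm (U - 1)" using norm_triangle_ineq2[of U 1] by simp
      also have "C * x \<le> C" using C x1 by (simp add: mult_left_le)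
      then have "1 + norm (U - 1) \<le> 1 + C" using U by simp
      finally show ?thesis .
    qed
    then have "norm (V + 1) \<le> 2 * (C * x) + C * x + C0 * x * (1 + C)"
      unfolding V norm_minus_cancel using U B r x1 C0
      by (intro norm_triangle_le add_mono) (auto simp: norm_mult intro!: mult_mono)
    then have V1: "norm (V + 1) \<le> (3 * C + C0 * (1 + C)) * x" by (simp add: algebra_simps)
    have "y' z = V * (tS0 m a z * (exp (- tXi m a z) / tR0 m a z))" using S0 by (simp add: V_def exp_minus)
    then have "y' z + asym1 m a z = asym1 m a z * ((V + 1) * \<sigma> - (\<sigma> - 1))" unfolding a1 by (simp add: algebra_simps)
    then have "norm (y' z + asym1 m a z) = norm (asym1 m a z) * norm ((V + 1) * \<sigma> - (\<sigma> - 1))" by (simp only: norm_mult)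
    also have "\<dots> \<le> norm (asym1 m a z) * (C1 * x)"
    proof (rule mult_left_mono)
      have "norm ((V + 1) * \<sigma> - (\<sigma> - 1)) \<le> norm (V + 1) * norm \<sigma> + norm (\<sigma> - 1)"
        by (rule order_trans[OF norm_triangle_ineq4]) (simp only: norm_mult order_refl)
      also have "\<dots> \<le> (3 * C + C0 * (1 + C)) * x * 2 + C0 * x" using V1 s T x1 C C0 by (intro add_mono mult_mono) auto
      also have "\<dots> \<le> C1 * x" using C0 x1 by (simp add: C1_def algebra_simps)
      finally show "norm ((V + 1) * \<sigma> - (\<sigma> - 1)) \<le> C1 * x" .
    qed simp
    finally have "norm (y' z + asym1 m a z) \<le> C1 * x * norm (asym1 m a z)" by (simp add: mult_ac)
    with f1 show ?thesis unfolding x_def by simp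
  qed
  have "R1 \<ge> 1" using C by (simp add: R1_def)
  then show thesis by (rule that[of C1 R1 y y', OF C1(1) _ sol]) (rule main, assumption+)
qed

text \<open>The sign \<open>s\<close> selects the half. A rotation by slightly less than
  \<open>s * pi / 2\<close> moves that half, narrowed by the margin, into |arg w| \<le> \<pi> - 2
  \<theta>, where segments towards large positive \<open>w\<close> are admissible.\<close>

lemma half_sector_asymptotics:
  assumes m: "m \<ge> 3" and e: "0 < e" "e < 3 * pi / (real m + 2)" and s: "s = 1 \<or> s = - (1::real)"
  obtains y y' C R where "C \<ge> 0" "R \<ge> 1" "solves (pot m a lam) y y'"
   "\<And>z. norm z \<ge> R \<Longrightarrow> 0 \<le> s * Arg z \<Longrightarrow> \<bar>Arg z\<bar> \<le> 3 * pi / (real m + 2) - e \<Longrightarrow>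
     asym_bound m a C y y' z"
proof -
  define \<kappa> where "\<kappa> = 2 / (real m + 2)"
  have k: "\<kappa> > 0" by (simp add: \<kappa>_def)
  have pk: "3 * pi / (real m + 2) = \<kappa> * (3 * pi / 2)" by (simp add: \<kappa>_def divide_simps)
  \<comment> \<open>The margin \<open>e\<close> becomes 3 \<theta> in the angle of z^((m+2)/2). One
    \<theta> is spent on keeping |\<beta>| below \<pi>/2; the remaining two keep arg w away from
    \<pi>.\<close>
  define \<theta> where "\<theta> = e / (3 * \<kappa>)"
  have th: "0 < \<theta>" "\<theta> < pi / 2" "e = 3 * \<kappa> * \<theta>" using e k unfolding pk \<theta>_def by (auto simp: field_simps)
  define \<beta> where "\<beta> = s * (pi / 2 - \<theta>)"
  have b: "\<bar>\<beta>\<bar> < pi / 2" using s th by (auto simp: \<beta>_def)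
  \<comment> \<open>Midway between |cos(2 \<theta>)| and 1, so that cos(arg w) \<ge> -cos(2
    \<theta>) > -q.\<close>
  define q where "q = (1 + \<bar>cos (2 * \<theta>)\<bar>) / 2"
  have "\<bar>cos (2 * \<theta>)\<bar> < 1"
  proof -
    have "sin (2 * \<theta>) > 0" using th by (intro sin_gt_zero) auto
    then have "(cos (2 * \<theta>))\<^sup>2 < 1" using sin_cos_squared_add[of "2 * \<theta>"] by (smt (verit) zero_less_power)
    then show ?thesis by (simp add: abs_square_less_1)
  qed
  then have q: "0 < q" "q < 1" "cos (2 * \<theta>) < q" by (auto simp: q_def)
  show thesis
  proof (rule sector_asymptotics[OF m b q(1,2), of a lam])
    fix y y' C R
    assume C: "C \<ge> 0" "R \<ge> 1" and sol: "solves (pot m a lam) y y'"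
      and est: "\<And>w z. norm w \<ge> R \<Longrightarrow> Re w > - q * norm w \<Longrightarrow> z = zf m \<beta> w \<Longrightarrow>
     asym_bound m a C y y' z"
    define R1 where "R1 = max 1 (R powr \<kappa>)"
    have main: "asym_bound m a C y y' z"
      if z: "norm z \<ge> R1" "0 \<le> s * Arg z" "\<bar>Arg z\<bar> \<le> 3 * pi / (real m + 2) - e" for z
    proof -
      have z0: "z \<noteq> 0" using z(1) by (auto simp: R1_def)
      define w where "w = exp (Ln z / of_real \<kappa> - \<i> * of_real \<beta>)"
      define t where "t = Arg z / \<kappa> - \<beta>"
      have Aim: "Im (Ln z) = Arg z" using Arg_def z0 by simp
      have "\<bar>Arg z\<bar> \<le> \<kappa> * (3 * pi / 2 - 3 * \<theta>)" using z(3) unfolding pk th(3) by (simp add: algebra_simps)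
      then have az: "\<bar>Arg z / \<kappa>\<bar> \<le> 3 * pi / 2 - 3 * \<theta>" using k by (simp add: abs_divide pos_divide_le_eq mult.commute)
      have sz: "0 \<le> s * (Arg z / \<kappa>)" using z(2) k by simp
      have t: "\<bar>t\<bar> \<le> pi - 2 * \<theta>"
      proof -
        have "Arg z / \<kappa> \<le> 3 * pi / 2 - 3 * \<theta>" "- (Arg z / \<kappa>) \<le> 3 * pi / 2 - 3 * \<theta>" using az by (simp_all only: abs_le_iff)
        then have "t \<le> pi - 2 * \<theta>" "- t \<le> pi - 2 * \<theta>" using s sz th unfolding t_def \<beta>_def by (elim disjE; simp)+
        then show ?thesis by (simp only: abs_le_iff)
      qed
      have imw: "Im (Ln z / of_real \<kappa> - \<i> * of_real \<beta>) = t" by (simp add: t_def Aim Im_divide_of_real)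
      have Lw: "Ln w = Ln z / of_real \<kappa> - \<i> * of_real \<beta>"
        unfolding w_def by (intro Ln_exp; unfold imw; use t th in linarith)
      have nw: "norm w = norm z powr (1 / \<kappa>)"
        unfolding w_def norm_exp_eq_Re using z0 by (simp add: powr_def Re_divide_of_real)
      have zz: "z = zf m \<beta> w"
        unfolding zf_def Lw \<kappa>_def[symmetric] using k z0 by simp
      have "cos t \<ge> cos (pi - 2 * \<theta>)"
        using cos_monotone_0_pi_le[of "\<bar>t\<bar>" "pi - 2 * \<theta>"] t th by auto
      then have "cos t > - q" using q(3) by simp
      then have rw: "Re w > - q * norm w"
      proof -
        have "Re w = norm w * cos t" unfolding w_def Re_exp norm_exp_eq_Re imw ..
        moreover have "norm w * cos t > norm w * - q" using \<open>cos t > - q\<close> by (intro mult_strict_left_mono) (auto simp: w_def)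
        ultimately show ?thesis by (simp add: mult.commute)
      qed
      have "(R powr \<kappa>) powr (1 / \<kappa>) \<le> norm z powr (1 / \<kappa>)" using z(1) k by (intro powr_mono2) (auto simp: R1_def)
      then have "R \<le> norm w" using nw k C by (simp add: powr_powr)
      then show ?thesis by (rule est[OF _ rw zz])
    qed
    show thesis by (rule that[of C R1 y y', OF C(1) _ sol]) (simp add: R1_def, rule main, assumption+)
  qed
qed

section \<open>The subdominant solution\<close>

lemma exp_diff_1_bound:
  fixes x :: complex assumes "norm x \<le> 1" shows "norm (exp x - 1) \<le> 3 * norm x"
proof -
  have "norm (exp x - exp 0) \<le> 3 * norm (x - 0)"
  proof (rule field_differentiable_bound[of "cball 0 1"])
    fix z :: complex assume "z \<in> cball 0 1"
    then have "norm (exp z) \<le> exp 1" using norm_exp[of z] order_trans[of _ "exp (norm z)"] by simp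
    also have "\<dots> \<le> 3" by (rule exp_le)
    finally show "norm (exp z) \<le> 3" .
  qed (use assms in \<open>auto intro!: has_field_derivative_at_within DERIV_exp\<close>)
  then show ?thesis by simp
qed

text \<open>The second smallness condition keeps the rotation by 1 + h/lam below \<delta>, so the
  sum does not cross the cut and the principal logarithms add. It serves for
  \<open>lam + a m\<close>, the value of the potential at 0.\<close>

lemma Ln_perturbation:
  assumes lam: "lam \<noteq> 0" "\<bar>Arg lam\<bar> \<le> pi - \<delta>" and h: "norm h \<le> norm lam / 4" "2 * norm h < \<delta> * norm lam"
  shows "norm (Ln (lam + h) - Ln lam) \<le> 2 * norm h / norm lam"
proof -
  define \<eta> where "\<eta> = h / lam"
  have e: "lam + h = lam * (1 + \<eta>)" using lam by (simp add: \<eta>_def field_simps)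
  have ne: "norm \<eta> = norm h / norm lam" by (simp add: \<eta>_def norm_divide)
  have n1: "norm \<eta> \<le> 1 / 4" "2 * norm \<eta> < \<delta>" using h lam unfolding ne by (auto simp: field_simps)
  have l: "norm (Ln (1 + \<eta>)) \<le> 2 * norm \<eta>" using n1 by (intro norm_Ln_le) auto
  have z: "1 + \<eta> \<noteq> 0"
  proof
    assume "1 + \<eta> = 0"
    then have "\<eta> = - 1" by (simp add: add_eq_0_iff)
    then show False using n1 by simp
  qed
  have "\<bar>Im (Ln (1 + \<eta>))\<bar> < \<delta>" using l n1 abs_Im_le_cmod[of "Ln (1 + \<eta>)"] by linarith
  moreover have "\<bar>Im (Ln lam)\<bar> \<le> pi - \<delta>" using lam by (simp add: Arg_def)
  ultimately have "- pi < Im (Ln lam) + Im (Ln (1 + \<eta>))" "Im (Ln lam) + Im (Ln (1 + \<eta>)) \<le> pi" by linarith+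
  then have "Ln (lam + h) = Ln lam + Ln (1 + \<eta>)" unfolding e using lam z by (intro Ln_times_simple) auto
  then show ?thesis using l by (simp add: ne)
qed

lemma asym_nonzero [simp]: "z \<noteq> 0 \<Longrightarrow> asym0 m a z \<noteq> 0" "z \<noteq> 0 \<Longrightarrow> asym1 m a z \<noteq> 0"
  by (simp_all add: asym0_def asym1_def)

lemma asymptotic_ratio_limit:
  fixes y \<phi> :: "complex \<Rightarrow> complex"
  assumes \<phi>: "\<And>z. z \<noteq> 0 \<Longrightarrow> \<phi> z \<noteq> 0"
    and est: "\<And>n. real n \<ge> R \<Longrightarrow> n > 0 \<Longrightarrow> norm (y (of_nat n) - \<gamma> * \<phi> (of_nat n)) \<le> C * real n powr (- 1 / 2) * norm (\<phi> (of_nat n))"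
  shows "(\<lambda>n. y (of_nat n) / \<phi> (of_nat n)) \<longlonglongrightarrow> \<gamma>"
proof -
  have "(\<lambda>n. C * real n powr (- 1 / 2)) \<longlonglongrightarrow> C * 0" by (intro tendsto_intros) real_asymp
  then have l: "(\<lambda>n. C * real n powr (- 1 / 2)) \<longlonglongrightarrow> 0" by simp
  have "\<forall>\<^sub>F n in sequentially. real n \<ge> R"
    using filterlim_real_sequentially unfolding filterlim_at_top by blast
  then have "\<forall>\<^sub>F n in sequentially. norm (y (of_nat n) / \<phi> (of_nat n) - \<gamma>) \<le> C * real n powr (- 1 / 2)"
    using eventually_gt_at_top[of 0]
  proof eventually_elim
    case (elim n)
    then have p: "\<phi> (of_nat n) \<noteq> 0" using \<phi> by simp
    have "y (of_nat n) / \<phi> (of_nat n) - \<gamma> = (y (of_nat n) - \<gamma> * \<phi> (of_nat n)) / \<phi> (of_nat n)" using p by (simp add: field_simps)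
    then show ?case using est[OF elim] p by (simp add: norm_divide pos_divide_le_eq)
  qed
  then have "(\<lambda>n. y (of_nat n) / \<phi> (of_nat n) - \<gamma>) \<longlonglongrightarrow> 0" by (rule Lim_null_comparison[OF _ l])
  then show ?thesis by (simp add: LIM_zero_iff)
qed

text \<open>Normalisation along the integers only: weak enough to be shared by solutions built for
  different sectors, strong enough for uniqueness.\<close>

definition subdominant :: "nat \<Rightarrow> (nat \<Rightarrow> complex) \<Rightarrow> complex \<Rightarrow> (complex \<Rightarrow> complex) \<Rightarrow> (complex \<Rightarrow> complex) \<Rightarrow> bool" where
  "subdominant m a lam y y' \<longleftrightarrow> solves (pot m a lam) y y'
    \<and> (\<lambda>n. y (of_nat n) / asym0 m a (of_nat n)) \<longlonglongrightarrow> 1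
    \<and> (\<lambda>n. y' (of_nat n) / asym1 m a (of_nat n)) \<longlonglongrightarrow> - 1"

lemma Arg_of_nat_0 [simp]: "n > 0 \<Longrightarrow> Arg (of_nat n) = 0"
  using Arg_of_real[of "real n"] by simp

lemma sibuya_sol_subdominant:
  assumes "sibuya_sol m a lam g"
  shows "subdominant m a lam g (deriv g)"
proof -
  have hol: "g holomorphic_on UNIV" and ode: "\<And>z. (deriv ^^ 2) g z = (z ^ m + poly (Ppoly m a) z + lam) * g z"
    using assms by (auto simp: sibuya_sol_def)
  \<comment> \<open>Taking \<open>eps\<close> equal to the full opening restricts the estimate to
    the positive axis.\<close>
  have "3 * pi / (real m + 2) > 0" by (intro divide_pos_pos) (auto simp: add_pos_nonneg)
  then obtain C R where CR: "\<And>z. z \<noteq> 0 \<Longrightarrow> norm z \<ge> R \<Longrightarrow> \<bar>Arg z\<bar> \<le> 3 * pi / (real m + 2) - 3 * pi / (real m + 2) \<Longrightarrow>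
     norm (g z - asym0 m a z) \<le> C * norm z powr (- 1 / 2) * norm (asym0 m a z)
     \<and> norm (deriv g z - (- asym1 m a z)) \<le> C * norm z powr (- 1 / 2) * norm (asym1 m a z)"
    using assms unfolding sibuya_sol_def asym0_def asym1_def by meson
  have d1: "(g has_field_derivative deriv g z) (at z)" for z
    using hol holomorphic_derivI by blast
  have d2: "(deriv g has_field_derivative poly (pot m a lam) z * g z) (at z)" for z
  proof -
    have "deriv g holomorphic_on UNIV" by (rule holomorphic_deriv[OF hol]) simp
    then have "(deriv g has_field_derivative deriv (deriv g) z) (at z)" using holomorphic_derivI by blast
    moreover have "deriv (deriv g) z = poly (pot m a lam) z * g z" using ode[of z] by (simp add: numeral_2_eq_2 poly_pot)
    ultimately show ?thesis by simp
  qed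
  have N: "norm (g (of_nat n) - 1 * asym0 m a (of_nat n)) \<le> C * real n powr (- 1 / 2) * norm (asym0 m a (of_nat n))"
    "norm (deriv g (of_nat n) - (- 1) * asym1 m a (of_nat n)) \<le> C * real n powr (- 1 / 2) * norm (asym1 m a (of_nat n))"
    if "real n \<ge> R" "n > 0" for n
    using CR[of "of_nat n"] that by simp_all
  have "(\<lambda>n. g (of_nat n) / asym0 m a (of_nat n)) \<longlonglongrightarrow> 1"
    by (rule asymptotic_ratio_limit[of "asym0 m a" R g 1 C, OF asym_nonzero(1) N(1)])
  moreover have "(\<lambda>n. deriv g (of_nat n) / asym1 m a (of_nat n)) \<longlonglongrightarrow> - 1"
    by (rule asymptotic_ratio_limit[of "asym1 m a" R "deriv g" "-1" C, OF asym_nonzero(2) N(2)])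
  ultimately show ?thesis using d1 d2 by (simp add: subdominant_def solves_def)
qed

text \<open>The positive integers have argument 0 and lie in either half, so both signs give the
  same normalisation.\<close>

lemma half_sector_subdominant:
  assumes m: "m \<ge> 3" and e: "0 < e" "e < 3 * pi / (real m + 2)" and s: "s = 1 \<or> s = - (1::real)"
  obtains y y' C R where "C \<ge> 0" "R \<ge> 1" "subdominant m a lam y y'"
   "\<And>z. norm z \<ge> R \<Longrightarrow> 0 \<le> s * Arg z \<Longrightarrow> \<bar>Arg z\<bar> \<le> 3 * pi / (real m + 2) - e \<Longrightarrow>
     asym_bound m a C y y' z"
proof (rule half_sector_asymptotics[OF m e s, of a lam])
  fix y y' C R
  assume C: "C \<ge> 0" "R \<ge> 1" and sol: "solves (pot m a lam) y y'"
    and est: "\<And>z. norm z \<ge> R \<Longrightarrow> 0 \<le> s * Arg z \<Longrightarrow> \<bar>Arg z\<bar> \<le> 3 * pi / (real m + 2) - e \<Longrightarrow>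
     asym_bound m a C y y' z"
  have "norm (y (of_nat n) - 1 * asym0 m a (of_nat n)) \<le> C * real n powr (- 1 / 2) * norm (asym0 m a (of_nat n))"
    "norm (y' (of_nat n) - (- 1) * asym1 m a (of_nat n)) \<le> C * real n powr (- 1 / 2) * norm (asym1 m a (of_nat n))"
    if "real n \<ge> R" "n > 0" for n
    using est[of "of_nat n"] that e by simp_all
  then have "(\<lambda>n. y (of_nat n) / asym0 m a (of_nat n)) \<longlonglongrightarrow> 1" "(\<lambda>n. y' (of_nat n) / asym1 m a (of_nat n)) \<longlonglongrightarrow> - 1"
    by (auto intro: asymptotic_ratio_limit[of "asym0 m a" R _ 1 C] asymptotic_ratio_limit[of "asym1 m a" R _ "-1" C])
  then have "subdominant m a lam y y'" using sol by (simp add: subdominant_def)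
  then show thesis by (rule that[OF C]) (rule est, assumption+)
qed

text \<open>A solution is constructed for each half and each margin; uniqueness identifies all of
  them with one \<open>g\<close>, which then has the asymptotics in every admissible sector.\<close>

lemma sibuya_sol_exists:
  assumes m: "m \<ge> 3"
    and uniq: "\<And>y y' w w'. subdominant m a lam y y' \<Longrightarrow> subdominant m a lam w w' \<Longrightarrow> y = w \<and> y' = w'"
  obtains g where "sibuya_sol m a lam g"
proof -
  have pm: "3 * pi / (real m + 2) > 0" by (intro divide_pos_pos) (auto simp: add_pos_nonneg)
  define e0 where "e0 = 3 * pi / (real m + 2) / 2"
  have e0: "0 < e0" unfolding e0_def using pm by (rule half_gt_zero)
  have e0': "e0 < 3 * pi / (real m + 2)" 
  proof -
    have "x / 2 < x" if "x > 0" for x :: real using that by simp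
    then show ?thesis unfolding e0_def using pm .
  qed
  obtain g g' where g: "subdominant m a lam g g'"
    using half_sector_subdominant[OF m e0 e0', of 1 a lam] by metis
  have half: "\<exists>C R. C \<ge> 0 \<and> (\<forall>z. norm z \<ge> R \<longrightarrow> 0 \<le> s * Arg z \<longrightarrow> \<bar>Arg z\<bar> \<le> 3 * pi / (real m + 2) - e \<longrightarrow>
     asym_bound m a C g g' z)"
    if "0 < e" "e < 3 * pi / (real m + 2)" "s = 1 \<or> s = - 1" for e s :: real
  proof (rule half_sector_subdominant[OF m that, of a lam])
    fix y y' C R
    assume "C \<ge> 0" "subdominant m a lam y y'" and
      *: "\<And>z. norm z \<ge> R \<Longrightarrow> 0 \<le> s * Arg z \<Longrightarrow> \<bar>Arg z\<bar> \<le> 3 * pi / (real m + 2) - e \<Longrightarrow>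
     asym_bound m a C y y' z"
    then have "y = g" "y' = g'" using uniq[OF _ g] by auto
    then show ?thesis using * \<open>C \<ge> 0\<close> by blast
  qed
  have sol: "solves (pot m a lam) g g'" using g by (simp add: subdominant_def)
  have dg: "deriv g = g'" using DERIV_imp_deriv[OF solvesD(1)[OF sol]] by auto
  have dg': "deriv g' z = poly (pot m a lam) z * g z" for z using DERIV_imp_deriv[OF solvesD(2)[OF sol]] by auto
  have full: "\<exists>C R. \<forall>z. z \<noteq> 0 \<and> norm z \<ge> R \<and> \<bar>Arg z\<bar> \<le> 3 * pi / (real m + 2) - eps \<longrightarrow>
     norm (g z - asym0 m a z) \<le> C * norm z powr (- 1 / 2) * norm (asym0 m a z)
     \<and> norm (deriv g z - (- asym1 m a z)) \<le> C * norm z powr (- 1 / 2) * norm (asym1 m a z)" if eps: "eps > 0" for eps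
  proof -
    \<comment> \<open>The construction requires a margin below the full opening. A smaller margin
      gives a larger sector, so large \<open>eps\<close> is covered.\<close>
    define e where "e = min eps e0"
    have e: "0 < e" "e < 3 * pi / (real m + 2)" "e \<le> eps" using eps e0 e0' by (auto simp: e_def)
    obtain C1 R1 where 1: "C1 \<ge> 0" "\<And>z. norm z \<ge> R1 \<Longrightarrow> 0 \<le> Arg z \<Longrightarrow> \<bar>Arg z\<bar> \<le> 3 * pi / (real m + 2) - e \<Longrightarrow>
     asym_bound m a C1 g g' z"
      using half[OF e(1,2), of 1] by auto
    obtain C2 R2 where 2: "C2 \<ge> 0" "\<And>z. norm z \<ge> R2 \<Longrightarrow> Arg z \<le> 0 \<Longrightarrow> \<bar>Arg z\<bar> \<le> 3 * pi / (real m + 2) - e \<Longrightarrow>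
     asym_bound m a C2 g g' z"
      using half[OF e(1,2), of "- 1"] by auto
    have up: "C * t * n \<le> (C1 + C2) * t * n" if "C \<le> C1 + C2" "t \<ge> 0" "n \<ge> 0" for C t n :: real
      using that by (intro mult_right_mono)
    have "norm (g z - asym0 m a z) \<le> (C1 + C2) * norm z powr (- 1 / 2) * norm (asym0 m a z)
     \<and> norm (deriv g z - (- asym1 m a z)) \<le> (C1 + C2) * norm z powr (- 1 / 2) * norm (asym1 m a z)"
      if "norm z \<ge> max R1 R2" "\<bar>Arg z\<bar> \<le> 3 * pi / (real m + 2) - eps" for z
    proof (cases "0 \<le> Arg z")
      case True
      have "\<bar>Arg z\<bar> \<le> 3 * pi / (real m + 2) - e" using that e by linarith
      then have *: "norm (g z - asym0 m a z) \<le> C1 * norm z powr (- 1 / 2) * norm (asym0 m a z)"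
         "norm (g' z + asym1 m a z) \<le> C1 * norm z powr (- 1 / 2) * norm (asym1 m a z)"
        using 1(2)[of z] True that by auto
      show ?thesis unfolding dg
        using order_trans[OF *(1) up[of C1 "norm z powr (- 1 / 2)" "norm (asym0 m a z)"]] order_trans[OF *(2) up[of C1 "norm z powr (- 1 / 2)" "norm (asym1 m a z)"]] 2(1)
        by simp
    next
      case False
      have "\<bar>Arg z\<bar> \<le> 3 * pi / (real m + 2) - e" using that e by linarith
      then have *: "norm (g z - asym0 m a z) \<le> C2 * norm z powr (- 1 / 2) * norm (asym0 m a z)"
         "norm (g' z + asym1 m a z) \<le> C2 * norm z powr (- 1 / 2) * norm (asym1 m a z)"
        using 2(2)[of z] False that by auto
      show ?thesis unfolding dg
        using order_trans[OF *(1) up[of C2 "norm z powr (- 1 / 2)" "norm (asym0 m a z)"]] order_trans[OF *(2) up[of C2 "norm z powr (- 1 / 2)" "norm (asym1 m a z)"]] 1(1)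
        by simp
    qed
    then show ?thesis by blast
  qed
  have "g holomorphic_on UNIV"
    unfolding holomorphic_on_def field_differentiable_def using solvesD(1)[OF sol] has_field_derivative_at_within by blast
  then have "sibuya_sol m a lam g"
    using full unfolding sibuya_sol_def asym0_def asym1_def
    by (simp add: numeral_2_eq_2 dg dg' poly_pot)
  then show ?thesis by (rule that)
qed

section \<open>Uniformity on compact sets, uniqueness, and the values at 0\<close>

lemma compact_coordinates_bounded:
  fixes K :: "(nat \<Rightarrow> complex) set"
  assumes "compact K"
  obtains A where "A \<ge> 1" "\<And>a i. a \<in> K \<Longrightarrow> i \<in> {1..m::nat} \<Longrightarrow> norm (a i) \<le> A"
proof -
  have "\<exists>B. \<forall>a\<in>K. norm (a i) \<le> B" for i
  proof -
    have "compact ((\<lambda>a. a i) ` K)"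
      by (rule compact_continuous_image[OF continuous_on_subset[OF continuous_on_product_coordinates] assms]) simp
    then have "bounded ((\<lambda>a. a i) ` K)" by (rule compact_imp_bounded)
    then show ?thesis by (auto simp: bounded_iff)
  qed
  then obtain B where B: "\<And>i a. a \<in> K \<Longrightarrow> norm (a i) \<le> B i" by metis
  have "norm (a i) \<le> 1 + (\<Sum>j=1..m. \<bar>B j\<bar>)" if "a \<in> K" "i \<in> {1..m}" for a i
  proof -
    have "norm (a i) \<le> \<bar>B i\<bar>" using B[OF that(1), of i] by linarith
    also have "\<dots> \<le> (\<Sum>j=1..m. \<bar>B j\<bar>)" using that by (intro member_le_sum) auto
    finally show ?thesis by simp
  qed
  moreover have "1 + (\<Sum>j=1..m. \<bar>B j\<bar>) \<ge> 1" by (simp add: sum_nonneg)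
  ultimately show ?thesis using that by blast
qed

text \<open>The difference of two such solutions has limit \<gamma> = 0, so the half-line estimate
  gives \<open>U = B = 0\<close> at 0. Hence its value and derivative at 0 vanish.\<close>

lemma subdominant_unique:
  fixes \<Lambda> c K :: real
  assumes m: "m \<ge> 3" and L: "\<Lambda> \<ge> 1" and c: "c > 0"
    and q0: "\<And>x::real. x \<ge> 0 \<Longrightarrow> poly (pot m a lam) (of_real x) \<notin> \<real>\<^sub>\<le>\<^sub>0"
    and ql: "\<And>x::real. x \<ge> 0 \<Longrightarrow> norm (poly (pot m a lam) (of_real x)) \<ge> c * (x + \<Lambda>) ^ m"
    and q1: "\<And>x::real. x \<ge> 0 \<Longrightarrow> norm (poly (pderiv (pot m a lam)) (of_real x)) \<le> K * (x + \<Lambda>) ^ (m - 1)"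
    and q2: "\<And>x::real. x \<ge> 0 \<Longrightarrow> norm (poly (pderiv (pderiv (pot m a lam))) (of_real x)) \<le> K * (x + \<Lambda>) ^ (m - 2)"
    and small: "(K / c powr (3/2) + K ^ 2 / c powr (5/2)) * \<Lambda> powr - (real m / 2 + 1) \<le> 1/4"
    and y: "subdominant m a lam y y'" and w: "subdominant m a lam w w'"
  shows "y = w \<and> y' = w'"
proof -
  let ?q = "pot m a lam"
  have s: "solves ?q y y'" "solves ?q w w'" using y w by (auto simp: subdominant_def)
  define d where "d = (\<lambda>z. 1 * y z + (- 1) * w z)"
  define d' where "d' = (\<lambda>z. 1 * y' z + (- 1) * w' z)"
  have sd: "solves ?q d d'" unfolding d_def d'_def by (rule solves_combination[OF s])
  have "(\<lambda>n. y (of_nat n) / asym0 m a (of_nat n) - w (of_nat n) / asym0 m a (of_nat n)) \<longlonglongrightarrow> 1 - 1"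
    "(\<lambda>n. y' (of_nat n) / asym1 m a (of_nat n) - w' (of_nat n) / asym1 m a (of_nat n)) \<longlonglongrightarrow> - 1 - - 1"
    by (rule tendsto_diff; use y w in \<open>simp add: subdominant_def\<close>)+
  then have l: "(\<lambda>n. d (of_nat n) / asym0 m a (of_nat n)) \<longlonglongrightarrow> 0" "(\<lambda>n. d' (of_nat n) / asym1 m a (of_nat n)) \<longlonglongrightarrow> - 0"
    by (simp_all add: d_def d'_def diff_divide_distrib)
  have U: "(\<lambda>n. lgU ?q d (real n)) \<longlonglongrightarrow> 0" and B: "(\<lambda>n. lgB ?q d d' (real n)) \<longlonglongrightarrow> 0"
    using lgU_lgB_limit[OF m q0 l] by simp_all
  have m2: "m \<ge> 2" using m by simp
  have "norm (lgU ?q d 0 - 0) \<le> 4 * norm (0::complex) * ((K / c powr (3/2) + K ^ 2 / c powr (5/2)) * \<Lambda> powr - (real m / 2 + 1))"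
    "norm (lgB ?q d d' 0) \<le> 2 * norm (0::complex) * ((K / c powr (3/2) + K ^ 2 / c powr (5/2)) * \<Lambda> powr - (real m / 2 + 1))"
    using half_line_estimate[OF m2 L c q0 ql q1 q2 solvesD(1)[OF sd] solvesD(2)[OF sd] U B small] by auto
  then have z: "lgU ?q d 0 = 0" "lgB ?q d d' 0 = 0" by simp_all
  have "lgR ?q 0 \<noteq> 0" by (simp add: lgR_def)
  with z(1) have "d 0 = 0" by (simp add: lgU_def)
  moreover have "d' 0 = 0" using z \<open>lgR ?q 0 \<noteq> 0\<close> by (simp add: lgB_def)
  ultimately show ?thesis using solves_unique[OF s] by (auto simp: d_def d'_def)
qed

theorem theorem4p1:
  fixes m :: nat and \<delta> :: real and K :: "(nat \<Rightarrow> complex) set"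
  assumes "m \<ge> 3"
    and "0 < \<delta>" and "\<delta> \<le> pi / (real m + 2)"
    and "compact K"
  shows "\<exists>C R. \<forall>a\<in>K. \<forall>lam. norm lam \<ge> R \<and> \<bar>Arg lam\<bar> \<le> pi - \<delta> \<longrightarrow>
      norm (sibuya m a lam 0 - lam powr (-1/4) * exp (Lint m a lam))
        \<le> C * norm lam powr (- (1/2 + 1 / real m)) * norm (lam powr (-1/4) * exp (Lint m a lam))
    \<and> norm (deriv (sibuya m a lam) 0 - (- (lam powr (1/4) * exp (Lint m a lam))))
        \<le> C * norm lam powr (- (1/2 + 1 / real m)) * norm (lam powr (1/4) * exp (Lint m a lam))"
proof -
  note m = \<open>m \<ge> 3\<close>
  have m1: "m \<ge> 1" "m \<ge> 2" using m by auto
  have "pi / (real m + 2) \<le> pi" by (simp add: field_simps)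
  then have dpi: "\<delta> \<le> pi" using assms(3) by linarith
  obtain A where A: "A \<ge> 1" "\<And>a i. a \<in> K \<Longrightarrow> i \<in> {1..m} \<Longrightarrow> norm (a i) \<le> A"
    using compact_coordinates_bounded[OF assms(4), of m] by blast
  obtain c D R0 where c: "c > 0" and R0: "R0 \<ge> 1" and D: "D \<ge> 0"
   and pb: "\<And>a lam x. (\<And>i. i \<in> {1..m} \<Longrightarrow> norm (a i) \<le> A) \<Longrightarrow> norm lam \<ge> R0 \<Longrightarrow> \<bar>Arg lam\<bar> \<le> pi - \<delta> \<Longrightarrow> (x::real) \<ge> 0 \<Longrightarrow>
      pot_bound m c D a lam x"
    by (rule pot_bounds[OF m1(1) assms(2) dpi A(1)]) blast
  define Ch where "Ch = D / c powr (3/2) + D ^ 2 / c powr (5/2)"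
  \<comment> \<open>Bounds, up to the factor \<open>E\<close>, the correction q'/(4 S^3) in
    \<open>B\<close> at 0.\<close>
  define Cr where "Cr = D / c powr (3/2)"
  have Ch: "Ch \<ge> 0" and Cr: "Cr \<ge> 0" using D c by (auto simp: Ch_def Cr_def)
  \<comment> \<open>16 Ch^2 yields \<open>Ch * E \<le> 1 / 4\<close>; the last two entries provide
    the hypotheses of \<open>Ln_perturbation\<close> for \<open>lam + a m\<close>.\<close>
  define R where "R = max R0 (max (16 * Ch\<^sup>2) (max (4 * A) (2 * A / \<delta> + 1)))"
  \<comment> \<open>The constant of the derivative estimate, 2 (8 Ch + 2 Cr) + 2 A; it dominates 8
    Ch + 2 A for the value.\<close>
  define C where "C = 16 * Ch + 4 * Cr + 2 * A"
  have "norm (sibuya m a lam 0 - lam powr (-1/4) * exp (Lint m a lam))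
        \<le> C * norm lam powr (- (1/2 + 1 / real m)) * norm (lam powr (-1/4) * exp (Lint m a lam))
    \<and> norm (deriv (sibuya m a lam) 0 - (- (lam powr (1/4) * exp (Lint m a lam))))
        \<le> C * norm lam powr (- (1/2 + 1 / real m)) * norm (lam powr (1/4) * exp (Lint m a lam))"
    if a: "a \<in> K" and lam: "norm lam \<ge> R" "\<bar>Arg lam\<bar> \<le> pi - \<delta>" for a lam
  proof -
    let ?q = "pot m a lam"
    have lR: "norm lam \<ge> R0" "norm lam \<ge> 16 * Ch\<^sup>2" "norm lam \<ge> 4 * A" "norm lam \<ge> 2 * A / \<delta> + 1" "norm lam \<ge> 1"
      using lam(1) R0 by (auto simp: R_def)
    have lam0: "lam \<noteq> 0" using lR by auto
    define \<Lambda> where "\<Lambda> = norm lam powr (1 / real m)"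
    have L: "\<Lambda> \<ge> 1" unfolding \<Lambda>_def using lR by (intro ge_one_powr_ge_zero) auto
    note b = pb[of a lam, OF A(2)[OF a] lR(1) lam(2), folded \<Lambda>_def]
    have q0: "poly ?q (of_real x) \<notin> \<real>\<^sub>\<le>\<^sub>0"
      and ql: "norm (poly ?q (of_real x)) \<ge> c * (x + \<Lambda>) ^ m"
      and q1: "norm (poly (pderiv ?q) (of_real x)) \<le> D * (x + \<Lambda>) ^ (m - 1)"
      and q2: "norm (poly (pderiv (pderiv ?q)) (of_real x)) \<le> D * (x + \<Lambda>) ^ (m - 2)" if "x \<ge> 0" for x :: real
      using b[OF _ that] by blast+
    define E where "E = norm lam powr (- (1/2 + 1 / real m))"
    \<comment> \<open>The exponent \<rho> of the theorem appears here, from \<Lambda> =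
      |lam|^(1/m).\<close>
    have LE: "\<Lambda> powr - (real m / 2 + 1) = E"
    proof -
      have "1 / real m * - (real m / 2 + 1) = - (1/2 + 1 / real m)" using m by (simp add: field_simps)
      then show ?thesis unfolding \<Lambda>_def E_def powr_powr by simp
    qed
    have E0: "E > 0" using lam0 by (simp add: E_def)
    \<comment> \<open>As 1/2 + 1/m \<le> 1, the relative error of order 1/|lam| from replacing the
      potential at 0 by \<open>lam\<close> is absorbed in \<open>E\<close>.\<close>
    have El: "1 / norm lam \<le> E"
    proof -
      have "norm lam powr (- 1) \<le> E" unfolding E_def using lR m by (intro powr_mono) (auto simp: field_simps)
      then show ?thesis using lam0 by (simp add: powr_minus_divide)
    qed
    have CE: "Ch * E \<le> 1 / 4"
    proof -
      have "E \<le> norm lam powr (- (1/2))" unfolding E_def using lR by (intro powr_mono) auto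
      also have "\<dots> = 1 / sqrt (norm lam)" using lam0 by (simp add: powr_minus_divide powr_half_sqrt)
      finally have 1: "Ch * E \<le> Ch * (1 / sqrt (norm lam))" using Ch by (intro mult_left_mono)
      have "sqrt (16 * Ch\<^sup>2) \<le> sqrt (norm lam)" using lR(2) by (rule real_sqrt_le_mono)
      then have "4 * Ch \<le> sqrt (norm lam)" using Ch by (simp add: real_sqrt_mult)
      then have "Ch * (1 / sqrt (norm lam)) \<le> 1 / 4" using lam0 by (simp add: pos_divide_le_eq)
      then show ?thesis using 1 by linarith
    qed
    have small: "(D / c powr (3/2) + D ^ 2 / c powr (5/2)) * \<Lambda> powr - (real m / 2 + 1) \<le> 1/4"
      unfolding LE using CE by (simp add: Ch_def)
    have uniq: "y = w \<and> y' = w'" if "subdominant m a lam y y'" "subdominant m a lam w w'" for y y' w w'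
      by (rule subdominant_unique[OF m L c q0 ql q1 q2 small that])
    obtain g where g: "sibuya_sol m a lam g" using sibuya_sol_exists[OF m uniq] by blast
    \<comment> \<open>Every Sibuya solution is subdominant, so there is exactly one and the definite
      description denotes it.\<close>
    have "h = g" if "sibuya_sol m a lam h" for h
      using uniq[OF sibuya_sol_subdominant[OF that] sibuya_sol_subdominant[OF g]] by simp
    then have sg: "sibuya m a lam = g" unfolding sibuya_def using g by (intro the_equality)
    have sd: "subdominant m a lam g (deriv g)" by (rule sibuya_sol_subdominant[OF g])
    then have sol: "solves ?q g (deriv g)" and l1: "(\<lambda>n. g (of_nat n) / asym0 m a (of_nat n)) \<longlonglongrightarrow> 1"
      and l2: "(\<lambda>n. deriv g (of_nat n) / asym1 m a (of_nat n)) \<longlonglongrightarrow> - 1" by (auto simp: subdominant_def)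
    define X where "X = exp (Lint m a lam)"
    have "(\<lambda>n. lgU ?q g (real n)) \<longlonglongrightarrow> X" and "(\<lambda>n. lgB ?q g (deriv g) (real n)) \<longlonglongrightarrow> 0"
      using lgU_lgB_limit[OF m q0 l1 l2] by (simp_all add: X_def)
    note hl = half_line_estimate[OF m1(2) L c q0 ql q1 q2 solvesD(1)[OF sol] solvesD(2)[OF sol] this small, folded Ch_def, unfolded LE]
    define U where "U = lgU ?q g 0"
    define B where "B = lgB ?q g (deriv g) 0"
    have U: "norm (U - X) \<le> norm X * (4 * (Ch * E))" and B: "norm B \<le> norm X * (2 * (Ch * E))"
      using hl by (simp_all add: U_def B_def mult_ac)
    define \<mu> where "\<mu> = lam + a m"
    have q00: "poly ?q 0 = \<mu>"
    proof -
      have "poly (Ppoly m a) 0 = coeff (Ppoly m a) 0" by (simp add: poly_0_coeff_0)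
      then show ?thesis using m1 by (simp add: poly_pot \<mu>_def coeff_Ppoly)
    qed
    have am: "norm (a m) \<le> A" using A(2)[OF a, of m] m1 by simp
    have "2 * A / \<delta> < norm lam" using lR(4) by linarith
    then have "2 * A < \<delta> * norm lam" using assms(2) by (simp add: pos_divide_less_eq mult.commute)
    then have "norm (Ln \<mu> - Ln lam) \<le> 2 * norm (a m) / norm lam"
      unfolding \<mu>_def using am lR(3) by (intro Ln_perturbation[OF lam0 lam(2)]) auto
    also have "\<dots> \<le> 2 * A * (1 / norm lam)" using am by (simp add: divide_right_mono)
    finally have Ln: "norm (Ln \<mu> - Ln lam) \<le> 2 * A * (1 / norm lam)" .
    define \<eta> where "\<eta> = A * (1 / norm lam)"
    have Al: "0 \<le> \<eta>" "\<eta> \<le> 1 / 4" using lR(3) lam0 A(1) by (simp_all add: \<eta>_def pos_divide_le_eq)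
    have AE: "\<eta> \<le> A * E" using El A(1) unfolding \<eta>_def by (intro mult_left_mono) auto
    \<comment> \<open>exp x is a fourth root of \<mu>/lam on the branch for which R(0) = lam^(1/4)
      exp x.\<close>
    define x where "x = (Ln \<mu> - Ln lam) / 4"
    define \<sigma> where "\<sigma> = exp x"
    have \<sigma>': "1 / \<sigma> = exp (- x)" by (simp only: \<sigma>_def exp_minus inverse_eq_divide)
    have "norm x = norm (Ln \<mu> - Ln lam) / 4" by (simp add: x_def norm_divide)
    moreover have "norm (Ln \<mu> - Ln lam) \<le> 2 * \<eta>" using Ln by (simp add: \<eta>_def)
    ultimately have n4: "norm x \<le> \<eta> / 2" by linarith
    have n1: "norm x \<le> 1" "norm (- x) \<le> 1" using n4 Al by simp_all
    have s1: "norm (\<sigma> - 1) \<le> 2 * \<eta>" using exp_diff_1_bound[OF n1(1)] n4 Al unfolding \<sigma>_def by linarith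
    have s1': "norm (1 / \<sigma> - 1) \<le> 2 * \<eta>" using exp_diff_1_bound[OF n1(2)] n4 Al unfolding \<sigma>' norm_minus_cancel by linarith
    have sE: "norm (\<sigma> - 1) \<le> 2 * A * E" "norm (1 / \<sigma> - 1) \<le> 2 * A * E" using s1 s1' AE by simp_all
    have s2: "norm \<sigma> \<le> 2" "norm (1 / \<sigma>) \<le> 2"
    proof -
      show "norm \<sigma> \<le> 2" using s1 Al norm_triangle_ineq2[of \<sigma> 1, unfolded norm_one] by linarith
      show "norm (1 / \<sigma>) \<le> 2" using s1' Al norm_triangle_ineq2[of "1 / \<sigma>" 1, unfolded norm_one] by linarith
    qed
    have s0: "\<sigma> \<noteq> 0" by (simp add: \<sigma>_def)
    have R4: "lgR ?q 0 = lam powr (1/4) * \<sigma>"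
    proof -
      have "lgR ?q 0 = exp (Ln lam / 4 + x)" unfolding lgR_def q00 by (simp add: x_def diff_divide_distrib)
      then show ?thesis unfolding exp_add \<sigma>_def powr_def using lam0 by simp
    qed
    have lp: "lam powr (-1/4) * lam powr (1/4) = 1"
      using lam0 by (simp add: powr_def exp_add[symmetric])
    have lpn: "lam powr (1/4) \<noteq> 0" using lam0 by simp
    have Ug: "U = g 0 * lgR ?q 0" by (simp add: U_def lgU_def lgXi_def)
    have g0: "g 0 = lam powr (-1/4) * (U * (1 / \<sigma>))"
    proof -
      have "p * (u * (r * s) * (1 / s)) = (p * r) * u" if "s \<noteq> 0" for p u r s :: complex
        using that by simp
      from this[OF s0] show ?thesis unfolding Ug R4 by (simp only: lp mult_1)
    qed
    have "g 0 - lam powr (-1/4) * X = lam powr (-1/4) * ((U - X) * (1 / \<sigma>) + X * (1 / \<sigma> - 1))"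
    proof -
      have "p * (u * i) - p * v = p * ((u - v) * i + v * (i - 1))" for p u v i :: complex
        by (simp add: algebra_simps)
      then show ?thesis unfolding g0 .
    qed
    then have "norm (g 0 - lam powr (-1/4) * X) = norm (lam powr (-1/4)) * norm ((U - X) * (1 / \<sigma>) + X * (1 / \<sigma> - 1))"
      by (simp only: norm_mult)
    also have "\<dots> \<le> norm (lam powr (-1/4)) * (C * E * norm X)"
    proof (rule mult_left_mono)
      have "norm ((U - X) * (1 / \<sigma>) + X * (1 / \<sigma> - 1)) \<le> norm (U - X) * norm (1 / \<sigma>) + norm X * norm (1 / \<sigma> - 1)"
        by (rule order_trans[OF norm_triangle_ineq]) (simp only: norm_mult order_refl)
      also have "\<dots> \<le> norm X * (4 * (Ch * E)) * 2 + norm X * (2 * A * E)"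
        using U sE s2 Ch E0 by (intro add_mono mult_mono) auto
      also have "\<dots> = (8 * Ch + 2 * A) * E * norm X" by (simp add: algebra_simps)
      also have "\<dots> \<le> C * E * norm X" using Ch Cr E0 by (intro mult_right_mono) (auto simp: C_def)
      finally show "norm ((U - X) * (1 / \<sigma>) + X * (1 / \<sigma> - 1)) \<le> C * E * norm X" .
    qed simp
    also have "\<dots> = C * E * norm (lam powr (-1/4) * X)" by (simp add: norm_mult mult_ac)
    finally have f1: "norm (g 0 - lam powr (-1/4) * X) \<le> C * E * norm (lam powr (-1/4) * X)" .
    define r where "r = poly (pderiv ?q) 0 / (4 * lgS ?q 0 ^ 3)"
    have r: "norm r \<le> Cr * E"
    proof -
      have qn0: "poly ?q 0 \<noteq> 0" using q0[of 0] by auto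
      have "(c * \<Lambda> ^ m) powr (3/2) \<le> norm (poly ?q 0) powr (3/2)" using ql[of 0] c L by (intro powr_mono2) auto
      also have "\<dots> = norm (lgS ?q 0) ^ 3" unfolding norm_lgS[OF qn0] using qn0 by (simp add: powr_powr flip: powr_realpow)
      also have "\<dots> \<le> norm (4 * lgS ?q 0 ^ 3)" by (simp add: norm_mult norm_power)
      finally have S: "(c * \<Lambda> ^ m) powr (3/2) \<le> norm (4 * lgS ?q 0 ^ 3)" .
      have "norm r \<le> D * \<Lambda> ^ (m - 1) / (c * \<Lambda> ^ m) powr (3/2)"
        unfolding r_def norm_divide using q1[of 0] S c L D by (intro frac_le) auto
      also have "(c * \<Lambda> ^ m) powr (3/2) = c powr (3/2) * \<Lambda> powr (real m * (3/2))"
        using c L by (simp add: powr_mult powr_powr flip: powr_realpow)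
      also have "\<Lambda> ^ (m - 1) = \<Lambda> powr (real m - 1)" using L m1 by (simp add: of_nat_diff flip: powr_realpow)
      also have "D * \<Lambda> powr (real m - 1) / (c powr (3/2) * \<Lambda> powr (real m * (3/2))) = Cr * \<Lambda> powr (real m - 1 - real m * (3/2))"
        unfolding powr_diff[of _ "real m - 1"] by (simp add: Cr_def)
      also have "real m - 1 - real m * (3/2) = - (real m / 2 + 1)" by (simp add: field_simps)
      finally show ?thesis unfolding LE .
    qed
    define V where "V = deriv g 0 * lgR ?q 0 / lgS ?q 0"
    have "B = - (V + (1 + r) * U) / 2" by (simp add: B_def V_def r_def lgB_def U_def lgXi_def)
    then have V: "V + X = - (2 * B + (U - X) + r * U)" by (simp add: algebra_simps)
    have nU: "norm U \<le> 2 * norm X"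
    proof -
      have "norm U \<le> norm X + norm (U - X)" using norm_triangle_ineq2[of U X] by simp
      also have "norm (U - X) \<le> norm X * (4 * (1 / 4))" using U CE by (smt (verit) mult_left_mono norm_ge_zero)
      finally show ?thesis by simp
    qed
    have "norm (V + X) \<le> norm (2 * B + (U - X)) + norm (r * U)"
      unfolding V norm_minus_cancel by (rule norm_triangle_ineq)
    also have "\<dots> \<le> (2 * norm B + norm (U - X)) + norm r * norm U"
      using norm_triangle_ineq[of "2 * B" "U - X"] by (simp add: norm_mult)
    also have "\<dots> \<le> (2 * (norm X * (2 * (Ch * E))) + norm X * (4 * (Ch * E))) + (Cr * E) * (2 * norm X)"
      using U B r nU Cr E0 by (intro add_mono mult_mono) auto
    also have "\<dots> = (8 * Ch + 2 * Cr) * E * norm X" by (simp add: algebra_simps)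
    finally have V1: "norm (V + X) \<le> (8 * Ch + 2 * Cr) * E * norm X" .
    have S4: "lgS ?q 0 = lgR ?q 0 * lgR ?q 0" by (simp add: lgS_def lgR_def exp_add[symmetric])
    \<comment> \<open>As S(0) = R(0)^2, the quotient in \<open>V\<close> leaves y'(0)/R(0), so y'(0)
      = V R(0).\<close>
    have d0: "deriv g 0 = lam powr (1/4) * (V * \<sigma>)"
    proof -
      have "u = p * (u * (p * s) / ((p * s) * (p * s)) * s)" if "s \<noteq> 0" "p \<noteq> 0" for p u s :: complex
        using that by (simp add: field_simps)
      from this[OF s0 lpn] show ?thesis unfolding V_def S4 unfolding R4 .
    qed
    have "deriv g 0 - (- (lam powr (1/4) * X)) = lam powr (1/4) * ((V + X) * \<sigma> - X * (\<sigma> - 1))"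
    proof -
      have "p * (u * s) - (- (p * v)) = p * ((u + v) * s - v * (s - 1))" for p u v s :: complex
        by (simp add: algebra_simps)
      then show ?thesis unfolding d0 .
    qed
    then have "norm (deriv g 0 - (- (lam powr (1/4) * X))) = norm (lam powr (1/4)) * norm ((V + X) * \<sigma> - X * (\<sigma> - 1))"
      by (simp only: norm_mult)
    also have "\<dots> \<le> norm (lam powr (1/4)) * (C * E * norm X)"
    proof (rule mult_left_mono)
      have "norm ((V + X) * \<sigma> - X * (\<sigma> - 1)) \<le> norm (V + X) * norm \<sigma> + norm X * norm (\<sigma> - 1)"
        by (rule order_trans[OF norm_triangle_ineq4]) (simp only: norm_mult order_refl)
      also have "\<dots> \<le> (8 * Ch + 2 * Cr) * E * norm X * 2 + norm X * (2 * A * E)"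
        using V1 sE s2 Ch Cr E0 by (intro add_mono mult_mono) auto
      also have "\<dots> = C * E * norm X" by (simp add: C_def algebra_simps)
      finally show "norm ((V + X) * \<sigma> - X * (\<sigma> - 1)) \<le> C * E * norm X" .
    qed simp
    also have "\<dots> = C * E * norm (lam powr (1/4) * X)" by (simp add: norm_mult mult_ac)
    finally have f2: "norm (deriv g 0 - (- (lam powr (1/4) * X))) \<le> C * E * norm (lam powr (1/4) * X)" .
    show ?thesis unfolding sg X_def[symmetric] E_def[symmetric] using f1 f2 by (rule conjI)
  qed
  then show ?thesis by blast
qed

end
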